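(* Let $\sigma\in(0,1)$, $\alpha\in(0,1)$, $\theta>0$, let $\lambda(s)=\alpha s^{-\alpha-1}(1-s)^{\theta+\alpha-1}$ on $(0,1)$, and let $\mathbf{Z}$ be generated by the BFRY urn scheme with these parameters, described in the context. Then: 1. $\mathbf{Z}$ is equivalently distributed to the random matrix obtained as follows: let $\zeta\sim\mathrm{BFRY}(\sigma)$; given $\zeta$, let $(J_k)_{k\in\mathbb{N}}$ be the jumps of a subordinator with Lévy density $\zeta\lambda$ (the points of a Poisson process on $(0,1)$ with intensity $\zeta\lambda(s)\,ds$), i.e. the weights of the random measure $\mu=\sum_kJ_k\delta_{U_k}$ with $(U_k)$ i.i.d. and independent of the weights; and, given $(J_k)$, generate the entries of column $k$ as i.i.d. $\mathrm{Bernoulli}(J_k)$ variables, independently across columns. 2. For each $n\in\mathbb{N}$, the total number $K_n$ of features selected in the first $n$ rows of $\mathbf{Z}$ has marginal distribution $K_n\sim\mathrm{Poisson\text{-}BFRY}\bigl(\sigma,\sum_{j\le n}\phi_j\bigr)$. In particular, $K_n$ exhibits a power law.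
   Context: Definitions. For $\sigma\in(0,1)$, $\mathrm{BFRY}(\sigma)$ is the law on $(0,\infty)$ with density $\frac{\sigma}{\Gamma(1-\sigma)}z^{-\sigma-1}(1-e^{-z})$; equivalently the law of $G/\beta$ for independent $G\sim\mathrm{Gamma}(1-\sigma,1)$ and $\beta\sim\mathrm{Beta}(\sigma,1)$. $K\sim\mathrm{Poisson\text{-}BFRY}(\sigma,\tau)$, $\tau>0$, means $K|\zeta\sim\mathrm{Poisson}(\tau\zeta)$ with $\zeta\sim\mathrm{BFRY}(\sigma)$. "Exhibits a power law" means that $\mathbb{P}(K_n=j)$ decays polynomially in $j$, i.e. $\mathbb{P}(K_n=j)\sim Cj^{-\gamma}$ as $j\to\infty$ for some constants $C>0,\gamma>1$. For a binary matrix $\mathbf{Z}$ put $n_k:=\sum_{i=1}^n\mathbf{Z}_{ik}$ and $K_n:=\sum_k\mathbb{I}\{n_k>0\}$ (based on the first $n$ rows). Each column encodes the set of row indices at which it is non-zero, so $\mathbf{Z}$ encodes a family of sets. Two matrices are equivalent if they encode the same family (i.e. agree up to reordering columns and discarding zero columns); $[\mathbf{Z}]$ is the equivalence class, and $\mathbf{Z}_1,\mathbf{Z}_2$ are equivalently distributed if $[\mathbf{Z}_1]\stackrel{d}{=}[\mathbf{Z}_2]$. BFRY urn scheme. Let $$\phi_k:=\int_0^1 s(1-s)^{k-1}\lambda(s)\,ds=\frac{\alpha\,\Gamma(\theta+\alpha+k-1)\Gamma(1-\alpha)}{\Gamma(\theta+k)},\qquad f(x,a,b):=\bigl(xa^b+(1-x)(1+a)^b\bigr)^{-1/b}.$$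 Let $V_1,V_2,\ldots$ be i.i.d. $\mathrm{Uniform}[0,1]$. (i) The first row has $H_1\sim\mathrm{Poisson}(\zeta\phi_1)$ consecutive non-zero entries, where $\zeta\sim\mathrm{BFRY}(\sigma)$. (ii) In row $n+1$ ($n\ge1$), given the first $n$ rows, each of the first $K_n$ entries is non-zero independently with probability $\frac{n_k-\alpha}{\theta+n}$, $k=1,\ldots,K_n$. Additionally, independently of these entries, append $H_{n+1}$ consecutive non-zero entries, where $$H_{n+1}\,|\,K_n\ \sim\ \mathrm{Poisson}\Bigl(G_{n+1}\,\phi_{n+1}\,f\bigl(V_n,\textstyle\sum_{j\le n}\phi_j,\ \sigma-K_n\bigr)\Bigr),\qquad G_{n+1}\sim\mathrm{Gamma}(1-\sigma+K_n,1),$$ with $G_{n+1}$ and $V_n$ independent given $K_n$, and fresh at each step. *)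

theory Defs
  imports "HOL-Probability.Probability" "HOL-Library.Landau_Symbols"
begin

subsection \<open>Conditional distributions\<close>

text \<open>The random element \<open>Y\<close>, with values in \<open>L\<close>, has the regular conditional distribution
  \<open>\<kappa>\<close> given the sub-sigma-algebra \<open>F\<close>.  Since a version of the conditional expectation is
  \<open>F\<close>-measurable, the condition also says that \<open>\<kappa>\<close> is, up to null sets, a function of the
  information in \<open>F\<close>.\<close>

definition cond_distributed ::
  "'a measure \<Rightarrow> 'a measure \<Rightarrow> 'b measure \<Rightarrow> ('a \<Rightarrow> 'b) \<Rightarrow> ('a \<Rightarrow> 'b measure) \<Rightarrow> bool" where
  "cond_distributed M F L Y \<kappa> \<longleftrightarrow>
     subalgebra M F \<and> Y \<in> measurable M L \<and>
     (\<forall>B\<in>sets L. AE \<omega> in M.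
        real_cond_exp M F (indicator (Y -` B \<inter> space M)) \<omega> = measure (\<kappa> \<omega>) B)"

abbreviation generated_by :: "'a measure \<Rightarrow> 'b measure \<Rightarrow> ('a \<Rightarrow> 'b) \<Rightarrow> 'a measure" where
  "generated_by M N X \<equiv> vimage_algebra (space M) X N"


subsection \<open>Probability laws\<close>

definition BFRY_density :: "real \<Rightarrow> real \<Rightarrow> real" where
  "BFRY_density \<sigma> z =
     (if 0 < z then \<sigma> / Gamma (1 - \<sigma>) * z powr (- \<sigma> - 1) * (1 - exp (- z)) else 0)"

definition BFRY :: "real \<Rightarrow> real measure" where
  "BFRY \<sigma> = density lborel (\<lambda>z. ennreal (BFRY_density \<sigma> z))"

definition Gamma_law :: "real \<Rightarrow> real measure" where
  "Gamma_law a =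
     density lborel (\<lambda>x. ennreal (if 0 < x then x powr (a - 1) * exp (- x) / Gamma a else 0))"

text \<open>The law of \<open>K\<close> when \<open>\<zeta>\<close> has law \<open>BFRY \<sigma>\<close> and \<open>K\<close> given \<open>\<zeta>\<close> is Poisson with mean
  \<open>\<tau> * \<zeta>\<close>, written as a mixture.\<close>

definition Poisson_BFRY :: "real \<Rightarrow> real \<Rightarrow> nat measure" where
  "Poisson_BFRY \<sigma> \<tau> =
     density (count_space UNIV) (\<lambda>k. \<integral>\<^sup>+ z. ennreal (pmf (poisson_pmf (\<tau> * z)) k) \<partial>BFRY \<sigma>)"

text \<open>Here \<open>p j\<close> is the probability of the value \<open>j\<close>.\<close>

definition exhibits_power_law :: "(nat \<Rightarrow> real) \<Rightarrow> bool" where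
  "exhibits_power_law p \<longleftrightarrow>
     (\<exists>C>0. \<exists>\<gamma>>1. p \<sim>[at_top] (\<lambda>j. C * real j powr (- \<gamma>)))"


subsection \<open>Poisson processes\<close>

text \<open>The library's \<^term>\<open>poisson_pmf r\<close> is unspecified unless \<open>r > 0\<close>.  The intensity
  measure of a Poisson process may assign mass \<open>0\<close> or \<open>\<infinity>\<close> to a set, which then contains
  almost surely no, respectively infinitely many, points.\<close>

definition extended_poisson_pmf :: "ennreal \<Rightarrow> enat pmf" where
  "extended_poisson_pmf r =
     (if r = 0 then return_pmf 0
      else if r = \<infinity> then return_pmf \<infinity>
      else map_pmf enat (poisson_pmf (enn2real r)))"

definition num_points :: "(nat \<Rightarrow> real) \<Rightarrow> real set \<Rightarrow> enat" where
  "num_points x A = (if finite {k. x k \<in> A} then enat (card {k. x k \<in> A}) else \<infinity>)"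

text \<open>Given \<open>F\<close>, the points \<open>J 0, J 1, \<dots>\<close> (in an arbitrary enumeration) form a Poisson process
  with intensity measure \<open>\<Lambda>\<close>, which may be random through \<open>F\<close>.\<close>

definition cond_poisson_process ::
  "'a measure \<Rightarrow> 'a measure \<Rightarrow> (nat \<Rightarrow> 'a \<Rightarrow> real) \<Rightarrow> ('a \<Rightarrow> real measure) \<Rightarrow> bool" where
  "cond_poisson_process M F J \<Lambda> \<longleftrightarrow>
     (\<forall>k. J k \<in> borel_measurable M) \<and>
     (\<forall>(m::nat) A. (\<forall>i<m. A i \<in> sets borel) \<and> disjoint_family_on A {..<m} \<longrightarrow>
        cond_distributed M F (PiM {..<m} (\<lambda>_. count_space UNIV))
          (\<lambda>\<omega>. \<lambda>i\<in>{..<m}. num_points (\<lambda>k. J k \<omega>) (A i))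
          (\<lambda>\<omega>. PiM {..<m} (\<lambda>i. measure_pmf (extended_poisson_pmf (emeasure (\<Lambda> \<omega>) (A i))))))"


subsection \<open>Binary matrices\<close>

text \<open>Rows and columns are indexed from \<open>0\<close>: \<open>Z i k\<close> is the entry in row \<open>i\<close> and column \<open>k\<close>, the
  first \<open>n\<close> rows are those with index below \<open>n\<close>, and row \<open>n\<close> is the row that follows them.
  A matrix with finitely many columns is padded with zero columns.\<close>

type_synonym binary_matrix = "nat \<Rightarrow> nat \<Rightarrow> bool"

definition matrix_space :: "binary_matrix measure" where
  "matrix_space = PiM UNIV (\<lambda>_. PiM UNIV (\<lambda>_. count_space UNIV))"

definition column_count :: "binary_matrix \<Rightarrow> nat \<Rightarrow> nat \<Rightarrow> nat" where
  "column_count Z n k = (\<Sum>i<n. of_bool (Z i k))"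

text \<open>Only used for matrices in which finitely many columns are selected in the first \<open>n\<close> rows.\<close>

definition num_features :: "binary_matrix \<Rightarrow> nat \<Rightarrow> nat" where
  "num_features Z n = card {k. column_count Z n k > 0}"

definition first_rows :: "nat \<Rightarrow> binary_matrix \<Rightarrow> binary_matrix" where
  "first_rows n Z = (\<lambda>i k. i < n \<and> Z i k)"

definition nonzero_columns :: "binary_matrix \<Rightarrow> nat set" where
  "nonzero_columns Z = {k. \<exists>i. Z i k}"

definition matrix_equiv :: "(binary_matrix \<times> binary_matrix) set" where
  "matrix_equiv = {(Z, W). \<exists>\<pi>. bij_betw \<pi> (nonzero_columns Z) (nonzero_columns W) \<and>
     (\<forall>k\<in>nonzero_columns Z. \<forall>i. W i (\<pi> k) = Z i k)}"

definition matrix_class :: "binary_matrix \<Rightarrow> binary_matrix set" where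
  "matrix_class Z = matrix_equiv `` {Z}"

text \<open>Equivalence classes carry the quotient sigma-algebra, the largest one for which
  \<open>matrix_class\<close> is measurable.\<close>

definition class_space :: "binary_matrix set measure" where
  "class_space =
     sigma (UNIV // matrix_equiv)
       {A. A \<subseteq> UNIV // matrix_equiv \<and> matrix_class -` A \<in> sets matrix_space}"

definition equivalently_distributed ::
  "'a measure \<Rightarrow> ('a \<Rightarrow> binary_matrix) \<Rightarrow> 'b measure \<Rightarrow> ('b \<Rightarrow> binary_matrix) \<Rightarrow> bool" where
  "equivalently_distributed M Z N W \<longleftrightarrow>
     distr M class_space (\<lambda>\<omega>. matrix_class (Z \<omega>)) =
     distr N class_space (\<lambda>\<omega>. matrix_class (W \<omega>))"


subsection \<open>The BFRY urn scheme\<close>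

definition levy_density :: "real \<Rightarrow> real \<Rightarrow> real \<Rightarrow> real" where
  "levy_density \<alpha> \<theta> s =
     (if 0 < s \<and> s < 1 then \<alpha> * s powr (- \<alpha> - 1) * (1 - s) powr (\<theta> + \<alpha> - 1) else 0)"

text \<open>Used for \<open>k \<ge> 1\<close> only.\<close>

definition phi :: "real \<Rightarrow> real \<Rightarrow> nat \<Rightarrow> real" where
  "phi \<alpha> \<theta> k = (LINT s:{0<..<1}|lborel. s * (1 - s) ^ (k - 1) * levy_density \<alpha> \<theta> s)"

definition bfry_f :: "real \<Rightarrow> real \<Rightarrow> real \<Rightarrow> real" where
  "bfry_f x a b = (x * a powr b + (1 - x) * (1 + a) powr b) powr (- 1 / b)"

text \<open>\<open>H n\<close> is the number of new features in the \<open>n\<close>-th row, counting rows from \<open>1\<close>.  The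
  variables \<open>H n\<close>, \<open>V n\<close> are used for \<open>n \<ge> 1\<close> and \<open>G n\<close> for \<open>n \<ge> 2\<close>.  Freshness at each step
  means that the conditional laws are those given everything generated before.\<close>

locale BFRY_urn = prob_space M
  for M :: "'a measure" and \<sigma> \<alpha> \<theta> :: real +
  fixes \<zeta> :: "'a \<Rightarrow> real"
    and G V :: "nat \<Rightarrow> 'a \<Rightarrow> real"
    and H :: "nat \<Rightarrow> 'a \<Rightarrow> nat"
    and Z :: "'a \<Rightarrow> binary_matrix"
    and history :: "nat \<Rightarrow> 'a \<Rightarrow>
      real \<times> (nat \<Rightarrow> real) \<times> (nat \<Rightarrow> real) \<times> (nat \<Rightarrow> nat) \<times> binary_matrix"
    and history_space :: "nat \<Rightarrow>
      (real \<times> (nat \<Rightarrow> real) \<times> (nat \<Rightarrow> real) \<times> (nat \<Rightarrow> nat) \<times> binary_matrix) measure"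
  defines "history n \<omega> \<equiv>
      (\<zeta> \<omega>, \<lambda>j\<in>{2..n}. G j \<omega>, \<lambda>j\<in>{1..<n}. V j \<omega>, \<lambda>j\<in>{1..n}. H j \<omega>, first_rows n (Z \<omega>))"
    and "history_space n \<equiv>
      borel \<Otimes>\<^sub>M PiM {2..n} (\<lambda>_. borel) \<Otimes>\<^sub>M PiM {1..<n} (\<lambda>_. borel) \<Otimes>\<^sub>M
      PiM {1..n} (\<lambda>_. count_space UNIV) \<Otimes>\<^sub>M matrix_space"
  assumes Z_measurable: "Z \<in> measurable M matrix_space"
    and zeta_law: "distributed M lborel \<zeta> (\<lambda>z. ennreal (BFRY_density \<sigma> z))"
    and H_first: "cond_distributed M (generated_by M borel \<zeta>) (count_space UNIV) (H 1)
      (\<lambda>\<omega>. measure_pmf (poisson_pmf (\<zeta> \<omega> * phi \<alpha> \<theta> 1)))"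
    and row_first: "AE \<omega> in M. \<forall>k. Z \<omega> 0 k \<longleftrightarrow> k < H 1 \<omega>"
    and GV_next: "n \<ge> 1 \<Longrightarrow>
      cond_distributed M (generated_by M (history_space n) (history n))
        (borel \<Otimes>\<^sub>M borel) (\<lambda>\<omega>. (G (n + 1) \<omega>, V n \<omega>))
        (\<lambda>\<omega>. Gamma_law (1 - \<sigma> + real (num_features (Z \<omega>) n)) \<Otimes>\<^sub>M
              uniform_measure lborel {0..1})"
    and H_next: "n \<ge> 1 \<Longrightarrow>
      cond_distributed M
        (generated_by M (borel \<Otimes>\<^sub>M borel \<Otimes>\<^sub>M history_space n)
          (\<lambda>\<omega>. (G (n + 1) \<omega>, V n \<omega>, history n \<omega>)))
        (count_space UNIV) (H (n + 1))
        (\<lambda>\<omega>. measure_pmf (poisson_pmf (G (n + 1) \<omega> * phi \<alpha> \<theta> (n + 1) *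
           bfry_f (V n \<omega>) (\<Sum>j=1..n. phi \<alpha> \<theta> j) (\<sigma> - real (num_features (Z \<omega>) n)))))"
    and row_next: "n \<ge> 1 \<Longrightarrow>
      cond_distributed M
        (generated_by M (count_space UNIV \<Otimes>\<^sub>M borel \<Otimes>\<^sub>M borel \<Otimes>\<^sub>M history_space n)
          (\<lambda>\<omega>. (H (n + 1) \<omega>, G (n + 1) \<omega>, V n \<omega>, history n \<omega>)))
        (PiM UNIV (\<lambda>_. count_space UNIV)) (\<lambda>\<omega>. Z \<omega> n)
        (\<lambda>\<omega>. PiM UNIV (\<lambda>k. measure_pmf
           (if k < num_features (Z \<omega>) n
            then bernoulli_pmf ((real (column_count (Z \<omega>) n k) - \<alpha>) / (\<theta> + real n))
            else return_pmf (k < num_features (Z \<omega>) n + H (n + 1) \<omega>))))"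


subsection \<open>The feature model with a random Levy density\<close>

text \<open>The intensity of the Poisson process vanishes off \<open>(0,1)\<close>, so almost surely all \<open>J k\<close> lie
  in \<open>(0,1)\<close>.\<close>

locale BFRY_feature_model = prob_space M
  for M :: "'a measure" and \<sigma> \<alpha> \<theta> :: real +
  fixes \<zeta> :: "'a \<Rightarrow> real"
    and J :: "nat \<Rightarrow> 'a \<Rightarrow> real"
    and Z :: "'a \<Rightarrow> binary_matrix"
  assumes zeta_law: "distributed M lborel \<zeta> (\<lambda>z. ennreal (BFRY_density \<sigma> z))"
    and jumps: "cond_poisson_process M (generated_by M borel \<zeta>) J
      (\<lambda>\<omega>. density lborel (\<lambda>s. ennreal (\<zeta> \<omega> * levy_density \<alpha> \<theta> s)))"
    and entries: "cond_distributed M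
      (generated_by M (PiM UNIV (\<lambda>_. borel)) (\<lambda>\<omega> k. J k \<omega>)) matrix_space Z
      (\<lambda>\<omega>. PiM UNIV (\<lambda>i. PiM UNIV (\<lambda>k. measure_pmf (bernoulli_pmf (J k \<omega>)))))"

end

theory Submission
  imports Defs "HOL-Real_Asymp.Real_Asymp"
begin

text \<open>The law of the first \<open>n\<close> rows up to column order is a multiset of patterns in \<open>{0,1}^n\<close>, described by
  \<open>E (\<Prod> u(pattern))\<close>, the product being over all columns.

  For the urn, \<open>\<zeta>\<close> given the first \<open>n\<close> rows should have density proportional to
  \<open>z^(j - \<sigma> - 1) (e^(- T z) - e^(- (T + 1) z))\<close>, where \<open>j = K_n\<close> and \<open>T\<close> is the sum of the \<open>\<phi>_i\<close>; this
  is precisely the law of the product of the gamma variable and \<open>f\<close>, since \<open>1/f\<close> mixes exponential tilts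
  over \<open>[T, T + 1]\<close>.  Induction on \<open>n\<close> then shows that \<open>E (1{K_n = j} \<Prod> u(pattern))\<close> is
  \<open>E (e^(- \<zeta> T) (\<zeta> S(u))^j / j!)\<close>, where \<open>S(u)\<close> integrates \<open>u\<close> against the pattern masses
  \<open>\<integral> s^a (1 - s)^(n - a) \<lambda>(s) ds\<close>.  In the feature model the Laplace functional of the Poisson process
  yields the same total \<open>E (e^(- \<zeta> (T - S(u))))\<close>.

  To recover the law from the functional, encode the multiset by the product of distinct primes attached to
  the patterns: with \<open>u = p^(- s)\<close> the functional is the \<open>s\<close>-th negative moment of the code, and these
  determine its law.  The codes for all \<open>n\<close> determine the matrix with its columns sorted
  lexicographically, a measurable representative of the equivalence class.  The power law is Stirling's formula
  for \<open>\<Gamma>(j - \<sigma>) / j!\<close>.\<close>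

subsection \<open>Integration against conditional laws\<close>

text \<open>The law of the next row involves \<open>K_n\<close> through
  \<open>\<sigma> - K_n\<close> and through the column counts, so a functional without the
  restriction to \<open>K_n = j\<close> would not close under the recursion. After its first row the
  scheme no longer consults \<open>\<zeta>\<close>: the product of the fresh gamma variable and
  \<open>f\<close> is a new draw from the law that \<open>\<zeta>\<close> has given the past. Only
  \<open>K_n\<close> matters for that law, because the likelihood of an arrangement with
  \<open>j\<close> columns depends on \<open>\<zeta>\<close> only through
  \<open>\<zeta>^j e^(- \<zeta> T)\<close>. Likewise
  \<open>(n_k - \<alpha>) / (\<theta> + n)\<close> is the mean of the beta law of a jump given its
  column, so pattern masses obey the same one-row recursion as the urn. In the feature model there
  are infinitely many jumps in an arbitrary order, so only symmetric functionals are accessible, and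
  local finiteness of the matrix has to be derived; it is transferred from the urn through the
  codes. The quotient sigma-algebra comes without an evident generator on which two laws could be
  compared, hence the detour through a representative computed from countably many integers.\<close>

lemma cond_distributed_nn_integral_indicator:
  assumes M: "prob_space M" and cd: "cond_distributed M F L Y \<kappa>"
    and \<kappa>: "\<And>\<omega>. \<omega> \<in> space M \<Longrightarrow> prob_space (\<kappa> \<omega>)"
    and sets_\<kappa>: "\<And>\<omega>. \<omega> \<in> space M \<Longrightarrow> sets (\<kappa> \<omega>) = sets L"
    and X: "X \<in> measurable F S" and A: "A \<in> sets (S \<Otimes>\<^sub>M L)"
  shows "\<exists>h\<in>borel_measurable M. (AE \<omega> in M. emeasure (\<kappa> \<omega>) (Pair (X \<omega>) -` A) = h \<omega>) \<and>
           (\<integral>\<^sup>+\<omega>. indicator A (X \<omega>, Y \<omega>) \<partial>M) = (\<integral>\<^sup>+\<omega>. h \<omega> \<partial>M)"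
    (is "?Q A")
proof -
  interpret prob_space M by fact
  have sub: "subalgebra M F" and Y[measurable]: "Y \<in> measurable M L"
    using cd by (auto simp: cond_distributed_def)
  interpret finite_measure_subalgebra M F
    using sub by unfold_locales
  have X'[measurable]: "X \<in> measurable M S"
    using measurable_from_subalg[OF sub X] .
  have sl: "Pair (X \<omega>) -` B \<in> sets (\<kappa> \<omega>)" if "\<omega> \<in> space M" "B \<in> sets (S \<Otimes>\<^sub>M L)" for \<omega> B
    using that sets_\<kappa> by (simp add: sets_Pair1)
  have sp\<kappa>: "space (\<kappa> \<omega>) = space L" if "\<omega> \<in> space M" for \<omega>
    using sets_\<kappa>[OF that] by (rule sets_eq_imp_space_eq)
  let ?G = "{a \<times> b |a b. a \<in> sets S \<and> b \<in> sets L}" and ?\<Omega> = "space S \<times> space L"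
  have A': "A \<in> sigma_sets ?\<Omega> ?G"
    using A by (simp add: sets_pair_measure)
  have sets: "sigma_sets ?\<Omega> ?G = sets (S \<Otimes>\<^sub>M L)" by (simp add: sets_pair_measure)
  show ?thesis
  \<comment> \<open>The kernel is not assumed measurable in \<omega>, and its defining identity
    holds off a null set that depends on the event. The Dynkin induction from rectangles therefore
    carries along a measurable version \<open>h\<close> of the section probabilities.\<close>
  proof (rule sigma_sets_induct_disjoint[OF Int_stable_pair_measure_generator pair_measure_closed A'])
    fix C assume "C \<in> ?G"
    then obtain a b where C: "C = a \<times> b" and a[measurable]: "a \<in> sets S" and b[measurable]: "b \<in> sets L" by auto
    let ?f = "indicator (Y -` b \<inter> space M) :: _ \<Rightarrow> real"
    let ?c = "real_cond_exp M F ?f"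
    let ?i = "\<lambda>\<omega>. indicator a (X \<omega>) :: real"
    have Fi: "?i \<in> borel_measurable F" using X by measurable
    have int: "integrable M (\<lambda>\<omega>. ?i \<omega> * ?f \<omega>)"
      by (intro integrable_const_bound[where B=1]) (auto simp: indicator_def)
    have pos: "AE \<omega> in M. 0 \<le> ?c \<omega>"
      by (intro real_cond_exp_pos) auto
    have eq: "AE \<omega> in M. ?c \<omega> = measure (\<kappa> \<omega>) b"
      using cd b unfolding cond_distributed_def by blast
    have "(\<integral>\<^sup>+\<omega>. indicator C (X \<omega>, Y \<omega>) \<partial>M) = (\<integral>\<^sup>+\<omega>. ennreal (?i \<omega> * ?f \<omega>) \<partial>M)"
      by (intro nn_integral_cong) (auto simp: C indicator_def)
    also have "\<dots> = ennreal (\<integral>\<omega>. ?i \<omega> * ?f \<omega> \<partial>M)"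
      by (intro nn_integral_eq_integral int) auto
    also have "\<dots> = ennreal (\<integral>\<omega>. ?i \<omega> * ?c \<omega> \<partial>M)"
      using real_cond_exp_intg(2)[OF int Fi] by simp
    also have "\<dots> = (\<integral>\<^sup>+\<omega>. ennreal (?i \<omega> * ?c \<omega>) \<partial>M)"
      using real_cond_exp_intg(1)[OF int Fi] pos
      by (intro nn_integral_eq_integral[symmetric]) auto
    finally have 1: "(\<integral>\<^sup>+\<omega>. indicator C (X \<omega>, Y \<omega>) \<partial>M) = (\<integral>\<^sup>+\<omega>. ennreal (?i \<omega> * ?c \<omega>) \<partial>M)" .
    have 2: "AE \<omega> in M. emeasure (\<kappa> \<omega>) (Pair (X \<omega>) -` C) = ennreal (?i \<omega> * ?c \<omega>)"
      using eq AE_space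
    proof eventually_elim
      fix \<omega> assume c: "?c \<omega> = measure (\<kappa> \<omega>) b" and \<omega>: "\<omega> \<in> space M"
      interpret K: prob_space "\<kappa> \<omega>" using \<kappa>[OF \<omega>] .
      show "emeasure (\<kappa> \<omega>) (Pair (X \<omega>) -` C) = ennreal (?i \<omega> * ?c \<omega>)"
        by (cases "X \<omega> \<in> a") (auto simp: C c K.emeasure_eq_measure)
    qed
    show "?Q C" by (intro bexI[of _ "\<lambda>\<omega>. ennreal (?i \<omega> * ?c \<omega>)"] conjI 1 2) measurable
  next
    show "?Q {}" by (intro bexI[of _ "\<lambda>_. 0"]) auto
  next
    fix C assume C[unfolded sets, measurable]: "C \<in> sigma_sets ?\<Omega> ?G" and "?Q C"
    then obtain h where h[measurable]: "h \<in> borel_measurable M"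
      and 1: "AE \<omega> in M. emeasure (\<kappa> \<omega>) (Pair (X \<omega>) -` C) = h \<omega>"
      and 2: "(\<integral>\<^sup>+\<omega>. indicator C (X \<omega>, Y \<omega>) \<partial>M) = (\<integral>\<^sup>+\<omega>. h \<omega> \<partial>M)" by auto
    have 3: "AE \<omega> in M. h \<omega> \<le> 1 \<and> emeasure (\<kappa> \<omega>) (Pair (X \<omega>) -` (?\<Omega> - C)) = 1 - h \<omega>"
      using 1 AE_space
    proof eventually_elim
      fix \<omega> assume h: "emeasure (\<kappa> \<omega>) (Pair (X \<omega>) -` C) = h \<omega>" and \<omega>: "\<omega> \<in> space M"
      interpret K: prob_space "\<kappa> \<omega>" using \<kappa>[OF \<omega>] .
      have "Pair (X \<omega>) -` (?\<Omega> - C) = space (\<kappa> \<omega>) - Pair (X \<omega>) -` C"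
        using measurable_space[OF X' \<omega>] by (auto simp: sp\<kappa>[OF \<omega>])
      moreover have "h \<omega> \<le> 1" using h K.emeasure_le_1 by metis
      ultimately show "h \<omega> \<le> 1 \<and> emeasure (\<kappa> \<omega>) (Pair (X \<omega>) -` (?\<Omega> - C)) = 1 - h \<omega>"
        using sl[OF \<omega> C] h ennreal_one_less_top emeasure_compl[of "Pair (X \<omega>) -` C" "\<kappa> \<omega>"] by (metis K.emeasure_finite K.emeasure_space_1 infinity_ennreal_def)
    qed
    have h1: "AE \<omega> in M. h \<omega> \<le> 1" using 3 by eventually_elim simp
    \<comment> \<open>Passing to complements subtracts integrals in \<open>ennreal\<close>, which is
      legitimate only for a finite subtrahend.\<close>
    have fin: "(\<integral>\<^sup>+\<omega>. h \<omega> \<partial>M) \<noteq> \<infinity>"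
    proof -
      have "(\<integral>\<^sup>+\<omega>. h \<omega> \<partial>M) \<le> (\<integral>\<^sup>+\<omega>. 1 \<partial>M)" by (intro nn_integral_mono_AE h1)
      then show ?thesis by (auto simp: emeasure_space_1 top_unique)
    qed
    have "(\<integral>\<^sup>+\<omega>. indicator (?\<Omega> - C) (X \<omega>, Y \<omega>) \<partial>M) = (\<integral>\<^sup>+\<omega>. 1 - indicator C (X \<omega>, Y \<omega>) \<partial>M)"
      using measurable_space[OF X'] measurable_space[OF Y]
      by (intro nn_integral_cong) (auto simp: indicator_def)
    also have "\<dots> = 1 - (\<integral>\<^sup>+\<omega>. indicator C (X \<omega>, Y \<omega>) \<partial>M)"
      using fin by (subst nn_integral_diff) (auto simp: 2[symmetric] emeasure_space_1 indicator_def)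
    also have "\<dots> = (\<integral>\<^sup>+\<omega>. 1 - h \<omega> \<partial>M)"
      unfolding 2 using fin h1 by (subst nn_integral_diff) (auto simp: emeasure_space_1)
    finally show "?Q (?\<Omega> - C)"
    proof (intro bexI[of _ "\<lambda>\<omega>. 1 - h \<omega>"] conjI)
      show "AE \<omega> in M. emeasure (\<kappa> \<omega>) (Pair (X \<omega>) -` (?\<Omega> - C)) = 1 - h \<omega>"
        using 3 by eventually_elim simp
    qed measurable
  next
    fix C :: "nat \<Rightarrow> _" assume dis: "disjoint_family C" and C: "range C \<subseteq> sigma_sets ?\<Omega> ?G"
      and Q: "\<And>i. ?Q (C i)"
    from choice[of "\<lambda>i h. h \<in> borel_measurable M \<and> (AE \<omega> in M. emeasure (\<kappa> \<omega>) (Pair (X \<omega>) -` C i) = h \<omega>) \<and>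
      (\<integral>\<^sup>+\<omega>. indicator (C i) (X \<omega>, Y \<omega>) \<partial>M) = (\<integral>\<^sup>+\<omega>. h \<omega> \<partial>M)"] Q[unfolded Bex_def]
    obtain h where h[measurable]: "\<And>i. h i \<in> borel_measurable M"
      and 1: "\<And>i. AE \<omega> in M. emeasure (\<kappa> \<omega>) (Pair (X \<omega>) -` C i) = h i \<omega>"
      and 2: "\<And>i. (\<integral>\<^sup>+\<omega>. indicator (C i) (X \<omega>, Y \<omega>) \<partial>M) = (\<integral>\<^sup>+\<omega>. h i \<omega> \<partial>M)" by blast
    have C'[measurable]: "C i \<in> sets (S \<Otimes>\<^sub>M L)" for i using C sets by auto
    have "AE \<omega> in M. \<forall>i. emeasure (\<kappa> \<omega>) (Pair (X \<omega>) -` C i) = h i \<omega>"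
      using 1 by (simp add: AE_all_countable)
    then have 3: "AE \<omega> in M. emeasure (\<kappa> \<omega>) (Pair (X \<omega>) -` (\<Union>i. C i)) = (\<Sum>i. h i \<omega>)"
      using AE_space
    proof eventually_elim
      fix \<omega> assume h: "\<forall>i. emeasure (\<kappa> \<omega>) (Pair (X \<omega>) -` C i) = h i \<omega>" and \<omega>: "\<omega> \<in> space M"
      have "emeasure (\<kappa> \<omega>) (\<Union>i. Pair (X \<omega>) -` C i) = (\<Sum>i. emeasure (\<kappa> \<omega>) (Pair (X \<omega>) -` C i))"
        using dis sl[OF \<omega> C'] by (intro suminf_emeasure[symmetric]) (auto simp: disjoint_family_on_def)
      then show "emeasure (\<kappa> \<omega>) (Pair (X \<omega>) -` (\<Union>i. C i)) = (\<Sum>i. h i \<omega>)"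
        using h by (simp add: vimage_UN)
    qed
    have "(\<integral>\<^sup>+\<omega>. indicator (\<Union>i. C i) (X \<omega>, Y \<omega>) \<partial>M) = (\<integral>\<^sup>+\<omega>. (\<Sum>i. indicator (C i) (X \<omega>, Y \<omega>)) \<partial>M)"
      using dis by (simp add: suminf_indicator)
    also have "\<dots> = (\<Sum>i. \<integral>\<^sup>+\<omega>. indicator (C i) (X \<omega>, Y \<omega>) \<partial>M)"
      by (intro nn_integral_suminf) auto
    also have "\<dots> = (\<integral>\<^sup>+\<omega>. (\<Sum>i. h i \<omega>) \<partial>M)"
      unfolding 2 by (intro nn_integral_suminf[symmetric]) auto
    finally show "?Q (\<Union>i. C i)"
      by (intro bexI[of _ "\<lambda>\<omega>. \<Sum>i. h i \<omega>"] conjI 3) measurable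
  qed
qed

text \<open>Since \<open>X\<close> is known given \<open>F\<close>, it may be frozen while
  \<open>Y\<close> is integrated out under \<open>\<kappa> \<omega>\<close>. Every conditional law
  assumed for either model is used through this rule or its marginal form below.\<close>

lemma cond_distributed_nn_integral:
  fixes f :: "'c \<times> 'b \<Rightarrow> ennreal"
  assumes M: "prob_space M" and cd: "cond_distributed M F L Y \<kappa>"
    and \<kappa>: "\<And>\<omega>. \<omega> \<in> space M \<Longrightarrow> prob_space (\<kappa> \<omega>)"
    and sets_\<kappa>: "\<And>\<omega>. \<omega> \<in> space M \<Longrightarrow> sets (\<kappa> \<omega>) = sets L"
    and X: "X \<in> measurable F S" and f: "f \<in> borel_measurable (S \<Otimes>\<^sub>M L)"
  shows "(\<integral>\<^sup>+\<omega>. f (X \<omega>, Y \<omega>) \<partial>M) = (\<integral>\<^sup>+\<omega>. (\<integral>\<^sup>+y. f (X \<omega>, y) \<partial>\<kappa> \<omega>) \<partial>M)"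
proof -
  have sub: "subalgebra M F" and Y[measurable]: "Y \<in> measurable M L"
    using cd by (auto simp: cond_distributed_def)
  have X'[measurable]: "X \<in> measurable M S"
    using measurable_from_subalg[OF sub X] .
  have sl[measurable]: "(\<lambda>y. g (X \<omega>, y)) \<in> borel_measurable (\<kappa> \<omega>)"
    if "\<omega> \<in> space M" "g \<in> borel_measurable (S \<Otimes>\<^sub>M L)" for \<omega> and g :: "'c \<times> 'b \<Rightarrow> ennreal"
  proof -
    have "(\<lambda>y. g (X \<omega>, y)) \<in> borel_measurable L"
      using that measurable_space[OF X' that(1)] by measurable
    then show ?thesis using measurable_cong_sets[OF sets_\<kappa>[OF that(1)] refl] by blast
  qed
  have sp\<kappa>: "space (\<kappa> \<omega>) = space L" if "\<omega> \<in> space M" for \<omega>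
    using sets_\<kappa>[OF that] by (rule sets_eq_imp_space_eq)
  \<comment> \<open>The induction again needs the measurable version \<open>h\<close>: without it,
    additivity and monotone convergence would not apply to the outer integral.\<close>
  let ?Q = "\<lambda>f. \<exists>h\<in>borel_measurable M. (AE \<omega> in M. (\<integral>\<^sup>+y. f (X \<omega>, y) \<partial>\<kappa> \<omega>) = h \<omega>) \<and>
           (\<integral>\<^sup>+\<omega>. f (X \<omega>, Y \<omega>) \<partial>M) = (\<integral>\<^sup>+\<omega>. h \<omega> \<partial>M)"
  have "?Q f" using f
  proof induction
    case (cong f g)
    have "(\<integral>\<^sup>+y. f (X \<omega>, y) \<partial>\<kappa> \<omega>) = (\<integral>\<^sup>+y. g (X \<omega>, y) \<partial>\<kappa> \<omega>)" if "\<omega> \<in> space M" for \<omega>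
      using cong(3) measurable_space[OF X' that] sp\<kappa>[OF that]
      by (intro nn_integral_cong) (auto simp: space_pair_measure)
    moreover have "(\<integral>\<^sup>+\<omega>. f (X \<omega>, Y \<omega>) \<partial>M) = (\<integral>\<^sup>+\<omega>. g (X \<omega>, Y \<omega>) \<partial>M)"
      using cong(3) measurable_space[OF X'] measurable_space[OF Y]
      by (intro nn_integral_cong) (auto simp: space_pair_measure)
    ultimately show ?case using cong(4) by (auto cong: AE_cong_simp)
  next
    case (set A)
    have "(\<integral>\<^sup>+y. indicator A (X \<omega>, y) \<partial>\<kappa> \<omega>) = emeasure (\<kappa> \<omega>) (Pair (X \<omega>) -` A)" if "\<omega> \<in> space M" for \<omega>
    proof -
      have "(\<integral>\<^sup>+y. indicator A (X \<omega>, y) \<partial>\<kappa> \<omega>) = (\<integral>\<^sup>+y. indicator (Pair (X \<omega>) -` A) y \<partial>\<kappa> \<omega>)"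
        by (simp add: indicator_def)
      also have "\<dots> = emeasure (\<kappa> \<omega>) (Pair (X \<omega>) -` A)"
        using that set by (intro nn_integral_indicator) (simp add: sets_\<kappa> sets_Pair1)
      finally show ?thesis .
    qed
    then show ?case
      using cond_distributed_nn_integral_indicator[OF M cd \<kappa> sets_\<kappa> X set] by (auto cong: AE_cong_simp)
  next
    case (mult u c)
    from mult.IH obtain h where h[measurable]: "h \<in> borel_measurable M"
      and 1: "AE \<omega> in M. (\<integral>\<^sup>+y. u (X \<omega>, y) \<partial>\<kappa> \<omega>) = h \<omega>"
      and 2: "(\<integral>\<^sup>+\<omega>. u (X \<omega>, Y \<omega>) \<partial>M) = (\<integral>\<^sup>+\<omega>. h \<omega> \<partial>M)" by blast
    have u[measurable]: "u \<in> borel_measurable (S \<Otimes>\<^sub>M L)" by fact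
    have 3: "AE \<omega> in M. (\<integral>\<^sup>+y. c * u (X \<omega>, y) \<partial>\<kappa> \<omega>) = c * h \<omega>"
      using 1 AE_space by eventually_elim (simp add: nn_integral_cmult sl)
    have 4: "(\<integral>\<^sup>+\<omega>. c * u (X \<omega>, Y \<omega>) \<partial>M) = (\<integral>\<^sup>+\<omega>. c * h \<omega> \<partial>M)"
      by (simp add: nn_integral_cmult 2)
    show ?case
      by (intro bexI[of _ "\<lambda>\<omega>. c * h \<omega>"] conjI 3 4) measurable
  next
    case (add u v)
    from add.IH obtain h h' where h[measurable]: "h \<in> borel_measurable M" "h' \<in> borel_measurable M"
      and 1: "AE \<omega> in M. (\<integral>\<^sup>+y. u (X \<omega>, y) \<partial>\<kappa> \<omega>) = h \<omega>"
       "AE \<omega> in M. (\<integral>\<^sup>+y. v (X \<omega>, y) \<partial>\<kappa> \<omega>) = h' \<omega>"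
      and 2: "(\<integral>\<^sup>+\<omega>. u (X \<omega>, Y \<omega>) \<partial>M) = (\<integral>\<^sup>+\<omega>. h \<omega> \<partial>M)"
         "(\<integral>\<^sup>+\<omega>. v (X \<omega>, Y \<omega>) \<partial>M) = (\<integral>\<^sup>+\<omega>. h' \<omega> \<partial>M)" by blast
    have [measurable]: "u \<in> borel_measurable (S \<Otimes>\<^sub>M L)" "v \<in> borel_measurable (S \<Otimes>\<^sub>M L)"
      by fact+
    have 3: "AE \<omega> in M. (\<integral>\<^sup>+y. v (X \<omega>, y) + u (X \<omega>, y) \<partial>\<kappa> \<omega>) = h' \<omega> + h \<omega>"
      using 1 AE_space by eventually_elim (simp add: nn_integral_add sl)
    have 4: "(\<integral>\<^sup>+\<omega>. v (X \<omega>, Y \<omega>) + u (X \<omega>, Y \<omega>) \<partial>M) = (\<integral>\<^sup>+\<omega>. h' \<omega> + h \<omega> \<partial>M)"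
      by (simp add: nn_integral_add 2)
    show ?case
      by (intro bexI[of _ "\<lambda>\<omega>. h' \<omega> + h \<omega>"] conjI 3 4) measurable
  next
    case (seq U)
    from choice[of "\<lambda>i h. h \<in> borel_measurable M \<and> (AE \<omega> in M. (\<integral>\<^sup>+y. U i (X \<omega>, y) \<partial>\<kappa> \<omega>) = h \<omega>) \<and>
      (\<integral>\<^sup>+\<omega>. U i (X \<omega>, Y \<omega>) \<partial>M) = (\<integral>\<^sup>+\<omega>. h \<omega> \<partial>M)"] seq.IH[unfolded Bex_def]
    obtain h where h[measurable]: "\<And>i. h i \<in> borel_measurable M"
      and 1: "\<And>i. AE \<omega> in M. (\<integral>\<^sup>+y. U i (X \<omega>, y) \<partial>\<kappa> \<omega>) = h i \<omega>"
      and 2: "\<And>i. (\<integral>\<^sup>+\<omega>. U i (X \<omega>, Y \<omega>) \<partial>M) = (\<integral>\<^sup>+\<omega>. h i \<omega> \<partial>M)" by blast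
    have iU: "incseq U" and U[measurable]: "\<And>i. U i \<in> borel_measurable (S \<Otimes>\<^sub>M L)" by fact+
    have inc: "incseq (\<lambda>i y. U i (X \<omega>, y))" for \<omega>
      using iU by (auto simp: incseq_def le_fun_def)
    have inc': "incseq (\<lambda>i \<omega>. U i (X \<omega>, Y \<omega>))"
      using iU by (auto simp: incseq_def le_fun_def)
    have "AE \<omega> in M. \<forall>i. (\<integral>\<^sup>+y. U i (X \<omega>, y) \<partial>\<kappa> \<omega>) = h i \<omega>" using 1 by (simp add: AE_all_countable)
    then have 3: "AE \<omega> in M. (\<integral>\<^sup>+y. (SUP i. U i) (X \<omega>, y) \<partial>\<kappa> \<omega>) = (SUP i. h i \<omega>)"
      using AE_space
    proof eventually_elim
      fix \<omega> assume a: "\<forall>i. (\<integral>\<^sup>+y. U i (X \<omega>, y) \<partial>\<kappa> \<omega>) = h i \<omega>" and \<omega>: "\<omega> \<in> space M"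
      have "(\<integral>\<^sup>+y. (SUP i. U i (X \<omega>, y)) \<partial>\<kappa> \<omega>) = (SUP i. (\<integral>\<^sup>+y. U i (X \<omega>, y) \<partial>\<kappa> \<omega>))"
        by (rule nn_integral_monotone_convergence_SUP[OF inc]) (simp add: sl \<omega>)
      then show "(\<integral>\<^sup>+y. (SUP i. U i) (X \<omega>, y) \<partial>\<kappa> \<omega>) = (SUP i. h i \<omega>)"
        using a by (simp add: image_comp)
    qed
    have "(\<integral>\<^sup>+\<omega>. (SUP i. U i) (X \<omega>, Y \<omega>) \<partial>M) = (SUP i. (\<integral>\<^sup>+\<omega>. U i (X \<omega>, Y \<omega>) \<partial>M))"
      using nn_integral_monotone_convergence_SUP[OF inc', of M] by (simp add: image_comp)
    also have "\<dots> = (SUP i. (\<integral>\<^sup>+\<omega>. h i \<omega> \<partial>M))"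
      by (simp only: 2)
    also have "\<dots> = (\<integral>\<^sup>+\<omega>. (SUP i. h i \<omega>) \<partial>M)"
    proof (rule nn_integral_monotone_convergence_SUP_AE[symmetric])
      fix i
      show "AE \<omega> in M. h i \<omega> \<le> h (Suc i) \<omega>"
        using 1[of i] 1[of "Suc i"]
      proof eventually_elim
        fix \<omega> assume a: "(\<integral>\<^sup>+y. U i (X \<omega>, y) \<partial>\<kappa> \<omega>) = h i \<omega>" "(\<integral>\<^sup>+y. U (Suc i) (X \<omega>, y) \<partial>\<kappa> \<omega>) = h (Suc i) \<omega>"
        show "h i \<omega> \<le> h (Suc i) \<omega>"
          unfolding a[symmetric] using iU by (intro nn_integral_mono) (auto simp: incseq_def le_fun_def)
      qed
    qed auto
    finally show ?case
      by (intro bexI[of _ "\<lambda>\<omega>. SUP i. h i \<omega>"] conjI 3) measurable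
  qed
  then obtain h where h: "AE \<omega> in M. (\<integral>\<^sup>+y. f (X \<omega>, y) \<partial>\<kappa> \<omega>) = h \<omega>"
    "(\<integral>\<^sup>+\<omega>. f (X \<omega>, Y \<omega>) \<partial>M) = (\<integral>\<^sup>+\<omega>. h \<omega> \<partial>M)" by auto
  then show ?thesis using nn_integral_cong_AE[OF h(1)] by simp
qed

lemma cond_distributed_nn_integral_marginal:
  fixes f :: "'b \<Rightarrow> ennreal"
  assumes M: "prob_space M" and cd: "cond_distributed M F L Y \<kappa>"
    and \<kappa>: "\<And>\<omega>. \<omega> \<in> space M \<Longrightarrow> prob_space (\<kappa> \<omega>)"
    and sets_\<kappa>: "\<And>\<omega>. \<omega> \<in> space M \<Longrightarrow> sets (\<kappa> \<omega>) = sets L"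
    and f: "f \<in> borel_measurable L"
  shows "(\<integral>\<^sup>+\<omega>. f (Y \<omega>) \<partial>M) = (\<integral>\<^sup>+\<omega>. (\<integral>\<^sup>+y. f y \<partial>\<kappa> \<omega>) \<partial>M)"
proof -
  have "(\<lambda>p. f (snd p)) \<in> borel_measurable (count_space UNIV \<Otimes>\<^sub>M L)"
    by (rule measurable_compose[OF measurable_snd f])
  with cond_distributed_nn_integral[OF M cd \<kappa> sets_\<kappa>, of "\<lambda>_. ()" "count_space UNIV" "\<lambda>p. f (snd p)"]
  show ?thesis by simp
qed

subsection \<open>The laws of the scheme\<close>

lemma sets_Gamma_law[measurable_cong, simp]: "sets (Gamma_law a) = sets borel"
  by (simp add: Gamma_law_def)

lemma sets_BFRY[measurable_cong, simp]: "sets (BFRY \<sigma>) = sets borel"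
  by (simp add: BFRY_def)

lemma BFRY_density_measurable[measurable]: "BFRY_density \<sigma> \<in> borel_measurable borel"
  unfolding BFRY_density_def by measurable

lemma BFRY_density_nonneg: "0 < \<sigma> \<Longrightarrow> \<sigma> < 1 \<Longrightarrow> 0 \<le> BFRY_density \<sigma> z"
  by (auto simp: BFRY_density_def Gamma_real_pos less_imp_le)

lemma levy_density_measurable[measurable]: "levy_density \<alpha> \<theta> \<in> borel_measurable borel"
  unfolding levy_density_def by measurable

lemma levy_density_nonneg: "0 < \<alpha> \<Longrightarrow> 0 \<le> levy_density \<alpha> \<theta> s"
  by (auto simp: levy_density_def)

lemma AE_BFRY_pos: "AE z in BFRY \<sigma>. 0 < z"
  unfolding BFRY_def by (subst AE_density) (auto simp: BFRY_density_def)

lemma ennreal_mult3: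
  "0 \<le> a \<Longrightarrow> 0 \<le> b \<Longrightarrow> 0 \<le> c \<Longrightarrow> ennreal (a * (b * c)) = ennreal a * (ennreal b * ennreal c)"
  by (simp add: ennreal_mult)

lemma nn_integral_BFRY_distributed:
  assumes "distributed M lborel \<zeta> (\<lambda>z. ennreal (BFRY_density \<sigma> z))" and [measurable]: "g \<in> borel_measurable borel"
  shows "(\<integral>\<^sup>+\<omega>. g (\<zeta> \<omega>) \<partial>M) = (\<integral>\<^sup>+z. g z \<partial>BFRY \<sigma>)"
  unfolding BFRY_def using distributed_nn_integral[OF assms(1), of g]
  by (subst nn_integral_density) auto

lemma AE_BFRY_distributed_pos:
  assumes z: "distributed M lborel \<zeta> (\<lambda>z. ennreal (BFRY_density \<sigma> z))"
  shows "AE \<omega> in M. 0 < \<zeta> \<omega>"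
proof -
  have "distr M lborel \<zeta> = BFRY \<sigma>"
    using z by (simp add: distributed_def BFRY_def)
  then have "AE z in distr M lborel \<zeta>. 0 < z" using AE_BFRY_pos[of \<sigma>] by (simp only:)
  from AE_distrD[OF _ this] show ?thesis using distributed_measurable[OF z] by simp
qed

lemma ennreal_mult3':
  "0 \<le> a \<Longrightarrow> 0 \<le> b \<Longrightarrow> 0 \<le> c \<Longrightarrow> ennreal (a * b * c) = ennreal a * ennreal b * ennreal c"
  by (simp add: ennreal_mult)

text \<open>Equals the Poisson mass for positive \<open>r\<close>, but is a Borel function of
  \<open>r\<close> on the whole line by inspection, whatever \<open>poisson_pmf r\<close> means for
  other \<open>r\<close>.\<close>

definition poisson_density :: "real \<Rightarrow> nat \<Rightarrow> ennreal" where
  "poisson_density r i = ennreal (r ^ i / fact i * exp (- r))"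

lemma prob_space_Gamma_law:
  assumes "0 < a" shows "prob_space (Gamma_law a)"
proof
  have "emeasure (Gamma_law a) (space (Gamma_law a)) =
      (\<integral>\<^sup>+x. ennreal (if 0 < x then x powr (a - 1) * exp (- x) / Gamma a else 0) \<partial>lborel)"
    unfolding Gamma_law_def by (simp add: emeasure_density)
  also have "\<dots> = (\<integral>\<^sup>+x. ennreal (1 / Gamma a) * ennreal (indicator {0..} x * x powr (a - 1) / exp x) \<partial>lborel)"
    using assms by (intro nn_integral_cong)
      (auto simp: indicator_def exp_minus field_simps Gamma_real_pos less_imp_le simp flip: ennreal_mult)
  also have "\<dots> = ennreal (1 / Gamma a) * ennreal (Gamma a)"
    using Gamma_conv_nn_integral_real[OF assms] by (subst nn_integral_cmult) auto
  also have "\<dots> = 1"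
    using Gamma_real_pos[OF assms] by (simp flip: ennreal_mult)
  finally show "emeasure (Gamma_law a) (space (Gamma_law a)) = 1" .
qed

lemma AE_Gamma_law_pos: "AE x in Gamma_law a. 0 < x"
  unfolding Gamma_law_def by (subst AE_density) auto

text \<open>The normalising constant of the law of \<open>\<zeta>\<close> given \<open>j\<close>
  features and total rate \<open>t\<close>; times \<open>t ^ j / fact j\<close> it is the
  Poisson-BFRY mass at \<open>j\<close>.\<close>

definition BFRY_moment :: "real \<Rightarrow> nat \<Rightarrow> real \<Rightarrow> ennreal" where
  "BFRY_moment \<sigma> j t = (\<integral>\<^sup>+z. ennreal (z ^ j * exp (- t * z)) \<partial>BFRY \<sigma>)"

section \<open>The product of the gamma variable and \<open>f\<close> as a tilted BFRY law\<close>

lemma powr_interpolation_pos: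
  fixes T b v :: real
  assumes T: "0 < T" and v: "v \<in> {0..1}"
  shows "0 < v * T powr b + (1 - v) * (1 + T) powr b"
proof (cases "v = 0")
  case False
  then have "0 < v * T powr b" using v T by auto
  then show ?thesis using v by (auto intro!: add_pos_nonneg)
qed (use T in auto)

text \<open>Both signs of \<open>b = \<sigma> - j\<close> occur: positive for \<open>j = 0\<close>,
  negative for all larger \<open>j\<close>. The difference of powers changes sign together with
  \<open>b\<close>.\<close>

lemma powr_increment_sign:
  fixes T b :: real
  assumes T: "0 < T" and b: "b \<noteq> 0"
  shows "0 < - b / (T powr b - (1 + T) powr b)"
proof (cases "b > 0")
  case True
  then have "T powr b < (1 + T) powr b" using T by (intro powr_less_mono2) auto
  with True show ?thesis by (auto simp: divide_simps)
next
  case False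
  then have "(1 + T) powr b < T powr b" using T b by (intro powr_less_mono2_neg) auto
  with False b show ?thesis by (auto simp: divide_simps)
qed

text \<open>With \<open>b = \<sigma> - j\<close> and \<open>w v\<close> interpolating linearly between \<open>(T + 1) powr b\<close> and \<open>T powr b\<close>, the integrand is
  up to a constant the derivative of \<open>exp (- z * w v powr (1 / b))\<close> in \<open>v\<close>.\<close>

lemma mixture_over_uniform:
  fixes T b z :: real
  assumes T: "0 < T" and b: "b \<noteq> 0" and z: "0 < z"
  defines "D \<equiv> T powr b - (1 + T) powr b"
    and "w \<equiv> \<lambda>v. v * T powr b + (1 - v) * (1 + T) powr b"
  shows "(\<integral>\<^sup>+v. ennreal (w v powr ((1 - b) / b) * exp (- z * w v powr (1 / b))) * indicator {0..1} v \<partial>lborel)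
      = ennreal (- b / (D * z) * (exp (- T * z) - exp (- (1 + T) * z)))"
proof -
  have "- b / D > 0" unfolding D_def by (rule powr_increment_sign[OF T b])
  then have D0: "D \<noteq> 0" by auto
  have w: "0 < w v" if "v \<in> {0..1}" for v
    unfolding w_def by (rule powr_interpolation_pos[OF T that])
  let ?F = "\<lambda>v. - b / (D * z) * exp (- z * w v powr (1 / b))"
  have "(\<integral>\<^sup>+v. ennreal (w v powr ((1 - b) / b) * exp (- z * w v powr (1 / b))) * indicator {0..1} v \<partial>lborel)
     = ennreal (?F 1 - ?F 0)"
  proof (rule nn_integral_FTC_Icc)
    show "(\<lambda>v. w v powr ((1 - b) / b) * exp (- z * w v powr (1 / b))) \<in> borel_measurable borel"
      unfolding w_def by measurable
  next
    fix v :: real assume v: "v \<in> {0..1}"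
    have [derivative_intros]: "(w has_field_derivative D) (at v)"
      unfolding w_def D_def by (auto intro!: derivative_eq_intros)
    have "(?F has_field_derivative (- b / (D * z) * (exp (- z * w v powr (1 / b)) * (- z * (1 / b * w v powr (1 / b - 1) * D))))) (at v)"
      using w[OF v] by (auto intro!: derivative_eq_intros)
    also have "1 / b - 1 = (1 - b) / b" using b by (simp add: field_simps)
    also have "- b / (D * z) * (exp (- z * w v powr (1 / b)) * (- z * (1 / b * w v powr ((1 - b) / b) * D)))
      = w v powr ((1 - b) / b) * exp (- z * w v powr (1 / b))"
      using b z D0 by (simp add: field_simps)
    finally show "(?F has_field_derivative w v powr ((1 - b) / b) * exp (- z * w v powr (1 / b))) (at v)" .
  qed auto
  also have "w 1 powr (1 / b) = T" "w 0 powr (1 / b) = 1 + T"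
    using T b by (auto simp: w_def powr_powr)
  then have "?F 1 - ?F 0 = - b / (D * z) * (exp (- T * z) - exp (- (1 + T) * z))"
    by (simp add: algebra_simps)
  finally show ?thesis .
qed

text \<open>For fixed \<open>v\<close> the product \<open>G f\<close> is gamma of shape
  \<open>1 - b\<close> with rate \<open>1 / f\<close>. Averaging the rate over \<open>v\<close>
  produces \<open>(e^(- T z) - e^(- (1 + T) z)) / z\<close>, and factoring out
  \<open>e^(- T z)\<close> leaves the \<open>1 - e^(- z)\<close> of the BFRY density. The result is
  the BFRY law tilted by \<open>z^j e^(- T z)\<close>; the leading constant is its
  normalisation.\<close>

lemma gamma_uniform_mixture:
  fixes h :: "real \<Rightarrow> ennreal" and j :: nat
  assumes \<sigma>: "0 < \<sigma>" "\<sigma> < 1" and T: "0 < T" and h[measurable]: "h \<in> borel_measurable borel"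
  defines "b \<equiv> \<sigma> - real j"
  shows "(\<integral>\<^sup>+p. h (fst p * bfry_f (snd p) T b) \<partial>(Gamma_law (1 - \<sigma> + real j) \<Otimes>\<^sub>M uniform_measure lborel {0..1})) =
    ennreal (- b * Gamma (1 - \<sigma>) / ((T powr b - (1 + T) powr b) * Gamma (1 - b) * \<sigma>)) *
    (\<integral>\<^sup>+z. h z * ennreal (z ^ j * exp (- T * z)) \<partial>BFRY \<sigma>)"
proof -
  define w where "w v = v * T powr b + (1 - v) * (1 + T) powr b" for v
  have [measurable]: "w \<in> borel_measurable borel" unfolding w_def by measurable
  define D where "D = T powr b - (1 + T) powr b"
  have b: "b \<noteq> 0" "b < 1"
  proof -
    show "b < 1" using \<sigma> by (simp add: b_def)
    show "b \<noteq> 0"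
    proof
      assume "b = 0"
      then have s: "\<sigma> = real j" by (simp add: b_def)
      then have "0 < j" "j < 1" using \<sigma> by simp_all
      then show False by simp
    qed
  qed
  have G1: "Gamma (1 - b) > 0" and G2: "Gamma (1 - \<sigma>) > 0" using b \<sigma> by (auto intro!: Gamma_real_pos)
  have G0: "Gamma (1 - b) \<noteq> 0" "Gamma (1 - \<sigma>) \<noteq> 0" using G1 G2 less_irrefl by metis+
  have f: "bfry_f v T b = w v powr (- 1 / b)" for v by (simp add: bfry_f_def w_def)
  have [measurable]: "(\<lambda>v. bfry_f v T b) \<in> borel_measurable borel" unfolding bfry_f_def by measurable
  have wpos: "0 < w v" if "v \<in> {0..1}" for v
    unfolding w_def by (rule powr_interpolation_pos[OF T that])
  have Db: "- b / D > 0" unfolding D_def by (rule powr_increment_sign[OF T b(1)])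
  interpret G: prob_space "Gamma_law (1 - \<sigma> + real j)"
    using \<sigma> by (intro prob_space_Gamma_law) auto
  interpret U: prob_space "uniform_measure lborel {0..1::real}"
    by (rule prob_space_uniform_measure) auto
  interpret P: pair_sigma_finite "Gamma_law (1 - \<sigma> + real j)" "uniform_measure lborel {0..1::real}"
    by unfold_locales
  have scale: "(\<integral>\<^sup>+g. h (g * bfry_f v T b) \<partial>Gamma_law (1 - \<sigma> + real j)) =
     (\<integral>\<^sup>+z. h z * ennreal (if 0 < z then z powr (- b) / Gamma (1 - b) else 0) *
       ennreal (w v powr ((1 - b) / b) * exp (- z * w v powr (1 / b))) \<partial>lborel)"
    if v: "v \<in> {0..1}" for v
  proof -
    \<comment> \<open>The rate of the rescaled gamma variable: it moves from \<open>1 + T\<close> at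
      \<open>v = 0\<close> to \<open>T\<close> at \<open>v = 1\<close>. The Jacobian of the
      substitution turns its density into \<open>r powr (1 - b)\<close> times
      \<open>z powr (- b) * exp (- z * r)\<close>, up to the gamma constant.\<close>
    define r where "r = w v powr (1 / b)"
    have r: "0 < r" using wpos[OF v] by (simp add: r_def)
    have fr: "bfry_f v T b = 1 / r" using wpos[OF v] by (simp add: f r_def powr_minus_divide)
    have rb: "w v powr ((1 - b) / b) = r powr (1 - b)" by (simp add: r_def powr_powr)
    have "(\<integral>\<^sup>+g. h (g * bfry_f v T b) \<partial>Gamma_law (1 - \<sigma> + real j)) =
      (\<integral>\<^sup>+g. ennreal (if 0 < g then g powr (- b) * exp (- g) / Gamma (1 - b) else 0) * h (g / r) \<partial>lborel)"
    proof -
      have eq: "1 - \<sigma> + real j = 1 - b" "1 - b - 1 = - b" by (simp_all add: b_def)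
      show ?thesis
        unfolding Gamma_law_def eq by (subst nn_integral_density) (auto simp: fr)
    qed
    also have "\<dots> = \<bar>r\<bar> * (\<integral>\<^sup>+z. ennreal (if 0 < 0 + r * z then (0 + r * z) powr (- b) * exp (- (0 + r * z)) / Gamma (1 - b) else 0) *
       h ((0 + r * z) / r) \<partial>lborel)"
      using r by (intro nn_integral_real_affine) auto
    also have "\<dots> = (\<integral>\<^sup>+z. h z * ennreal (if 0 < z then z powr (- b) / Gamma (1 - b) else 0) *
       ennreal (r powr (1 - b) * exp (- z * r)) \<partial>lborel)"
    proof (subst nn_integral_cmult[symmetric], measurable, intro nn_integral_cong)
      fix z :: real
      show "ennreal \<bar>r\<bar> * (ennreal (if 0 < 0 + r * z then (0 + r * z) powr (- b) * exp (- (0 + r * z)) / Gamma (1 - b) else 0) *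
         h ((0 + r * z) / r)) = h z * ennreal (if 0 < z then z powr (- b) / Gamma (1 - b) else 0) *
         ennreal (r powr (1 - b) * exp (- z * r))"
      proof (cases "0 < z")
        case True
        have "ennreal r * ennreal ((r * z) powr (- b) * exp (- (r * z)) / Gamma (1 - b)) =
          ennreal (r * ((r * z) powr (- b) * exp (- (r * z)) / Gamma (1 - b)))"
          using r G1 by (intro ennreal_mult[symmetric]) (auto intro: less_imp_le)
        also have "r * ((r * z) powr (- b) * exp (- (r * z)) / Gamma (1 - b)) =
          z powr (- b) / Gamma (1 - b) * (r powr (1 - b) * exp (- z * r))"
          using r True by (simp add: powr_mult powr_diff powr_minus_divide mult.commute)
        also have "ennreal \<dots> = ennreal (z powr (- b) / Gamma (1 - b)) * ennreal (r powr (1 - b) * exp (- z * r))"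
          using G1 by (intro ennreal_mult) (auto intro: less_imp_le)
        finally show ?thesis using r True
          by (simp add: zero_less_mult_iff mult.assoc mult.commute[of _ "h z"] mult.left_commute[of _ "h z"])
      qed (use r in \<open>auto simp: zero_less_mult_iff\<close>)
    qed
    finally show ?thesis by (simp add: rb r_def)
  qed
  have "(\<integral>\<^sup>+p. h (fst p * bfry_f (snd p) T b) \<partial>(Gamma_law (1 - \<sigma> + real j) \<Otimes>\<^sub>M uniform_measure lborel {0..1})) =
    (\<integral>\<^sup>+v. (\<integral>\<^sup>+g. h (g * bfry_f v T b) \<partial>Gamma_law (1 - \<sigma> + real j)) \<partial>uniform_measure lborel {0..1})"
    by (subst P.nn_integral_snd[symmetric]) auto
  also have "\<dots> = (\<integral>\<^sup>+v. (\<integral>\<^sup>+g. h (g * bfry_f v T b) \<partial>Gamma_law (1 - \<sigma> + real j)) * indicator {0..1} v \<partial>lborel)"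
    by (subst nn_integral_uniform_measure) (auto intro!: G.borel_measurable_nn_integral simp: divide_ennreal_def)
  also have "\<dots> = (\<integral>\<^sup>+v. (\<integral>\<^sup>+z. h z * ennreal (if 0 < z then z powr (- b) / Gamma (1 - b) else 0) *
       ennreal (w v powr ((1 - b) / b) * exp (- z * w v powr (1 / b))) * indicator {0..1} v \<partial>lborel) \<partial>lborel)"
    by (intro nn_integral_cong) (auto simp: scale indicator_def)
  also have "\<dots> = (\<integral>\<^sup>+z. (\<integral>\<^sup>+v. h z * ennreal (if 0 < z then z powr (- b) / Gamma (1 - b) else 0) *
       ennreal (w v powr ((1 - b) / b) * exp (- z * w v powr (1 / b))) * indicator {0..1} v \<partial>lborel) \<partial>lborel)"
    by (rule lborel_pair.Fubini') measurable
  also have "\<dots> = (\<integral>\<^sup>+z. h z * ennreal (if 0 < z then z powr (- b) / Gamma (1 - b) else 0) *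
       (\<integral>\<^sup>+v. ennreal (w v powr ((1 - b) / b) * exp (- z * w v powr (1 / b))) * indicator {0..1} v \<partial>lborel) \<partial>lborel)"
    by (subst nn_integral_cmult[symmetric]) (auto simp: mult.assoc)
  also have "\<dots> = (\<integral>\<^sup>+z. h z * ennreal (if 0 < z then z powr (- b) / Gamma (1 - b) else 0) *
       ennreal (- b / (D * z) * (exp (- T * z) - exp (- (1 + T) * z))) \<partial>lborel)"
    by (intro nn_integral_cong) (use mixture_over_uniform[OF T b(1)] in \<open>auto simp: w_def D_def\<close>)
  also have "\<dots> = (\<integral>\<^sup>+z. ennreal (- b * Gamma (1 - \<sigma>) / (D * Gamma (1 - b) * \<sigma>)) *
       (ennreal (BFRY_density \<sigma> z) * (h z * ennreal (z ^ j * exp (- T * z)))) \<partial>lborel)"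
  proof (intro nn_integral_cong)
    fix z :: real
    show "h z * ennreal (if 0 < z then z powr (- b) / Gamma (1 - b) else 0) *
       ennreal (- b / (D * z) * (exp (- T * z) - exp (- (1 + T) * z))) =
       ennreal (- b * Gamma (1 - \<sigma>) / (D * Gamma (1 - b) * \<sigma>)) *
       (ennreal (BFRY_density \<sigma> z) * (h z * ennreal (z ^ j * exp (- T * z))))"
    proof (cases "0 < z")
      case z: True
      \<comment> \<open>The gamma density has one power of \<open>z\<close> more than the tilted
        BFRY density; the average over \<open>v\<close> supplies the missing factor
        \<open>1 / z\<close>.\<close>
      have 1: "z powr (- \<sigma> - 1) * z ^ j = z powr (- b) / z"
        using z by (simp add: b_def powr_diff powr_minus powr_realpow field_simps)
      have 2: "(1 - exp (- z)) * exp (- T * z) = exp (- T * z) - exp (- (1 + T) * z)"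
        by (simp add: algebra_simps flip: exp_add)
      have "z powr (- b) / Gamma (1 - b) * (- b / (D * z) * (exp (- T * z) - exp (- (1 + T) * z))) =
         - b / (D * Gamma (1 - b)) * (z powr (- b) / z) * ((1 - exp (- z)) * exp (- T * z))"
        unfolding 2 by (simp add: ac_simps)
      also have "\<dots> = - b * Gamma (1 - \<sigma>) / (D * Gamma (1 - b) * \<sigma>) * (BFRY_density \<sigma> z * (z ^ j * exp (- T * z)))"
        using z \<sigma> unfolding 1[symmetric] by (simp add: BFRY_density_def G0)
      finally have 3: "z powr (- b) / Gamma (1 - b) * (- b / (D * z) * (exp (- T * z) - exp (- (1 + T) * z))) =
         - b * Gamma (1 - \<sigma>) / (D * Gamma (1 - b) * \<sigma>) * (BFRY_density \<sigma> z * (z ^ j * exp (- T * z)))" .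
      have 4: "- b / (D * z) * (exp (- T * z) - exp (- (1 + T) * z)) \<ge> 0"
      proof -
        have "- b / (D * z) = (- b / D) / z" by simp
        then have "- b / (D * z) \<ge> 0" using Db z by (metis divide_nonneg_pos less_imp_le)
        moreover have "exp (- T * z) - exp (- (1 + T) * z) \<ge> 0" using z by (simp add: algebra_simps)
        ultimately show ?thesis by (rule mult_nonneg_nonneg)
      qed
      have 5: "- b * Gamma (1 - \<sigma>) / (D * Gamma (1 - b) * \<sigma>) \<ge> 0"
      proof -
        have "- b * Gamma (1 - \<sigma>) / (D * Gamma (1 - b) * \<sigma>) = (- b / D) * (Gamma (1 - \<sigma>) / (Gamma (1 - b) * \<sigma>))" by simp
        then show ?thesis using Db G1 G2 \<sigma> by (metis divide_nonneg_pos less_imp_le mult_nonneg_nonneg mult_pos_pos)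
      qed
      have "h z * ennreal (if 0 < z then z powr (- b) / Gamma (1 - b) else 0) *
       ennreal (- b / (D * z) * (exp (- T * z) - exp (- (1 + T) * z))) =
       h z * ennreal (z powr (- b) / Gamma (1 - b) * (- b / (D * z) * (exp (- T * z) - exp (- (1 + T) * z))))"
        using z G1 4 by (subst ennreal_mult) (auto simp: mult.assoc)
      also have "\<dots> = h z * (ennreal (- b * Gamma (1 - \<sigma>) / (D * Gamma (1 - b) * \<sigma>)) * (ennreal (BFRY_density \<sigma> z) * ennreal (z ^ j * exp (- T * z))))"
        unfolding 3 using z by (intro arg_cong[where f="(*) (h z)"] ennreal_mult3 5 BFRY_density_nonneg[OF \<sigma>]) auto
      finally show ?thesis by (simp add: ac_simps)
    qed (simp add: BFRY_density_def)
  qed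
  also have "\<dots> = ennreal (- b * Gamma (1 - \<sigma>) / (D * Gamma (1 - b) * \<sigma>)) *
       (\<integral>\<^sup>+z. ennreal (BFRY_density \<sigma> z) * (h z * ennreal (z ^ j * exp (- T * z))) \<partial>lborel)"
    by (rule nn_integral_cmult) measurable
  also have "(\<integral>\<^sup>+z. ennreal (BFRY_density \<sigma> z) * (h z * ennreal (z ^ j * exp (- T * z))) \<partial>lborel) =
     (\<integral>\<^sup>+z. h z * ennreal (z ^ j * exp (- T * z)) \<partial>BFRY \<sigma>)"
    unfolding BFRY_def by (subst nn_integral_density) auto
  finally show ?thesis unfolding D_def .
qed


text \<open>Integrating the constant 1 over a probability space in the mixture formula evaluates the
  moment without any further calculus. It also shows that the moment is neither zero nor infinite,
  which later permits cancelling it.\<close>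

lemma BFRY_moment_eq:
  fixes j :: nat
  assumes \<sigma>: "0 < \<sigma>" "\<sigma> < 1" and T: "0 < T"
  defines "b \<equiv> \<sigma> - real j"
  shows "ennreal (- b * Gamma (1 - \<sigma>) / ((T powr b - (1 + T) powr b) * Gamma (1 - b) * \<sigma>)) * BFRY_moment \<sigma> j T = 1"
proof -
  interpret G: prob_space "Gamma_law (1 - \<sigma> + real j)"
    using \<sigma> by (intro prob_space_Gamma_law) auto
  interpret U: prob_space "uniform_measure lborel {0..1::real}"
    by (rule prob_space_uniform_measure) auto
  interpret P: pair_prob_space "Gamma_law (1 - \<sigma> + real j)" "uniform_measure lborel {0..1::real}"
    by unfold_locales
  show ?thesis
    using gamma_uniform_mixture[OF \<sigma> T, of "\<lambda>_. 1" j] P.emeasure_space_1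
    by (simp add: b_def BFRY_moment_def)
qed

subsection \<open>Moments of the Levy density\<close>

text \<open>One factor \<open>s\<close> is enough to tame the singularity of order
  \<open>1 + \<alpha>\<close> at 0, hence the bound \<open>1 \<le> a\<close>: only columns that have
  been selected carry finite mass.\<close>

lemma nn_integral_levy_beta:
  assumes \<alpha>: "0 < \<alpha>" "\<alpha> < 1" and \<theta>: "0 < \<theta>" and a: "1 \<le> a" "a \<le> n"
  shows "(\<integral>\<^sup>+s. ennreal (s ^ a * (1 - s) ^ (n - a) * levy_density \<alpha> \<theta> s) \<partial>lborel) =
    ennreal (\<alpha> * Beta (real a - \<alpha>) (real n - real a + \<theta> + \<alpha>))"
proof -
  let ?p = "real a - \<alpha>" and ?q = "real n - real a + \<theta> + \<alpha>"
  have pq: "0 < ?p" "0 < ?q" using assms by auto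
  let ?f = "\<lambda>s. if s \<in> {0<..<1} then \<alpha> * (s powr (?p - 1) * (1 - s) powr (?q - 1)) else 0"
  have "((\<lambda>t. t powr (?p - 1) * (1 - t) powr (?q - 1)) has_integral Beta ?p ?q) {0<..<1}"
    using has_integral_Beta_real[OF pq] by (simp add: has_integral_Icc_iff_Ioo)
  then have "((\<lambda>t. \<alpha> * (t powr (?p - 1) * (1 - t) powr (?q - 1))) has_integral (\<alpha> * Beta ?p ?q)) {0<..<1}"
    by (rule has_integral_mult_right)
  then have "(?f has_integral (\<alpha> * Beta ?p ?q)) UNIV"
    by (simp only: has_integral_restrict_UNIV)
  then have "(\<integral>\<^sup>+s. ennreal (?f s) \<partial>lborel) = ennreal (\<alpha> * Beta ?p ?q)"
    using \<alpha> by (intro nn_integral_has_integral_lborel) auto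
  also have "(\<integral>\<^sup>+s. ennreal (?f s) \<partial>lborel) =
     (\<integral>\<^sup>+s. ennreal (s ^ a * (1 - s) ^ (n - a) * levy_density \<alpha> \<theta> s) \<partial>lborel)"
  proof (intro nn_integral_cong arg_cong[where f=ennreal])
    fix s :: real
    show "?f s = s ^ a * (1 - s) ^ (n - a) * levy_density \<alpha> \<theta> s"
    proof (cases "0 < s \<and> s < 1")
      case True
      then have "s ^ a = s powr real a" "(1 - s) ^ (n - a) = (1 - s) powr (real n - real a)"
        using a by (simp_all add: powr_realpow flip: of_nat_diff)
      then have "s ^ a * (1 - s) ^ (n - a) * levy_density \<alpha> \<theta> s =
        \<alpha> * ((s powr real a * s powr (- \<alpha> - 1)) * ((1 - s) powr (real n - real a) * (1 - s) powr (\<theta> + \<alpha> - 1)))"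
        using True by (simp add: levy_density_def)
      also have "\<dots> = \<alpha> * (s powr (?p - 1) * (1 - s) powr (?q - 1))"
        by (simp add: algebra_simps flip: powr_add)
      finally show ?thesis using True by simp
    qed (auto simp: levy_density_def)
  qed
  finally show ?thesis .
qed

lemma phi_eq_Beta:
  assumes \<alpha>: "0 < \<alpha>" "\<alpha> < 1" and \<theta>: "0 < \<theta>"
  shows "phi \<alpha> \<theta> (Suc n) = \<alpha> * Beta (1 - \<alpha>) (real n + \<theta> + \<alpha>)"
proof -
  have "phi \<alpha> \<theta> (Suc n) = (\<integral>s. s ^ 1 * (1 - s) ^ (Suc n - 1) * levy_density \<alpha> \<theta> s \<partial>lborel)"
    unfolding phi_def set_lebesgue_integral_def
    by (intro Bochner_Integration.integral_cong) (auto simp: levy_density_def)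
  also have "\<dots> = enn2real (\<integral>\<^sup>+s. ennreal (s ^ 1 * (1 - s) ^ (Suc n - 1) * levy_density \<alpha> \<theta> s) \<partial>lborel)"
    using \<alpha> by (intro integral_eq_nn_integral) (auto simp: levy_density_def)
  also have "\<dots> = \<alpha> * Beta (1 - \<alpha>) (real n + \<theta> + \<alpha>)"
    using assms by (subst nn_integral_levy_beta) (auto simp: Beta_def Gamma_real_pos intro!: divide_nonneg_pos mult_nonneg_nonneg less_imp_le)
  finally show ?thesis .
qed

lemma Beta_real_pos: "0 < a \<Longrightarrow> 0 < b \<Longrightarrow> 0 < Beta a (b :: real)"
  by (simp add: Beta_def Gamma_real_pos)

lemma phi_pos:
  assumes "0 < \<alpha>" "\<alpha> < 1" "0 < \<theta>" "1 \<le> k"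
  shows "0 < phi \<alpha> \<theta> k"
proof -
  obtain n where "k = Suc n" using assms(4) by (cases k) auto
  then show ?thesis using assms by (simp add: phi_eq_Beta Beta_real_pos)
qed

subsection \<open>Column patterns\<close>

text \<open>A column is read as a binary number with row 0 as the most significant bit. Appending a
  row doubles it, forgetting rows is integer division, and numerical order is lexicographic order of
  columns, on which the sorting at the end relies.\<close>

primrec pattern :: "nat \<Rightarrow> (nat \<Rightarrow> bool) \<Rightarrow> nat" where
  "pattern 0 x = 0"
| "pattern (Suc n) x = 2 * pattern n x + of_bool (x n)"

fun popcount :: "nat \<Rightarrow> nat" where
  "popcount v = (if v = 0 then 0 else v mod 2 + popcount (v div 2))"

declare popcount.simps[simp del]

lemma popcount_0[simp]: "popcount 0 = 0"
  by (subst popcount.simps) simp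

lemma popcount_double[simp]: "popcount (2 * v) = popcount v"
  by (subst popcount.simps) simp

lemma popcount_Suc_double[simp]: "popcount (Suc (2 * v)) = Suc (popcount v)"
  by (subst popcount.simps) simp

lemma popcount_pattern: "popcount (pattern n x) = (\<Sum>i<n. of_bool (x i))"
  by (induction n) auto

lemma popcount_pos: "0 < v \<Longrightarrow> 1 \<le> popcount v"
proof (induction v rule: popcount.induct)
  case (1 v)
  show ?case
  proof (cases "v mod 2 = 0")
    case True
    then have "0 < v div 2" using 1(2) by presburger
    then show ?thesis using 1 by (subst popcount.simps) auto
  next
    case False
    then show ?thesis using 1(2) by (subst popcount.simps) auto
  qed
qed

lemma popcount_le: "v < 2 ^ n \<Longrightarrow> popcount v \<le> n"
proof (induction n arbitrary: v)
  case (Suc n)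
  have "popcount (v div 2) \<le> n" using Suc.prems by (intro Suc.IH) auto
  moreover have "v mod 2 \<le> 1" by simp
  ultimately show ?case by (subst popcount.simps) auto
qed simp

lemma pattern_less: "pattern n x < 2 ^ n"
  by (induction n) auto

lemma pattern_pos_iff: "0 < pattern n x \<longleftrightarrow> (\<exists>i<n. x i)"
  by (induction n) (auto simp: less_Suc_eq)

lemma pattern_cong: "(\<And>i. i < n \<Longrightarrow> x i = y i) \<Longrightarrow> pattern n x = pattern n y"
  by (induction n) auto

lemma pattern_eq_iff: "pattern n x = pattern n y \<longleftrightarrow> (\<forall>i<n. x i = y i)"
proof (induction n)
  case (Suc n)
  have *: "2 * a + of_bool p = 2 * b + of_bool q \<longleftrightarrow> a = b \<and> p = q" for a b :: nat and p q
    by (cases p; cases q) (simp_all add: of_bool_def, arith+)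
  then show ?case using Suc by (simp add: * less_Suc_eq) blast
qed simp

abbreviation (input) column :: "binary_matrix \<Rightarrow> nat \<Rightarrow> nat \<Rightarrow> bool" where
  "column Z k \<equiv> (\<lambda>i. Z i k)"

lemma column_count_eq: "column_count Z n k = popcount (pattern n (column Z k))"
  by (simp add: column_count_def popcount_pattern)

lemma column_count_pos_iff: "0 < column_count Z n k \<longleftrightarrow> 0 < pattern n (column Z k)"
  unfolding column_count_eq using popcount_pos[of "pattern n (column Z k)"]
  by (cases "pattern n (column Z k) = 0") auto

lemma pattern_first_rows[simp]: "pattern n (column (first_rows n Z) k) = pattern n (column Z k)"
  by (intro pattern_cong) (simp add: first_rows_def)

lemma space_matrix_space[simp]: "space matrix_space = UNIV"
  by (auto simp: matrix_space_def space_PiM)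

lemma entry_measurable[measurable]: "(\<lambda>Z. Z i k) \<in> measurable matrix_space (count_space UNIV)"
proof -
  have "(\<lambda>Z. Z i) \<in> measurable matrix_space (PiM UNIV (\<lambda>_. count_space UNIV))"
    unfolding matrix_space_def by (rule measurable_component_singleton) simp
  moreover have "(\<lambda>y. y k) \<in> measurable (PiM UNIV (\<lambda>_. count_space UNIV)) (count_space UNIV)"
    by (rule measurable_component_singleton) simp
  ultimately show ?thesis by (rule measurable_compose)
qed

lemma pattern_measurable[measurable]:
  "(\<lambda>Z. pattern n (column Z k)) \<in> measurable matrix_space (count_space UNIV)"
  by (induction n) simp_all

text \<open>Per unit of \<open>\<zeta>\<close>, the expected number of columns showing the pattern
  \<open>v\<close>, evaluated as a beta integral. It has this meaning for
  \<open>0 < v < 2 ^ n\<close> only; for \<open>v = 0\<close> the integral diverges, and sums over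
  patterns start at 1.\<close>

definition pattern_mass :: "real \<Rightarrow> real \<Rightarrow> nat \<Rightarrow> nat \<Rightarrow> real" where
  "pattern_mass \<alpha> \<theta> n v = \<alpha> * Beta (real (popcount v) - \<alpha>) (real n - real (popcount v) + \<theta> + \<alpha>)"

text \<open>The expected weight of the pattern of an old column after one more row.\<close>

definition next_weight :: "real \<Rightarrow> real \<Rightarrow> nat \<Rightarrow> (nat \<Rightarrow> real) \<Rightarrow> nat \<Rightarrow> real" where
  "next_weight \<alpha> \<theta> n u v =
     (real (popcount v) - \<alpha>) / (\<theta> + real n) * u (Suc (2 * v)) +
     (1 - (real (popcount v) - \<alpha>) / (\<theta> + real n)) * u (2 * v)"

definition total_weight :: "real \<Rightarrow> real \<Rightarrow> nat \<Rightarrow> (nat \<Rightarrow> real) \<Rightarrow> real" where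
  "total_weight \<alpha> \<theta> n u = (\<Sum>v\<in>{1..<2 ^ n}. u v * pattern_mass \<alpha> \<theta> n v)"

text \<open>The non-zero patterns after one more row: each old pattern \<open>v\<close> has the
  children \<open>2 * v\<close> and \<open>Suc (2 * v)\<close>, and the pattern 1 belongs to columns
  selected for the first time in the new row.\<close>

lemma sum_even_odd:
  fixes f :: "nat \<Rightarrow> 'a::comm_monoid_add"
  assumes "1 \<le> m"
  shows "(\<Sum>v\<in>{1..<2 * m}. f v) = (\<Sum>v\<in>{1..<m}. f (2 * v) + f (Suc (2 * v))) + f 1"
  using assms
proof (induction m rule: dec_induct)
  case (step m)
  have "{1..<2 * Suc m} = insert (Suc (2 * m)) (insert (2 * m) {1..<2 * m})" using step by auto
  moreover have "{1..<Suc m} = insert m {1..<m}" using step by auto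
  ultimately show ?case using step by (simp add: ac_simps)
qed (simp add: numeral_2_eq_2)

locale urn_params =
  fixes \<sigma> \<alpha> \<theta> :: real
  assumes \<sigma>: "0 < \<sigma>" "\<sigma> < 1" and \<alpha>: "0 < \<alpha>" "\<alpha> < 1" and \<theta>: "0 < \<theta>"
begin

text \<open>The recurrences of the beta function in either argument: with
  \<open>a = popcount v - \<alpha>\<close> and \<open>a + b = \<theta> + n\<close>, the urn
  probability is \<open>a / (a + b)\<close>, the mean of the beta law with these parameters.\<close>

lemma pattern_mass_step:
  assumes v: "v \<in> {1..<2 ^ n}"
  defines "q \<equiv> (real (popcount v) - \<alpha>) / (\<theta> + real n)"
  shows "pattern_mass \<alpha> \<theta> (Suc n) (Suc (2 * v)) = q * pattern_mass \<alpha> \<theta> n v"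
    and "pattern_mass \<alpha> \<theta> (Suc n) (2 * v) = (1 - q) * pattern_mass \<alpha> \<theta> n v"
    and "0 \<le> q" "q \<le> 1"
proof -
  define a b where "a = real (popcount v) - \<alpha>" and "b = real n - real (popcount v) + \<theta> + \<alpha>"
  have pc: "1 \<le> popcount v" "popcount v \<le> n" using v popcount_pos[of v] popcount_le[of v n] by auto
  then have ab: "0 < a" "0 < b" using \<alpha> \<theta> by (auto simp: a_def b_def)
  have s: "a + b = \<theta> + real n" by (simp add: a_def b_def)
  have q: "q = a / (a + b)" by (simp add: q_def s a_def[symmetric])
  have "(a + b) * Beta (a + 1) b = a * Beta a b"
    using ab by (intro Beta_plus1_left) (auto elim: nonpos_Ints_cases)
  then have 1: "Beta (a + 1) b = q * Beta a b" using ab by (simp add: q field_simps)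
  have "(a + b) * Beta a (b + 1) = b * Beta a b"
    using ab by (intro Beta_plus1_right) (auto elim: nonpos_Ints_cases)
  then have 2: "Beta a (b + 1) = (1 - q) * Beta a b" using ab by (simp add: q field_simps)
  have "pattern_mass \<alpha> \<theta> (Suc n) (Suc (2 * v)) = \<alpha> * Beta (a + 1) b"
    unfolding pattern_mass_def a_def b_def by (intro arg_cong[where f="(*) \<alpha>"] arg_cong2[where f=Beta]) simp_all
  then show "pattern_mass \<alpha> \<theta> (Suc n) (Suc (2 * v)) = q * pattern_mass \<alpha> \<theta> n v"
    by (simp only: 1 pattern_mass_def a_def[symmetric] b_def[symmetric] mult.left_commute)
  have "pattern_mass \<alpha> \<theta> (Suc n) (2 * v) = \<alpha> * Beta a (b + 1)"
    unfolding pattern_mass_def a_def b_def by (intro arg_cong[where f="(*) \<alpha>"] arg_cong2[where f=Beta]) simp_all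
  then show "pattern_mass \<alpha> \<theta> (Suc n) (2 * v) = (1 - q) * pattern_mass \<alpha> \<theta> n v"
    by (simp only: 2 pattern_mass_def a_def[symmetric] b_def[symmetric] mult.left_commute)
  show "0 \<le> q" "q \<le> 1" using ab by (auto simp: q divide_simps)
qed

lemma pattern_mass_nonneg: "v \<in> {1..<2 ^ n} \<Longrightarrow> 0 \<le> pattern_mass \<alpha> \<theta> n v"
  using popcount_pos[of v] popcount_le[of v n] \<alpha> \<theta>
  by (auto simp: pattern_mass_def intro!: mult_nonneg_nonneg less_imp_le[OF Beta_real_pos])

lemma total_weight_nonneg: "(\<And>v. 0 \<le> u v) \<Longrightarrow> 0 \<le> total_weight \<alpha> \<theta> n u"
  unfolding total_weight_def by (intro sum_nonneg mult_nonneg_nonneg pattern_mass_nonneg)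

lemma next_weight_nonneg: "(\<And>v. 0 \<le> u v) \<Longrightarrow> v \<in> {1..<2 ^ n} \<Longrightarrow> 0 \<le> next_weight \<alpha> \<theta> n u v"
  unfolding next_weight_def using pattern_mass_step(3,4)[of v n]
  by (intro add_nonneg_nonneg mult_nonneg_nonneg) auto

text \<open>Averaging the new entry of each old column replaces \<open>u\<close> by
  \<open>next_weight\<close>, and first-time columns contribute their mass
  \<open>phi \<alpha> \<theta> (Suc n)\<close> with pattern 1. This is the algebraic counterpart of
  one step of the urn.\<close>

lemma total_weight_Suc:
  "total_weight \<alpha> \<theta> (Suc n) u = total_weight \<alpha> \<theta> n (next_weight \<alpha> \<theta> n u) + phi \<alpha> \<theta> (Suc n) * u 1"
proof -
  have pc1: "popcount (Suc 0) = 1" using popcount_Suc_double[of 0] by simp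
  have "total_weight \<alpha> \<theta> (Suc n) u =
    (\<Sum>v\<in>{1..<2 ^ n}. u (2 * v) * pattern_mass \<alpha> \<theta> (Suc n) (2 * v) +
      u (Suc (2 * v)) * pattern_mass \<alpha> \<theta> (Suc n) (Suc (2 * v))) + u 1 * pattern_mass \<alpha> \<theta> (Suc n) 1"
    unfolding total_weight_def power_Suc by (rule sum_even_odd) simp
  also have "pattern_mass \<alpha> \<theta> (Suc n) 1 = phi \<alpha> \<theta> (Suc n)"
    using \<alpha> \<theta> by (simp add: pattern_mass_def pc1 phi_eq_Beta)
  also have "(\<Sum>v\<in>{1..<2 ^ n}. u (2 * v) * pattern_mass \<alpha> \<theta> (Suc n) (2 * v) +
      u (Suc (2 * v)) * pattern_mass \<alpha> \<theta> (Suc n) (Suc (2 * v))) =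
    total_weight \<alpha> \<theta> n (next_weight \<alpha> \<theta> n u)"
    unfolding total_weight_def
    by (intro sum.cong refl, subst pattern_mass_step(1,2), assumption, subst pattern_mass_step(1,2), assumption)
       (simp add: next_weight_def distrib_left mult_ac)
  finally show ?thesis by (simp add: mult.commute)
qed

lemma total_weight_1: "total_weight \<alpha> \<theta> n (\<lambda>_. 1) = (\<Sum>j=1..n. phi \<alpha> \<theta> j)"
proof (induction n)
  case (Suc n)
  have "next_weight \<alpha> \<theta> n (\<lambda>_. 1) = (\<lambda>_. 1)" by (auto simp: next_weight_def)
  then show ?case using Suc by (simp add: total_weight_Suc)
qed (simp add: total_weight_def)

lemma sum_phi_pos: "1 \<le> n \<Longrightarrow> 0 < (\<Sum>j=1..n. phi \<alpha> \<theta> j)"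
  by (intro sum_pos) (auto intro!: phi_pos \<alpha> \<theta>)

end

text \<open>The exponential series under the integral. It removes the restriction to a fixed number
  of columns and yields the form in which the feature model delivers the functional.\<close>

lemma suminf_BFRY_moment:
  assumes S: "0 \<le> S"
  shows "(\<Sum>j. ennreal (S ^ j / fact j) * BFRY_moment \<sigma> j T) = (\<integral>\<^sup>+z. ennreal (exp (- (T - S) * z)) \<partial>BFRY \<sigma>)"
proof -
  have "(\<Sum>j. ennreal (S ^ j / fact j) * BFRY_moment \<sigma> j T) =
     (\<Sum>j. \<integral>\<^sup>+z. ennreal (S ^ j / fact j) * ennreal (z ^ j * exp (- T * z)) \<partial>BFRY \<sigma>)"
    unfolding BFRY_moment_def by (subst nn_integral_cmult) auto
  also have "\<dots> = (\<integral>\<^sup>+z. (\<Sum>j. ennreal (S ^ j / fact j) * ennreal (z ^ j * exp (- T * z))) \<partial>BFRY \<sigma>)"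
    by (rule nn_integral_suminf[symmetric]) measurable
  also have "\<dots> = (\<integral>\<^sup>+z. ennreal (exp (- (T - S) * z)) \<partial>BFRY \<sigma>)"
    using AE_BFRY_pos
  proof (intro nn_integral_cong_AE, eventually_elim)
    fix z :: real assume z: "0 < z"
    have "(\<lambda>j. (S * z) ^ j /\<^sub>R fact j * exp (- T * z)) sums (exp (S * z) * exp (- T * z))"
      by (intro sums_mult2 exp_converges)
    then have "(\<lambda>j. S ^ j / fact j * (z ^ j * exp (- T * z))) sums exp (- (T - S) * z)"
      by (simp add: power_mult_distrib divide_inverse ac_simps algebra_simps flip: exp_add)
    then have "(\<Sum>j. ennreal (S ^ j / fact j * (z ^ j * exp (- T * z)))) = ennreal (exp (- (T - S) * z))"
      using S z by (intro suminf_ennreal_eq) auto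
    then show "(\<Sum>j. ennreal (S ^ j / fact j) * ennreal (z ^ j * exp (- T * z))) = ennreal (exp (- (T - S) * z))"
      using S z by (simp add: ennreal_mult'[symmetric])
  qed
  finally show ?thesis .
qed

text \<open>The index set \<open>I\<close> may be infinite; passing to the marginal on
  \<open>J\<close> reduces the claim to a finite product measure.\<close>

lemma nn_integral_PiM_prod:
  fixes M :: "'i \<Rightarrow> 'a measure" and f :: "'i \<Rightarrow> 'a \<Rightarrow> ennreal"
  assumes M: "\<And>i. prob_space (M i)" and J: "finite J" "J \<subseteq> I"
    and f: "\<And>i. i \<in> J \<Longrightarrow> f i \<in> borel_measurable (M i)"
  shows "(\<integral>\<^sup>+x. (\<Prod>i\<in>J. f i (x i)) \<partial>PiM I M) = (\<Prod>i\<in>J. \<integral>\<^sup>+x. f i x \<partial>M i)"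
proof -
  interpret product_prob_space M I
    using M by (simp add: product_prob_space_def product_prob_space_axioms_def product_sigma_finite_def prob_space_imp_sigma_finite)
  have "(\<lambda>x. \<Prod>i\<in>J. f i (x i)) \<in> borel_measurable (PiM J M)"
    using f by (intro borel_measurable_prod_ennreal) (auto intro: measurable_compose[OF measurable_component_singleton])
  then have "(\<integral>\<^sup>+x. (\<Prod>i\<in>J. f i (x i)) \<partial>distr (PiM I M) (PiM J M) (\<lambda>x. restrict x J)) =
     (\<integral>\<^sup>+x. (\<Prod>i\<in>J. f i (restrict x J i)) \<partial>PiM I M)"
    using J by (intro nn_integral_distr measurable_restrict_subset) auto
  then have "(\<integral>\<^sup>+x. (\<Prod>i\<in>J. f i (x i)) \<partial>PiM I M) = (\<integral>\<^sup>+x. (\<Prod>i\<in>J. f i (x i)) \<partial>PiM J M)"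
    unfolding distr_PiM_restrict_finite[OF J] by (simp cong: prod.cong)
  also have "\<dots> = (\<Prod>i\<in>J. \<integral>\<^sup>+x. f i x \<partial>M i)"
    using f by (intro product_nn_integral_prod J) auto
  finally show ?thesis .
qed

subsection \<open>The generating functional of the urn scheme\<close>

text \<open>New features are appended directly behind the old ones, so in the urn the non-zero
  columns form an initial segment. This pins down both \<open>K_n = j\<close> and a finite range for
  the product over columns.\<close>

definition initial_support :: "nat \<Rightarrow> nat \<Rightarrow> binary_matrix \<Rightarrow> bool" where
  "initial_support n j X \<longleftrightarrow> (\<forall>k. 0 < pattern n (column X k) \<longleftrightarrow> k < j)"

definition initial_weight :: "nat \<Rightarrow> (nat \<Rightarrow> real) \<Rightarrow> nat \<Rightarrow> binary_matrix \<Rightarrow> ennreal" where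
  "initial_weight n u j X =
     (if initial_support n j X then ennreal (\<Prod>k<j. u (pattern n (column X k))) else 0)"

lemma initial_support_measurable[measurable]: "Measurable.pred matrix_space (initial_support n j)"
  unfolding initial_support_def by measurable

lemma weight_measurable[measurable]:
  "(\<lambda>X. u (pattern n (column X k)) :: real) \<in> borel_measurable matrix_space"
  by (rule measurable_compose[OF pattern_measurable]) simp

lemma initial_weight_measurable[measurable]: "initial_weight n u j \<in> borel_measurable matrix_space"
  unfolding initial_weight_def by measurable

lemma initial_support_num_features: "initial_support n j X \<Longrightarrow> num_features X n = j"
  by (simp add: num_features_def column_count_pos_iff initial_support_def)

lemma initial_weight_first_rows[simp]: "initial_weight n u j (first_rows n X) = initial_weight n u j X"
  by (simp add: initial_weight_def initial_support_def)

lemma initial_support_unique: "initial_support n i X \<Longrightarrow> initial_support n j X \<Longrightarrow> i = j"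
  using initial_support_num_features by metis

lemma initial_support_Suc_le:
  assumes "initial_support n i X" "initial_support (Suc n) j X" shows "i \<le> j"
proof (rule ccontr)
  assume "\<not> i \<le> j"
  then have "0 < pattern n (column X j)" using assms(1) by (simp add: initial_support_def)
  then have "0 < pattern (Suc n) (column X j)" by simp
  then show False using assms(2) unfolding initial_support_def by blast
qed

lemma measurable_generated_by:
  assumes "\<And>\<omega>. \<omega> \<in> space M \<Longrightarrow> X \<omega> \<in> space N" and g: "g \<in> measurable N S"
  shows "(\<lambda>\<omega>. g (X \<omega>)) \<in> measurable (generated_by M N X) S"
  using assms(1) by (intro measurable_compose[OF measurable_vimage_algebra1 g]) auto

text \<open>One row of the scheme: \<open>a k\<close> is the pattern of column \<open>k\<close> so far and \<open>h\<close> the number of new columns.\<close>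

lemma nn_integral_next_row:
  assumes a: "\<And>k. 0 < a k \<longleftrightarrow> k < j" and q: "\<And>k. k < j \<Longrightarrow> 0 \<le> q k \<and> q k \<le> 1"
    and u: "\<And>v. 0 \<le> u v" and j': "j \<le> j'"
  shows "(\<integral>\<^sup>+y. (if \<forall>k. 0 < 2 * a k + of_bool (y k) \<longleftrightarrow> k < j'
           then ennreal (\<Prod>k<j'. u (2 * a k + of_bool (y k))) else 0)
         \<partial>PiM UNIV (\<lambda>k. measure_pmf (if k < j then bernoulli_pmf (q k) else return_pmf (k < j + h)))) =
    (if j + h = j' then ennreal (u 1 ^ h * (\<Prod>k<j. q k * u (Suc (2 * a k)) + (1 - q k) * u (2 * a k))) else 0)"
    (is "integral\<^sup>N ?K ?f = _")
proof -
  let ?m = "\<lambda>k. measure_pmf (if k < j then bernoulli_pmf (q k) else return_pmf (k < j + h))"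
  interpret product_prob_space ?m UNIV
    by unfold_locales
  have "AE y in ?K. y k = (k < j + h)" if "j \<le> k" for k
    using that by (intro AE_component) (auto simp: AE_measure_pmf_iff)
  \<comment> \<open>Behind the old columns every factor of the kernel is a point mass, and countably
    many almost sure statements combine into one.\<close>
  then have AE: "AE y in ?K. \<forall>k. j \<le> k \<longrightarrow> y k = (k < j + h)"
    by (subst AE_all_countable) auto
  have "integral\<^sup>N ?K ?f =
    (\<integral>\<^sup>+y. (if j + h = j' then ennreal (u 1 ^ h) else 0) * (\<Prod>k<j. ennreal (u (2 * a k + of_bool (y k)))) \<partial>?K)"
    using AE
  proof (intro nn_integral_cong_AE, eventually_elim)
    fix y assume y: "\<forall>k. j \<le> k \<longrightarrow> y k = (k < j + h)"
    have iff: "0 < 2 * a k + of_bool (y k) \<longleftrightarrow> k < j + h" for k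
      using y a[of k] by (cases "k < j") auto
    have a0: "a k = 0" if "j \<le> k" for k using a[of k] that by auto
    show "?f y = (if j + h = j' then ennreal (u 1 ^ h) else 0) * (\<Prod>k<j. ennreal (u (2 * a k + of_bool (y k))))"
    proof (cases "j + h = j'")
      case True
      have "(\<Prod>k<j'. u (2 * a k + of_bool (y k))) =
        (\<Prod>k<j. u (2 * a k + of_bool (y k))) * (\<Prod>k\<in>{j..<j'}. u (2 * a k + of_bool (y k)))"
        using j' by (subst prod.union_disjoint[symmetric]) (auto intro!: prod.cong)
      also have "(\<Prod>k\<in>{j..<j'}. u (2 * a k + of_bool (y k))) = (\<Prod>k\<in>{j..<j'}. u 1)"
        using y a0 True by (intro prod.cong) auto
      also have "\<dots> = u 1 ^ h" using True by auto
      finally show ?thesis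
        using True iff u by (simp add: ennreal_mult prod_nonneg mult.commute prod_ennreal)
    next
      case False
      have "\<not> (\<forall>k. 0 < 2 * a k + of_bool (y k) \<longleftrightarrow> k < j')"
      proof
        assume *: "\<forall>k. 0 < 2 * a k + of_bool (y k) \<longleftrightarrow> k < j'"
        then have "k < j + h \<longleftrightarrow> k < j'" for k using iff by metis
        then show False using False by (metis less_irrefl linorder_neqE_nat)
      qed
      then show ?thesis using False by (simp only: if_False mult_zero_left)
    qed
  qed
  also have "\<dots> = (if j + h = j' then ennreal (u 1 ^ h) else 0) * (\<integral>\<^sup>+y. (\<Prod>k<j. ennreal (u (2 * a k + of_bool (y k)))) \<partial>?K)"
  proof (rule nn_integral_cmult)
    have "(\<lambda>y. ennreal (u (2 * a k + of_bool (y k)))) \<in> borel_measurable ?K" for k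
      by (rule measurable_compose[OF measurable_component_singleton]) auto
    then show "(\<lambda>y. \<Prod>k<j. ennreal (u (2 * a k + of_bool (y k)))) \<in> borel_measurable ?K"
      by (rule borel_measurable_prod_ennreal)
  qed
  also have "(\<integral>\<^sup>+y. (\<Prod>k<j. ennreal (u (2 * a k + of_bool (y k)))) \<partial>?K) =
     (\<Prod>k<j. \<integral>\<^sup>+b. ennreal (u (2 * a k + of_bool b)) \<partial>?m k)"
    by (rule nn_integral_PiM_prod) (auto simp: measure_pmf.prob_space_axioms)
  also have "\<dots> = (\<Prod>k<j. ennreal (q k * u (Suc (2 * a k)) + (1 - q k) * u (2 * a k)))"
    using q u by (intro prod.cong refl) (auto simp: mult.commute simp flip: ennreal_mult ennreal_plus)
  also have "\<dots> = ennreal (\<Prod>k<j. q k * u (Suc (2 * a k)) + (1 - q k) * u (2 * a k))"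
    using q u by (intro prod_ennreal) auto
  finally have eq: "integral\<^sup>N ?K ?f = (if j + h = j' then ennreal (u 1 ^ h) else 0) *
    ennreal (\<Prod>k<j. q k * u (Suc (2 * a k)) + (1 - q k) * u (2 * a k))" .
  have "0 \<le> (\<Prod>k<j. q k * u (Suc (2 * a k)) + (1 - q k) * u (2 * a k))"
    using q u by (intro prod_nonneg ballI add_nonneg_nonneg mult_nonneg_nonneg) auto
  then show ?thesis
    unfolding eq using u by (simp add: ennreal_mult)
qed

text \<open>The convolution that merges \<open>j\<close> old with \<open>m - j\<close> new columns
  into \<open>m\<close> columns, in the exponential normalisation of Poisson weights.\<close>

lemma ennreal_binomial:
  assumes "0 \<le> a" "0 \<le> (b :: real)"
  shows "(\<Sum>j\<le>m. ennreal (a ^ j / fact j) * ennreal (b ^ (m - j) / fact (m - j))) = ennreal ((a + b) ^ m / fact m)"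
proof -
  have "(\<Sum>j\<le>m. ennreal (a ^ j / fact j) * ennreal (b ^ (m - j) / fact (m - j))) =
     ennreal (\<Sum>j\<le>m. a ^ j / fact j * (b ^ (m - j) / fact (m - j)))"
  proof -
    have "ennreal (a ^ j / fact j) * ennreal (b ^ (m - j) / fact (m - j)) =
      ennreal (a ^ j / fact j * (b ^ (m - j) / fact (m - j)))" for j
      using assms by (intro ennreal_mult[symmetric]) auto
    then show ?thesis using assms by (simp only:) (rule sum_ennreal, auto)
  qed
  also have "(\<Sum>j\<le>m. a ^ j / fact j * (b ^ (m - j) / fact (m - j))) = (a + b) ^ m / fact m"
    by (subst binomial_ring) (auto simp: sum_divide_distrib binomial_fact intro!: sum.cong)
  finally show ?thesis .
qed

text \<open>Phrased as a vanishing integral of an indicator so that it can be inserted into the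
  conditional integration rule, which then gives an almost sure statement on the underlying
  space.\<close>

lemma nn_integral_Gamma_uniform_null:
  assumes "0 < a"
  shows "(\<integral>\<^sup>+p. indicator {p. \<not> (0 < fst p \<and> snd p \<in> {0..1::real})} p \<partial>(Gamma_law a \<Otimes>\<^sub>M uniform_measure lborel {0..1})) = 0"
    (is "nn_integral ?K (indicator ?bad) = 0")
proof -
  interpret G: prob_space "Gamma_law a" by (rule prob_space_Gamma_law[OF assms])
  interpret U: prob_space "uniform_measure lborel {0..1::real}" by (rule prob_space_uniform_measure) auto
  interpret P: pair_prob_space "Gamma_law a" "uniform_measure lborel {0..1::real}"
    by unfold_locales
  have "AE p in ?K. 0 < fst p \<and> snd p \<in> {0..1}"
  proof (rule P.AE_pair_measure)
    show "{p \<in> space ?K. 0 < fst p \<and> snd p \<in> {0..1}} \<in> sets ?K"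
      by measurable
    have y: "AE y in uniform_measure lborel {0..1::real}. y \<in> {0..1}"
      by (rule AE_uniform_measureI) auto
    show "AE x in Gamma_law a. AE y in uniform_measure lborel {0..1::real}. 0 < fst (x, y) \<and> snd (x, y) \<in> {0..1}"
      using AE_Gamma_law_pos[of a]
    proof eventually_elim
      fix x :: real assume "0 < x"
      then show "AE y in uniform_measure lborel {0..1::real}. 0 < fst (x, y) \<and> snd (x, y) \<in> {0..1}"
        using y by (auto elim: eventually_mono)
    qed
  qed
  then have "nn_integral ?K (indicator ?bad) = (\<integral>\<^sup>+p. 0 \<partial>?K)"
  proof (intro nn_integral_cong_AE, eventually_elim)
    fix p :: "real \<times> real" assume "0 < fst p \<and> snd p \<in> {0..1}"
    then show "indicator ?bad p = (0 :: ennreal)" by (simp add: indicator_def)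
  qed
  then show ?thesis by simp
qed

section \<open>First row of the urn, and almost sure shape of the first rows\<close>

locale BFRY_urn_params = BFRY_urn + urn_params
begin

lemma zeta_measurable[measurable]: "\<zeta> \<in> borel_measurable M"
  using distributed_measurable[OF zeta_law] by simp

lemma prob_space_BFRY: "prob_space (BFRY \<sigma>)"
proof -
  have "distr M lborel \<zeta> = BFRY \<sigma>"
    using zeta_law by (simp add: distributed_def BFRY_def)
  moreover have "prob_space (distr M lborel \<zeta>)" by (rule prob_space_distr) simp
  ultimately show ?thesis by simp
qed

lemma history_in_space: "history n \<omega> \<in> space (history_space n)"
  by (auto simp: history_def history_space_def space_pair_measure space_PiM)

abbreviation T :: "nat \<Rightarrow> real" where
  "T n \<equiv> (\<Sum>j=1..n. phi \<alpha> \<theta> j)"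

abbreviation W :: "nat \<Rightarrow> (nat \<Rightarrow> real) \<Rightarrow> real" where
  "W \<equiv> total_weight \<alpha> \<theta>"

lemmas Z_meas[measurable] = Z_measurable

text \<open>The base of the induction, and the one place where a conditional law of the scheme
  evaluates \<open>\<zeta>\<close>: a Poisson mass with rate
  \<open>\<zeta> * phi \<alpha> \<theta> 1\<close>, all columns having the single pattern 1.\<close>

lemma initial_weight_1:
  assumes u: "\<And>v. 0 \<le> u v"
  shows "(\<integral>\<^sup>+\<omega>. initial_weight 1 u j (Z \<omega>) \<partial>M) = ennreal (W 1 u ^ j / fact j) * BFRY_moment \<sigma> j (T 1)"
proof -
  have phi1: "0 < phi \<alpha> \<theta> 1" by (intro phi_pos \<alpha> \<theta>) simp
  have "AE \<omega> in M. initial_weight 1 u j (Z \<omega>) = ennreal (u 1 ^ j) * indicator {j} (H 1 \<omega>)"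
    using row_first
  proof eventually_elim
    fix \<omega> assume *: "\<forall>k. Z \<omega> 0 k \<longleftrightarrow> k < H 1 \<omega>"
    have "initial_support 1 j (Z \<omega>) \<longleftrightarrow> H 1 \<omega> = j"
    proof -
      have "initial_support 1 j (Z \<omega>) \<longleftrightarrow> (\<forall>k. k < H 1 \<omega> \<longleftrightarrow> k < j)"
        unfolding initial_support_def using * by simp
      also have "\<dots> \<longleftrightarrow> H 1 \<omega> = j"
        by (metis linorder_neqE_nat less_irrefl)
      finally show ?thesis .
    qed
    moreover have "(\<Prod>k<H 1 \<omega>. u (pattern 1 (column (Z \<omega>) k))) = u 1 ^ H 1 \<omega>"
      using * by simp
    ultimately show "initial_weight 1 u j (Z \<omega>) = ennreal (u 1 ^ j) * indicator {j} (H 1 \<omega>)"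
      by (auto simp: initial_weight_def)
  qed
  then have "(\<integral>\<^sup>+\<omega>. initial_weight 1 u j (Z \<omega>) \<partial>M) = (\<integral>\<^sup>+\<omega>. ennreal (u 1 ^ j) * indicator {j} (H 1 \<omega>) \<partial>M)"
    by (rule nn_integral_cong_AE)
  also have "\<dots> = (\<integral>\<^sup>+\<omega>. (\<integral>\<^sup>+h. ennreal (u 1 ^ j) * indicator {j} h \<partial>measure_pmf (poisson_pmf (\<zeta> \<omega> * phi \<alpha> \<theta> 1))) \<partial>M)"
    by (rule cond_distributed_nn_integral_marginal[OF prob_space_axioms H_first])
       (simp_all add: measure_pmf.prob_space_axioms)
  also have "\<dots> = (\<integral>\<^sup>+\<omega>. ennreal (u 1 ^ j) * ennreal ((\<zeta> \<omega> * phi \<alpha> \<theta> 1) ^ j / fact j * exp (- (\<zeta> \<omega> * phi \<alpha> \<theta> 1))) \<partial>M)"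
    using AE_BFRY_distributed_pos[OF zeta_law]
  proof (intro nn_integral_cong_AE, eventually_elim)
    fix \<omega> assume "0 < \<zeta> \<omega>"
    then have "0 < \<zeta> \<omega> * phi \<alpha> \<theta> 1" using phi1 by simp
    then show "(\<integral>\<^sup>+h. ennreal (u 1 ^ j) * indicator {j} h \<partial>measure_pmf (poisson_pmf (\<zeta> \<omega> * phi \<alpha> \<theta> 1))) =
        ennreal (u 1 ^ j) * ennreal ((\<zeta> \<omega> * phi \<alpha> \<theta> 1) ^ j / fact j * exp (- (\<zeta> \<omega> * phi \<alpha> \<theta> 1)))"
      by (subst nn_integral_cmult) (auto simp: emeasure_pmf_single)
  qed
  also have "\<dots> = (\<integral>\<^sup>+z. ennreal (u 1 ^ j) * ennreal ((z * phi \<alpha> \<theta> 1) ^ j / fact j * exp (- (z * phi \<alpha> \<theta> 1))) \<partial>BFRY \<sigma>)"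
    by (rule nn_integral_BFRY_distributed[OF zeta_law]) measurable
  also have "\<dots> = (\<integral>\<^sup>+z. ennreal (W 1 u ^ j / fact j) * ennreal (z ^ j * exp (- T 1 * z)) \<partial>BFRY \<sigma>)"
    using AE_BFRY_pos
  proof (intro nn_integral_cong_AE, eventually_elim)
    fix z :: real assume z: "0 < z"
    have W1: "W 1 u = phi \<alpha> \<theta> 1 * u 1"
      using total_weight_Suc[of 0 u] by (simp add: total_weight_def)
    have "ennreal (u 1 ^ j) * ennreal ((z * phi \<alpha> \<theta> 1) ^ j / fact j * exp (- (z * phi \<alpha> \<theta> 1))) =
       ennreal (u 1 ^ j * ((z * phi \<alpha> \<theta> 1) ^ j / fact j * exp (- (z * phi \<alpha> \<theta> 1))))"
      using u z phi1 by (intro ennreal_mult[symmetric]) auto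
    also have "u 1 ^ j * ((z * phi \<alpha> \<theta> 1) ^ j / fact j * exp (- (z * phi \<alpha> \<theta> 1))) =
       W 1 u ^ j / fact j * (z ^ j * exp (- T 1 * z))"
      unfolding W1 by (simp add: power_mult_distrib mult_ac)
    also have "ennreal \<dots> = ennreal (W 1 u ^ j / fact j) * ennreal (z ^ j * exp (- T 1 * z))"
      using z u phi1 by (intro ennreal_mult) (auto intro!: divide_nonneg_pos zero_le_power total_weight_nonneg)
    finally show "ennreal (u 1 ^ j) * ennreal ((z * phi \<alpha> \<theta> 1) ^ j / fact j * exp (- (z * phi \<alpha> \<theta> 1))) =
       ennreal (W 1 u ^ j / fact j) * ennreal (z ^ j * exp (- T 1 * z))" .
  qed
  also have "\<dots> = ennreal (W 1 u ^ j / fact j) * BFRY_moment \<sigma> j (T 1)"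
    unfolding BFRY_moment_def by (rule nn_integral_cmult) measurable
  finally show ?thesis .
qed

text \<open>With constant weight 1 the functional gives the probabilities of the disjoint events
  over \<open>j\<close>. They sum to one because \<open>T - S\<close> vanishes and BFRY has total
  mass 1, so the shape of the support follows without tracking rows pathwise. The functional is a
  hypothesis because this is needed inside the induction that proves it.\<close>

lemma AE_initial_support:
  assumes n: "1 \<le> n"
    and IH: "\<And>j. (\<integral>\<^sup>+\<omega>. initial_weight n (\<lambda>_. 1) j (Z \<omega>) \<partial>M) = ennreal (W n (\<lambda>_. 1) ^ j / fact j) * BFRY_moment \<sigma> j (T n)"
  shows "AE \<omega> in M. \<exists>j. initial_support n j (Z \<omega>)"
proof -
  let ?A = "\<lambda>j. {\<omega>\<in>space M. initial_support n j (Z \<omega>)}"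
  have "emeasure M (\<Union>j. ?A j) = (\<Sum>j. emeasure M (?A j))"
    by (rule suminf_emeasure[symmetric]) (auto simp: disjoint_family_on_def dest: initial_support_unique)
  also have "\<dots> = (\<Sum>j. \<integral>\<^sup>+\<omega>. initial_weight n (\<lambda>_. 1) j (Z \<omega>) \<partial>M)"
  proof (intro suminf_cong)
    fix j
    have "emeasure M (?A j) = (\<integral>\<^sup>+\<omega>. indicator (?A j) \<omega> \<partial>M)" by (rule nn_integral_indicator[symmetric]) measurable
    also have "\<dots> = (\<integral>\<^sup>+\<omega>. initial_weight n (\<lambda>_. 1) j (Z \<omega>) \<partial>M)"
      by (intro nn_integral_cong) (auto simp: initial_weight_def)
    finally show "emeasure M (?A j) = (\<integral>\<^sup>+\<omega>. initial_weight n (\<lambda>_. 1) j (Z \<omega>) \<partial>M)" .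
  qed
  also have "\<dots> = 1"
  proof -
    interpret B: prob_space "BFRY \<sigma>" by (rule prob_space_BFRY)
    show ?thesis
      unfolding IH total_weight_1 using sum_phi_pos[OF n] B.emeasure_space_1
      by (subst suminf_BFRY_moment) auto
  qed
  finally have "AE \<omega> in M. \<omega> \<in> (\<Union>j. ?A j)"
    by (subst AE_in_set_eq_1) (auto simp: emeasure_eq_measure)
  then show ?thesis by eventually_elim auto
qed

text \<open>Ensures that the Poisson rate of the next step is positive almost surely, where
  \<open>poisson_pmf\<close> has its usual meaning.\<close>

lemma AE_GV:
  assumes n: "1 \<le> n"
  shows "AE \<omega> in M. 0 < G (n + 1) \<omega> \<and> V n \<omega> \<in> {0..1}"
proof -
  let ?K = "\<lambda>\<omega>. Gamma_law (1 - \<sigma> + real (num_features (Z \<omega>) n)) \<Otimes>\<^sub>M uniform_measure lborel {0..1::real}"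
  let ?bad = "{p. \<not> (0 < fst p \<and> snd p \<in> {0..1::real})} :: (real \<times> real) set"
  have U: "prob_space (uniform_measure lborel {0..1::real})" by (rule prob_space_uniform_measure) auto
  have pr: "prob_space (Gamma_law (1 - \<sigma> + real k))" for k using \<sigma> by (intro prob_space_Gamma_law) auto
  have prK: "prob_space (?K \<omega>)" for \<omega>
    using pair_prob_space.intro[of "Gamma_law (1 - \<sigma> + real (num_features (Z \<omega>) n))" "uniform_measure lborel {0..1::real}"] pr U
      prob_space_pair by blast
  have setsK: "sets (?K \<omega>) = sets (borel \<Otimes>\<^sub>M borel)" for \<omega>
    by (rule sets_pair_measure_cong) auto
  have GV[measurable]: "(\<lambda>\<omega>. (G (n + 1) \<omega>, V n \<omega>)) \<in> measurable M (borel \<Otimes>\<^sub>M borel)"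
    using GV_next[OF n] by (simp add: cond_distributed_def)
  have bad[measurable]: "?bad \<in> sets (borel \<Otimes>\<^sub>M borel)"
  proof -
    have "?bad = {p \<in> space (borel \<Otimes>\<^sub>M borel). \<not> (0 < fst p \<and> snd p \<in> {0..1})}" by (simp add: space_pair_measure)
    also have "\<dots> \<in> sets (borel \<Otimes>\<^sub>M borel)" by measurable
    finally show ?thesis .
  qed
  have "(\<integral>\<^sup>+\<omega>. indicator ?bad (G (n + 1) \<omega>, V n \<omega>) \<partial>M) = (\<integral>\<^sup>+\<omega>. (\<integral>\<^sup>+p. indicator ?bad p \<partial>?K \<omega>) \<partial>M)"
    by (rule cond_distributed_nn_integral_marginal[OF prob_space_axioms GV_next[OF n] prK setsK borel_measurable_indicator[OF bad]])
  also have "\<dots> = 0"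
  proof -
    have *: "integral\<^sup>N (?K \<omega>) (indicator ?bad) = 0" for \<omega>
      using \<sigma> by (intro nn_integral_Gamma_uniform_null) simp
    show ?thesis unfolding * by simp
  qed
  finally have 0: "(\<integral>\<^sup>+\<omega>. indicator ?bad (G (n + 1) \<omega>, V n \<omega>) \<partial>M) = 0" .
  have "(\<lambda>\<omega>. indicator ?bad (G (n + 1) \<omega>, V n \<omega>) :: ennreal) \<in> borel_measurable M"
    by (rule measurable_compose[OF GV borel_measurable_indicator[OF bad]])
  from iffD1[OF nn_integral_0_iff_AE[OF this] 0] show ?thesis
    by eventually_elim (simp only: indicator_eq_0_iff mem_Collect_eq fst_conv snd_conv simp_thms not_not)
qed

end

lemma initial_support_first_rows[simp]: "initial_support n j (first_rows n X) = initial_support n j X"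
  by (simp add: initial_support_def)

section \<open>Integrating out one row: its entries, the number of new columns, the gamma and
  uniform variables\<close>

context BFRY_urn_params
begin

text \<open>The three conditional laws of a step condition on three nested amounts of information.
  In each of them the first \<open>n\<close> rows are a projection of the generating tuple and may
  be frozen.\<close>

lemma first_rows_measurable_history:
  "(\<lambda>\<omega>. first_rows n (Z \<omega>)) \<in> measurable (generated_by M (history_space n) (history n)) matrix_space"
  "(\<lambda>\<omega>. (G (n + 1) \<omega>, V n \<omega>, first_rows n (Z \<omega>))) \<in>
     measurable (generated_by M (borel \<Otimes>\<^sub>M borel \<Otimes>\<^sub>M history_space n) (\<lambda>\<omega>. (G (n + 1) \<omega>, V n \<omega>, history n \<omega>)))
       (borel \<Otimes>\<^sub>M borel \<Otimes>\<^sub>M matrix_space)"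
  "(\<lambda>\<omega>. first_rows n (Z \<omega>)) \<in>
     measurable (generated_by M (count_space UNIV \<Otimes>\<^sub>M borel \<Otimes>\<^sub>M borel \<Otimes>\<^sub>M history_space n)
       (\<lambda>\<omega>. (H (n + 1) \<omega>, G (n + 1) \<omega>, V n \<omega>, history n \<omega>))) matrix_space"
proof -
  let ?r = "\<lambda>x. snd (snd (snd (snd x)))"
  have r: "?r \<in> measurable (history_space n) matrix_space"
    unfolding history_space_def by measurable
  have eq: "?r (history n \<omega>) = first_rows n (Z \<omega>)" for \<omega> by (simp add: history_def)
  show "(\<lambda>\<omega>. first_rows n (Z \<omega>)) \<in> measurable (generated_by M (history_space n) (history n)) matrix_space"
    using measurable_generated_by[of M "history n", OF history_in_space r] by (simp only: eq)
  have "(\<lambda>x. (fst x, fst (snd x), ?r (snd (snd x)))) \<in>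
     measurable (borel \<Otimes>\<^sub>M borel \<Otimes>\<^sub>M history_space n) (borel \<Otimes>\<^sub>M borel \<Otimes>\<^sub>M matrix_space)"
    using measurable_compose[OF _ r] by measurable
  from measurable_generated_by[of M "\<lambda>\<omega>. (G (n + 1) \<omega>, V n \<omega>, history n \<omega>)", OF _ this]
  show "(\<lambda>\<omega>. (G (n + 1) \<omega>, V n \<omega>, first_rows n (Z \<omega>))) \<in>
     measurable (generated_by M (borel \<Otimes>\<^sub>M borel \<Otimes>\<^sub>M history_space n) (\<lambda>\<omega>. (G (n + 1) \<omega>, V n \<omega>, history n \<omega>)))
       (borel \<Otimes>\<^sub>M borel \<Otimes>\<^sub>M matrix_space)"
    by (simp add: eq history_in_space space_pair_measure)
  have "(\<lambda>x. ?r (snd (snd (snd x)))) \<in>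
     measurable (count_space UNIV \<Otimes>\<^sub>M borel \<Otimes>\<^sub>M borel \<Otimes>\<^sub>M history_space n) matrix_space"
    using measurable_compose[OF _ r] by measurable
  from measurable_generated_by[of M "\<lambda>\<omega>. (H (n + 1) \<omega>, G (n + 1) \<omega>, V n \<omega>, history n \<omega>)", OF _ this]
  show "(\<lambda>\<omega>. first_rows n (Z \<omega>)) \<in>
     measurable (generated_by M (count_space UNIV \<Otimes>\<^sub>M borel \<Otimes>\<^sub>M borel \<Otimes>\<^sub>M history_space n)
       (\<lambda>\<omega>. (H (n + 1) \<omega>, G (n + 1) \<omega>, V n \<omega>, history n \<omega>))) matrix_space"
    by (simp add: eq history_in_space space_pair_measure)
qed

text \<open>Given the past and \<open>H (n + 1)\<close>, old columns are averaged independently,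
  which turns \<open>u\<close> into \<open>next_weight\<close>, and the new ones are forced. The
  integrand sees only the old rows and the fresh one; \<open>H (n + 1)\<close> enters through the
  kernel and survives as the indicator that exactly \<open>j' - j\<close> columns are new.\<close>

lemma nn_integral_row_step:
  assumes n: "1 \<le> n" and u: "\<And>v. 0 \<le> u v" and j: "j \<le> j'"
  shows "(\<integral>\<^sup>+\<omega>. (if initial_support n j (Z \<omega>) then initial_weight (Suc n) u j' (Z \<omega>) else 0) \<partial>M) =
    (\<integral>\<^sup>+\<omega>. initial_weight n (next_weight \<alpha> \<theta> n u) j (Z \<omega>) *
       (ennreal (u 1 ^ (j' - j)) * indicator {j' - j} (H (n + 1) \<omega>)) \<partial>M)"
proof -
  let ?R = "PiM UNIV (\<lambda>_. count_space UNIV) :: (nat \<Rightarrow> bool) measure"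
  let ?p = "\<lambda>X y k. 2 * pattern n (column X k) + of_bool (y k)"
  define f where "f = (\<lambda>(X, y). if initial_support n j X \<and> (\<forall>k. 0 < ?p X y k \<longleftrightarrow> k < j')
      then ennreal (\<Prod>k<j'. u (?p X y k)) else 0)"
  let ?K = "\<lambda>\<omega>. PiM UNIV (\<lambda>k. measure_pmf
           (if k < num_features (Z \<omega>) n
            then bernoulli_pmf ((real (column_count (Z \<omega>) n k) - \<alpha>) / (\<theta> + real n))
            else return_pmf (k < num_features (Z \<omega>) n + H (n + 1) \<omega>)))"
  have [measurable]: "(\<lambda>p. snd p k) \<in> measurable (matrix_space \<Otimes>\<^sub>M ?R) (count_space UNIV)" for k
    by (rule measurable_compose[OF measurable_snd measurable_component_singleton]) simp
  have p[measurable]: "(\<lambda>p. ?p (fst p) (snd p) k) \<in> measurable (matrix_space \<Otimes>\<^sub>M ?R) (count_space UNIV)" for k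
    by measurable
  have [measurable]: "(\<lambda>p. u (?p (fst p) (snd p) k)) \<in> borel_measurable (matrix_space \<Otimes>\<^sub>M ?R)" for k
    by (rule measurable_compose[OF p]) simp
  have f: "f \<in> borel_measurable (matrix_space \<Otimes>\<^sub>M ?R)"
    unfolding f_def split_beta' by measurable
  have prK: "prob_space (?K \<omega>)" for \<omega>
    by (intro prob_space_PiM measure_pmf.prob_space_axioms)
  have setsK: "sets (?K \<omega>) = sets ?R" for \<omega>
    by (intro sets_PiM_cong) auto
  have "(\<integral>\<^sup>+\<omega>. (if initial_support n j (Z \<omega>) then initial_weight (Suc n) u j' (Z \<omega>) else 0) \<partial>M) =
    (\<integral>\<^sup>+\<omega>. f (first_rows n (Z \<omega>), Z \<omega> n) \<partial>M)"
    by (intro nn_integral_cong) (auto simp: f_def initial_weight_def initial_support_def)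
  also have "\<dots> = (\<integral>\<^sup>+\<omega>. (\<integral>\<^sup>+y. f (first_rows n (Z \<omega>), y) \<partial>?K \<omega>) \<partial>M)"
    by (rule cond_distributed_nn_integral[OF prob_space_axioms row_next[OF n] prK setsK first_rows_measurable_history(3) f])
  also have "\<dots> = (\<integral>\<^sup>+\<omega>. initial_weight n (next_weight \<alpha> \<theta> n u) j (Z \<omega>) *
       (ennreal (u 1 ^ (j' - j)) * indicator {j' - j} (H (n + 1) \<omega>)) \<partial>M)"
  proof (intro nn_integral_cong)
    fix \<omega>
    show "(\<integral>\<^sup>+y. f (first_rows n (Z \<omega>), y) \<partial>?K \<omega>) = initial_weight n (next_weight \<alpha> \<theta> n u) j (Z \<omega>) *
       (ennreal (u 1 ^ (j' - j)) * indicator {j' - j} (H (n + 1) \<omega>))"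
    proof (cases "initial_support n j (Z \<omega>)")
      case True
      define a where "a k = pattern n (column (Z \<omega>) k)" for k
      define q where "q k = (real (column_count (Z \<omega>) n k) - \<alpha>) / (\<theta> + real n)" for k
      have nf: "num_features (Z \<omega>) n = j" using True by (rule initial_support_num_features)
      have a: "0 < a k \<longleftrightarrow> k < j" for k using True by (simp add: a_def initial_support_def)
      have av: "a k \<in> {1..<2 ^ n}" if "k < j" for k using a[of k] that pattern_less by (auto simp: a_def)
      have q: "0 \<le> q k \<and> q k \<le> 1" if "k < j" for k
        using pattern_mass_step(3,4)[OF av[OF that]] by (simp add: q_def column_count_eq a_def)
      have nw: "q k * u (Suc (2 * a k)) + (1 - q k) * u (2 * a k) = next_weight \<alpha> \<theta> n u (a k)" for k
        by (simp add: next_weight_def q_def column_count_eq a_def)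
      have "(\<integral>\<^sup>+y. f (first_rows n (Z \<omega>), y) \<partial>?K \<omega>) =
        (\<integral>\<^sup>+y. (if \<forall>k. 0 < 2 * a k + of_bool (y k) \<longleftrightarrow> k < j'
           then ennreal (\<Prod>k<j'. u (2 * a k + of_bool (y k))) else 0)
         \<partial>PiM UNIV (\<lambda>k. measure_pmf (if k < j then bernoulli_pmf (q k) else return_pmf (k < j + H (n + 1) \<omega>))))"
        using True unfolding nf q_def by (intro nn_integral_cong) (simp add: f_def a_def initial_support_def)
      also have "\<dots> = (if j + H (n + 1) \<omega> = j' then ennreal (u 1 ^ H (n + 1) \<omega> * (\<Prod>k<j. next_weight \<alpha> \<theta> n u (a k))) else 0)"
        by (rule trans[OF nn_integral_next_row[OF a q u j]]) (simp_all only: nw)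
      also have "\<dots> = ennreal (\<Prod>k<j. next_weight \<alpha> \<theta> n u (a k)) * (ennreal (u 1 ^ (j' - j)) * indicator {j' - j} (H (n + 1) \<omega>))"
      proof (cases "j + H (n + 1) \<omega> = j'")
        case True
        have "0 \<le> (\<Prod>k<j. next_weight \<alpha> \<theta> n u (a k))"
          using av next_weight_nonneg u by (intro prod_nonneg) auto
        then show ?thesis using True u by (auto simp: ennreal_mult mult.commute)
      qed (use j in auto)
      finally show ?thesis using True by (simp add: initial_weight_def a_def)
    next
      case False
      then have "f (first_rows n (Z \<omega>), y) = 0" for y by (simp add: f_def)
      then show ?thesis using False by (simp add: initial_weight_def)
    qed
  qed
  finally show ?thesis .
qed

text \<open>The weight vanishes unless exactly \<open>j\<close> columns are in use, so the random
  parameter \<open>\<sigma> - K_n\<close> may be replaced by the constant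
  \<open>\<sigma> - j\<close> and the indicator by its Poisson mass.\<close>

lemma nn_integral_H_step:
  assumes n: "1 \<le> n"
  shows "(\<integral>\<^sup>+\<omega>. initial_weight n w j (Z \<omega>) * (c * indicator {i} (H (n + 1) \<omega>)) \<partial>M) =
    (\<integral>\<^sup>+\<omega>. initial_weight n w j (Z \<omega>) *
       (c * poisson_density (phi \<alpha> \<theta> (n + 1) * (G (n + 1) \<omega> * bfry_f (V n \<omega>) (T n) (\<sigma> - real j))) i) \<partial>M)"
    (is "?lhs = ?rhs")
proof -
  define f where "f = (\<lambda>(p :: real \<times> real \<times> binary_matrix, h). initial_weight n w j (snd (snd p)) * (c * indicator {i} (h :: nat)))"
  let ?K = "\<lambda>\<omega>. measure_pmf (poisson_pmf (G (n + 1) \<omega> * phi \<alpha> \<theta> (n + 1) *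
           bfry_f (V n \<omega>) (T n) (\<sigma> - real (num_features (Z \<omega>) n))))"
  have f: "f \<in> borel_measurable ((borel \<Otimes>\<^sub>M borel \<Otimes>\<^sub>M matrix_space) \<Otimes>\<^sub>M count_space UNIV)"
    unfolding f_def split_beta' by measurable
  have "?lhs = (\<integral>\<^sup>+\<omega>. f ((G (n + 1) \<omega>, V n \<omega>, first_rows n (Z \<omega>)), H (n + 1) \<omega>) \<partial>M)"
    by (simp add: f_def)
  also have "\<dots> = (\<integral>\<^sup>+\<omega>. (\<integral>\<^sup>+h. f ((G (n + 1) \<omega>, V n \<omega>, first_rows n (Z \<omega>)), h) \<partial>?K \<omega>) \<partial>M)"
    by (rule cond_distributed_nn_integral[OF prob_space_axioms H_next[OF n] _ _ first_rows_measurable_history(2) f])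
       (simp_all add: measure_pmf.prob_space_axioms)
  also have "\<dots> = ?rhs"
    using AE_GV[OF n]
  proof (intro nn_integral_cong_AE, eventually_elim)
    fix \<omega> assume GV: "0 < G (n + 1) \<omega> \<and> V n \<omega> \<in> {0..1}"
    let ?r = "G (n + 1) \<omega> * phi \<alpha> \<theta> (n + 1) * bfry_f (V n \<omega>) (T n) (\<sigma> - real j)"
    let ?r' = "phi \<alpha> \<theta> (n + 1) * (G (n + 1) \<omega> * bfry_f (V n \<omega>) (T n) (\<sigma> - real j))"
    show "(\<integral>\<^sup>+h. f ((G (n + 1) \<omega>, V n \<omega>, first_rows n (Z \<omega>)), h) \<partial>?K \<omega>) =
      initial_weight n w j (Z \<omega>) * (c * poisson_density ?r' i)"
    proof (cases "initial_support n j (Z \<omega>)")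
      case True
      have nf: "num_features (Z \<omega>) n = j" using True by (rule initial_support_num_features)
      have "0 < bfry_f (V n \<omega>) (T n) (\<sigma> - real j)"
      proof -
        have "0 < V n \<omega> * T n powr (\<sigma> - real j) + (1 - V n \<omega>) * (1 + T n) powr (\<sigma> - real j)"
          using GV by (intro powr_interpolation_pos sum_phi_pos n) simp
        then show ?thesis by (simp add: bfry_f_def)
      qed
      then have r: "0 < ?r" using GV phi_pos[OF \<alpha> \<theta>, of "n + 1"] by simp
      have rr: "?r = ?r'" by (simp only: mult_ac)
      have "(\<integral>\<^sup>+h. f ((G (n + 1) \<omega>, V n \<omega>, first_rows n (Z \<omega>)), h) \<partial>?K \<omega>) =
        (\<integral>\<^sup>+h. initial_weight n w j (Z \<omega>) * (c * indicator {i} h) \<partial>measure_pmf (poisson_pmf ?r))"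
        by (simp add: f_def nf)
      also have "\<dots> = initial_weight n w j (Z \<omega>) * (c * ennreal (pmf (poisson_pmf ?r) i))"
        by (simp add: nn_integral_cmult emeasure_pmf_single)
      finally show ?thesis using r unfolding rr by (simp add: poisson_density_def)
    next
      case False
      then show ?thesis by (simp add: f_def initial_weight_def)
    qed
  qed
  finally show ?thesis .
qed

text \<open>Given \<open>K_n = j\<close>, the product of gamma variable and \<open>f\<close> behaves
  like a draw of \<open>\<zeta>\<close> from its conditional law. The moment is kept on the left as
  a factor: it is the inverse of the normalising constant, and no division in \<open>ennreal\<close>
  is required.\<close>

lemma nn_integral_GV_step:
  assumes n: "1 \<le> n" and h[measurable]: "h \<in> borel_measurable borel"
  shows "BFRY_moment \<sigma> j (T n) * (\<integral>\<^sup>+\<omega>. initial_weight n w j (Z \<omega>) * h (G (n + 1) \<omega> * bfry_f (V n \<omega>) (T n) (\<sigma> - real j)) \<partial>M) =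
    (\<integral>\<^sup>+\<omega>. initial_weight n w j (Z \<omega>) \<partial>M) * (\<integral>\<^sup>+z. h z * ennreal (z ^ j * exp (- T n * z)) \<partial>BFRY \<sigma>)"
proof -
  let ?b = "\<sigma> - real j"
  define C where "C = ennreal (- ?b * Gamma (1 - \<sigma>) / ((T n powr ?b - (1 + T n) powr ?b) * Gamma (1 - ?b) * \<sigma>))"
  have T: "0 < T n" using n by (rule sum_phi_pos)
  have C1: "C * BFRY_moment \<sigma> j (T n) = 1"
    unfolding C_def by (rule BFRY_moment_eq[OF \<sigma> T])
  define f where "f = (\<lambda>(X, p). initial_weight n w j X * h (fst p * bfry_f (snd p) (T n) ?b))"
  let ?K = "\<lambda>\<omega>. Gamma_law (1 - \<sigma> + real (num_features (Z \<omega>) n)) \<Otimes>\<^sub>M uniform_measure lborel {0..1::real}"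
  have [measurable]: "(\<lambda>v. bfry_f v (T n) ?b) \<in> borel_measurable borel" unfolding bfry_f_def by measurable
  have f: "f \<in> borel_measurable (matrix_space \<Otimes>\<^sub>M (borel \<Otimes>\<^sub>M borel))"
    unfolding f_def split_beta' by measurable
  have prK: "prob_space (?K \<omega>)" for \<omega>
  proof -
    interpret A: prob_space "Gamma_law (1 - \<sigma> + real (num_features (Z \<omega>) n))"
      using \<sigma> by (intro prob_space_Gamma_law) auto
    interpret B: prob_space "uniform_measure lborel {0..1::real}" by (rule prob_space_uniform_measure) auto
    interpret P: pair_prob_space "Gamma_law (1 - \<sigma> + real (num_features (Z \<omega>) n))" "uniform_measure lborel {0..1::real}"
      by unfold_locales
    show ?thesis by (rule P.prob_space_axioms)
  qed
  have setsK: "sets (?K \<omega>) = sets (borel \<Otimes>\<^sub>M borel)" for \<omega>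
    by (rule sets_pair_measure_cong) auto
  have "(\<integral>\<^sup>+\<omega>. initial_weight n w j (Z \<omega>) * h (G (n + 1) \<omega> * bfry_f (V n \<omega>) (T n) ?b) \<partial>M) =
    (\<integral>\<^sup>+\<omega>. f (first_rows n (Z \<omega>), G (n + 1) \<omega>, V n \<omega>) \<partial>M)"
    by (simp add: f_def)
  also have "\<dots> = (\<integral>\<^sup>+\<omega>. (\<integral>\<^sup>+p. f (first_rows n (Z \<omega>), p) \<partial>?K \<omega>) \<partial>M)"
    by (rule cond_distributed_nn_integral[OF prob_space_axioms GV_next[OF n] prK setsK first_rows_measurable_history(1) f])
  also have "\<dots> = (\<integral>\<^sup>+\<omega>. initial_weight n w j (Z \<omega>) * (C * (\<integral>\<^sup>+z. h z * ennreal (z ^ j * exp (- T n * z)) \<partial>BFRY \<sigma>)) \<partial>M)"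
  proof (intro nn_integral_cong)
    fix \<omega>
    show "(\<integral>\<^sup>+p. f (first_rows n (Z \<omega>), p) \<partial>?K \<omega>) = initial_weight n w j (Z \<omega>) * (C * (\<integral>\<^sup>+z. h z * ennreal (z ^ j * exp (- T n * z)) \<partial>BFRY \<sigma>))"
    proof (cases "initial_support n j (Z \<omega>)")
      case True
      have nf: "num_features (Z \<omega>) n = j" using True by (rule initial_support_num_features)
      have "(\<integral>\<^sup>+p. f (first_rows n (Z \<omega>), p) \<partial>?K \<omega>) =
        initial_weight n w j (Z \<omega>) * (\<integral>\<^sup>+p. h (fst p * bfry_f (snd p) (T n) ?b) \<partial>?K \<omega>)"
        unfolding f_def split_conv initial_weight_first_rows by (rule nn_integral_cmult) measurable
      also have "(\<integral>\<^sup>+p. h (fst p * bfry_f (snd p) (T n) ?b) \<partial>?K \<omega>) = C * (\<integral>\<^sup>+z. h z * ennreal (z ^ j * exp (- T n * z)) \<partial>BFRY \<sigma>)"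
        unfolding nf C_def by (rule gamma_uniform_mixture[OF \<sigma> T h])
      finally show ?thesis .
    next
      case False
      then show ?thesis by (simp add: f_def initial_weight_def)
    qed
  qed
  also have "\<dots> = (\<integral>\<^sup>+\<omega>. initial_weight n w j (Z \<omega>) \<partial>M) * (C * (\<integral>\<^sup>+z. h z * ennreal (z ^ j * exp (- T n * z)) \<partial>BFRY \<sigma>))"
    by (rule nn_integral_multc) measurable
  finally have *: "(\<integral>\<^sup>+\<omega>. initial_weight n w j (Z \<omega>) * h (G (n + 1) \<omega> * bfry_f (V n \<omega>) (T n) ?b) \<partial>M) =
    (\<integral>\<^sup>+\<omega>. initial_weight n w j (Z \<omega>) \<partial>M) * (C * (\<integral>\<^sup>+z. h z * ennreal (z ^ j * exp (- T n * z)) \<partial>BFRY \<sigma>))" .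
  have "x * (y * (C * z)) = y * z" if "C * x = 1" for x y z
  proof -
    have "x * (y * (C * z)) = (C * x) * (y * z)" by (simp only: mult_ac)
    then show ?thesis by (simp only: that mult_1)
  qed
  from this[OF C1] show ?thesis unfolding * .
qed

text \<open>The weight is generalised because the hypothesis is applied to
  \<open>next_weight\<close> of it. Conditioning on the number \<open>i\<close> of old columns, the
  moment of order \<open>i\<close> from the hypothesis cancels against the normalisation of the
  gamma-uniform draw, the new columns raise the order to \<open>j\<close> and the rate by
  \<open>phi \<alpha> \<theta> (Suc n)\<close>, and the binomial theorem recombines the sum over
  \<open>i\<close>.\<close>

theorem nn_integral_initial_weight:
  assumes "1 \<le> n" and "\<And>v. 0 \<le> u v"
  shows "(\<integral>\<^sup>+\<omega>. initial_weight n u j (Z \<omega>) \<partial>M) = ennreal (W n u ^ j / fact j) * BFRY_moment \<sigma> j (T n)"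
  using assms
proof (induction n arbitrary: u j rule: dec_induct)
  case base
  then show ?case using initial_weight_1[of u j] by simp
next
  case (step n)
  note u = step.prems and n = step.hyps(1)
  let ?w = "next_weight \<alpha> \<theta> n u" and ?\<phi> = "phi \<alpha> \<theta> (Suc n)"
  have phi: "0 < ?\<phi>" by (intro phi_pos \<alpha> \<theta>) simp
  have T: "0 < T n" using n by (rule sum_phi_pos)
  \<comment> \<open>At arguments that are not non-zero patterns of \<open>n\<close> rows, such as 0,
    \<open>next_weight\<close> has a negative coefficient or one above 1 and may be negative.
    Clipping makes the induction hypothesis applicable and changes nothing on actual
    patterns.\<close>
  define w where "w v = max 0 (?w v)" for v
  have w: "0 \<le> w v" for v by (simp add: w_def)
  have w_eq: "w v = ?w v" if "v \<in> {1..<2 ^ n}" for v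
    using next_weight_nonneg[OF u that] by (simp add: w_def)
  have Ww: "W n w = W n ?w" unfolding total_weight_def using w_eq by (intro sum.cong) auto
  have iw: "initial_weight n ?w i X = initial_weight n w i X" for i X
  proof (cases "initial_support n i X")
    case True
    then have "pattern n (column X k) \<in> {1..<2 ^ n}" if "k < i" for k
      using that pattern_less by (auto simp: initial_support_def Suc_le_eq)
    then have "(\<Prod>k<i. ?w (pattern n (column X k))) = (\<Prod>k<i. w (pattern n (column X k)))"
      by (intro prod.cong refl) (simp add: w_eq)
    then show ?thesis by (simp add: initial_weight_def)
  qed (simp add: initial_weight_def)
  have AE: "AE \<omega> in M. \<exists>i. initial_support n i (Z \<omega>)"
    by (rule AE_initial_support[OF n step.IH]) simp
  have "(\<integral>\<^sup>+\<omega>. initial_weight (Suc n) u j (Z \<omega>) \<partial>M) =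
    (\<integral>\<^sup>+\<omega>. (\<Sum>i\<le>j. if initial_support n i (Z \<omega>) then initial_weight (Suc n) u j (Z \<omega>) else 0) \<partial>M)"
    using AE
  proof (intro nn_integral_cong_AE, eventually_elim)
    fix \<omega> assume "\<exists>i. initial_support n i (Z \<omega>)"
    then obtain i where i: "initial_support n i (Z \<omega>)" by blast
    then have iff: "initial_support n i' (Z \<omega>) \<longleftrightarrow> i' = i" for i' using initial_support_unique by blast
    show "initial_weight (Suc n) u j (Z \<omega>) =
       (\<Sum>i\<le>j. if initial_support n i (Z \<omega>) then initial_weight (Suc n) u j (Z \<omega>) else 0)"
    proof (cases "i \<le> j")
      case False
      then have "\<not> initial_support (Suc n) j (Z \<omega>)" using initial_support_Suc_le[OF i] by blast
      then show ?thesis by (simp add: initial_weight_def)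
    qed (simp add: iff)
  qed
  also have "\<dots> = (\<Sum>i\<le>j. \<integral>\<^sup>+\<omega>. (if initial_support n i (Z \<omega>) then initial_weight (Suc n) u j (Z \<omega>) else 0) \<partial>M)"
    by (rule nn_integral_sum) measurable
  also have "\<dots> = (\<Sum>i\<le>j. ennreal (W n ?w ^ i / fact i) * ennreal ((?\<phi> * u 1) ^ (j - i) / fact (j - i)) * BFRY_moment \<sigma> j (T (Suc n)))"
  proof (intro sum.cong refl)
    fix i assume "i \<in> {..j}"
    then have i: "i \<le> j" by simp
    \<comment> \<open>The contribution of \<open>j - i\<close> new columns, each of pattern 1, when
      the draw replacing \<open>\<zeta>\<close> has the value \<open>z\<close>.\<close>
    define h where "h z = ennreal (u 1 ^ (j - i)) * poisson_density (?\<phi> * z) (j - i)" for z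
    have h[measurable]: "h \<in> borel_measurable borel" unfolding h_def poisson_density_def by measurable
    have "(\<integral>\<^sup>+\<omega>. (if initial_support n i (Z \<omega>) then initial_weight (Suc n) u j (Z \<omega>) else 0) \<partial>M) =
      (\<integral>\<^sup>+\<omega>. initial_weight n w i (Z \<omega>) * h (G (n + 1) \<omega> * bfry_f (V n \<omega>) (T n) (\<sigma> - real i)) \<partial>M)" (is "_ = ?I")
      using nn_integral_row_step[OF n u i] nn_integral_H_step[OF n] by (simp add: h_def iw)
    moreover have "BFRY_moment \<sigma> i (T n) * ?I = (\<integral>\<^sup>+\<omega>. initial_weight n w i (Z \<omega>) \<partial>M) *
      (\<integral>\<^sup>+z. h z * ennreal (z ^ i * exp (- T n * z)) \<partial>BFRY \<sigma>)"
      by (rule nn_integral_GV_step[OF n h])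
    moreover have "(\<integral>\<^sup>+\<omega>. initial_weight n w i (Z \<omega>) \<partial>M) = ennreal (W n w ^ i / fact i) * BFRY_moment \<sigma> i (T n)"
      by (rule step.IH[OF w])
    moreover have "(\<integral>\<^sup>+z. h z * ennreal (z ^ i * exp (- T n * z)) \<partial>BFRY \<sigma>) =
      ennreal ((?\<phi> * u 1) ^ (j - i) / fact (j - i)) * BFRY_moment \<sigma> j (T (Suc n))"
    proof -
      have "(\<integral>\<^sup>+z. h z * ennreal (z ^ i * exp (- T n * z)) \<partial>BFRY \<sigma>) =
         (\<integral>\<^sup>+z. ennreal ((?\<phi> * u 1) ^ (j - i) / fact (j - i)) * ennreal (z ^ j * exp (- T (Suc n) * z)) \<partial>BFRY \<sigma>)"
        using AE_BFRY_pos
      proof (intro nn_integral_cong_AE, eventually_elim)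
        fix z :: real assume z: "0 < z"
        have "h z * ennreal (z ^ i * exp (- T n * z)) =
          ennreal (u 1 ^ (j - i) * ((?\<phi> * z) ^ (j - i) / fact (j - i) * exp (- (?\<phi> * z))) * (z ^ i * exp (- T n * z)))"
          unfolding h_def poisson_density_def using u z phi by (intro ennreal_mult3'[symmetric]) auto
        also have "u 1 ^ (j - i) * ((?\<phi> * z) ^ (j - i) / fact (j - i) * exp (- (?\<phi> * z))) * (z ^ i * exp (- T n * z)) =
          (?\<phi> * u 1) ^ (j - i) / fact (j - i) * ((z ^ (j - i) * z ^ i) * (exp (- (?\<phi> * z)) * exp (- T n * z)))"
          by (simp add: power_mult_distrib mult_ac)
        also have "z ^ (j - i) * z ^ i = z ^ j" using i by (simp flip: power_add)
        also have "exp (- (?\<phi> * z)) * exp (- T n * z) = exp (- T (Suc n) * z)"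
          by (simp add: algebra_simps flip: exp_add)
        also have "ennreal ((?\<phi> * u 1) ^ (j - i) / fact (j - i) * (z ^ j * exp (- T (Suc n) * z))) =
          ennreal ((?\<phi> * u 1) ^ (j - i) / fact (j - i)) * ennreal (z ^ j * exp (- T (Suc n) * z))"
          using u z phi by (intro ennreal_mult) auto
        finally show "h z * ennreal (z ^ i * exp (- T n * z)) =
          ennreal ((?\<phi> * u 1) ^ (j - i) / fact (j - i)) * ennreal (z ^ j * exp (- T (Suc n) * z))" .
      qed
      also have "\<dots> = ennreal ((?\<phi> * u 1) ^ (j - i) / fact (j - i)) * BFRY_moment \<sigma> j (T (Suc n))"
        unfolding BFRY_moment_def by (rule nn_integral_cmult) measurable
      finally show ?thesis .
    qed
    ultimately have *: "BFRY_moment \<sigma> i (T n) * ?I =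
      BFRY_moment \<sigma> i (T n) * (ennreal (W n ?w ^ i / fact i) * ennreal ((?\<phi> * u 1) ^ (j - i) / fact (j - i)) * BFRY_moment \<sigma> j (T (Suc n)))"
      by (simp add: Ww mult_ac)
    \<comment> \<open>Cancellation in \<open>ennreal\<close> needs a factor that is neither 0 nor
      infinite; a factor of a product equal to 1 is neither.\<close>
    have "BFRY_moment \<sigma> i (T n) \<noteq> 0" "BFRY_moment \<sigma> i (T n) \<noteq> \<top>"
      using BFRY_moment_eq[OF \<sigma> T, of i] by (metis mult_zero_right zero_neq_one, metis ennreal_mult_top ennreal_one_neq_top mult_zero_left zero_neq_one)
    then have "?I = ennreal (W n ?w ^ i / fact i) * ennreal ((?\<phi> * u 1) ^ (j - i) / fact (j - i)) * BFRY_moment \<sigma> j (T (Suc n))"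
      using * by (simp add: ennreal_mult_cancel_left)
    then show "(\<integral>\<^sup>+\<omega>. (if initial_support n i (Z \<omega>) then initial_weight (Suc n) u j (Z \<omega>) else 0) \<partial>M) =
       ennreal (W n ?w ^ i / fact i) * ennreal ((?\<phi> * u 1) ^ (j - i) / fact (j - i)) * BFRY_moment \<sigma> j (T (Suc n))"
      using nn_integral_row_step[OF n u i] nn_integral_H_step[OF n] by (simp add: h_def iw)
  qed
  also have "\<dots> = ennreal ((W n ?w + ?\<phi> * u 1) ^ j / fact j) * BFRY_moment \<sigma> j (T (Suc n))"
    unfolding sum_distrib_right[symmetric]
  proof (subst ennreal_binomial)
    show "0 \<le> W n ?w" unfolding Ww[symmetric] by (rule total_weight_nonneg[OF w])
  qed (use u phi in auto)
  also have "W n ?w + ?\<phi> * u 1 = W (Suc n) u" by (rule total_weight_Suc[symmetric])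
  finally show ?case .
qed

lemma AE_ex_initial_support:
  assumes "1 \<le> n" shows "AE \<omega> in M. \<exists>j. initial_support n j (Z \<omega>)"
  by (rule AE_initial_support[OF assms nn_integral_initial_weight[OF assms]]) simp

end

subsection \<open>The number of features\<close>

lemma num_features_measurable[measurable]:
  "(\<lambda>Z. num_features Z n) \<in> measurable matrix_space (count_space UNIV)"
  unfolding num_features_def column_count_pos_iff by measurable

text \<open>Rather than a Stirling expansion, Euler's limit for \<open>Gamma z\<close> is enough:
  its denominator is the rising factorial, which equals the quotient of \<open>Gamma (z + n)\<close>
  and \<open>Gamma z\<close>.\<close>

lemma Gamma_shift_asymp:
  fixes z :: real
  assumes "0 < z"
  shows "(\<lambda>n. Gamma (real n + z) / (fact (n - 1) * real n powr z)) \<longlonglongrightarrow> 1"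
proof -
  have z: "z \<notin> \<int>\<^sub>\<le>\<^sub>0" using assms by (auto elim: nonpos_Ints_cases)
  have G: "Gamma z > 0" using assms by (rule Gamma_real_pos)
  have "(\<lambda>n. Gamma z / Gamma_series' z n) \<longlonglongrightarrow> Gamma z / Gamma z"
    using G by (intro tendsto_divide tendsto_const Gamma_series'_LIMSEQ) (metis less_irrefl)
  also have "Gamma z / Gamma z = 1" using G by (metis divide_self less_irrefl)
  finally show ?thesis
  proof (rule Lim_transform_eventually)
    show "\<forall>\<^sub>F n in sequentially. Gamma z / Gamma_series' z n = Gamma (real n + z) / (fact (n - 1) * real n powr z)"
      using eventually_gt_at_top[of 0]
    proof eventually_elim
      case (elim n)
      have "Gamma z \<noteq> 0" using G by (metis less_irrefl)
      then show ?case using elim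
        by (simp add: Gamma_series'_def pochhammer_Gamma[OF z] powr_def field_simps)
    qed
  qed
qed

context urn_params
begin

text \<open>The closed form of the moment gives
  \<open>C Gamma(j + 1 - \<sigma>) / (j! (j - \<sigma>))\<close> up to a factor
  \<open>1 - x^(j - \<sigma>)\<close> with \<open>x < 1\<close>. The gamma ratio is of order
  \<open>j^(- \<sigma>)\<close>, so the exponent is \<open>1 + \<sigma>\<close>.\<close>

lemma power_law_BFRY_moment:
  assumes T: "0 < T"
  shows "exhibits_power_law (\<lambda>j. T ^ j / fact j * enn2real (BFRY_moment \<sigma> j T))"
proof -
  \<comment> \<open>The constant predicted by the tail of the BFRY density: evaluate
    \<open>\<sigma> / Gamma (1 - \<sigma>) * z powr (- \<sigma> - 1)\<close> at
    \<open>z = j / T\<close> and multiply by the spacing \<open>1 / T\<close>.\<close>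
  define C where "C = \<sigma> * T powr \<sigma> / Gamma (1 - \<sigma>)"
  have G: "0 < Gamma (1 - \<sigma>)" using \<sigma> by (intro Gamma_real_pos) auto
  have C: "0 < C" using G \<sigma> T by (simp add: C_def)
  \<comment> \<open>Compares the two powers in the closed form: \<open>(1 + T) powr b\<close>
    divided by \<open>T powr b\<close> is \<open>x powr (j - \<sigma>)\<close>, which decays
    geometrically.\<close>
  define x where "x = T / (1 + T)"
  have x: "0 < x" "x < 1" using T by (auto simp: x_def)
  let ?p = "\<lambda>j. T ^ j / fact j * enn2real (BFRY_moment \<sigma> j T)"
  let ?R = "\<lambda>j. Gamma (real j + (1 - \<sigma>)) / (fact (j - 1) * real j powr (1 - \<sigma>))"
  have p: "?p j / (C * real j powr - (1 + \<sigma>)) = ?R j * (real j / (real j - \<sigma>)) * (1 - x ^ j * x powr (- \<sigma>))"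
    if j: "1 \<le> j" for j
  proof -
    define b where "b = \<sigma> - real j"
    define D where "D = T powr b - (1 + T) powr b"
    have b: "b < 0" using j \<sigma> by (simp add: b_def)
    have "(1 + T) powr b < T powr b" using T b by (intro powr_less_mono2_neg) auto
    then have D: "0 < D" by (simp add: D_def)
    have Gb: "0 < Gamma (1 - b)" using b by (intro Gamma_real_pos) auto
    define c where "c = - b * Gamma (1 - \<sigma>) / (D * Gamma (1 - b) * \<sigma>)"
    have c: "0 < c" using b G Gb D \<sigma> unfolding c_def
      by (intro divide_pos_pos mult_pos_pos) auto
    have "ennreal c * BFRY_moment \<sigma> j T = 1"
      unfolding c_def D_def b_def by (rule BFRY_moment_eq[OF \<sigma> T])
    then have "c * enn2real (BFRY_moment \<sigma> j T) = 1"
      using c by (metis enn2real_mult enn2real_ennreal enn2real_1 less_imp_le)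
    then have m: "enn2real (BFRY_moment \<sigma> j T) = 1 / c" using c by (simp add: field_simps)
    have TD: "T ^ j * D = T powr \<sigma> * (1 - x ^ j * x powr (- \<sigma>))"
    proof -
      have "T ^ j * T powr b = T powr \<sigma>"
        using T by (simp add: b_def powr_diff powr_realpow)
      moreover have "T ^ j * (1 + T) powr b = T powr \<sigma> * (x ^ j * x powr (- \<sigma>))"
        using T by (simp add: b_def x_def powr_diff powr_realpow powr_divide powr_minus power_divide field_simps)
      ultimately show ?thesis by (simp add: D_def algebra_simps)
    qed
    have fj: "fact j = real j * fact (j - 1)" using j by (simp add: fact_reduce)
    have jp: "real j * real j = real j powr (1 - \<sigma>) * real j powr (1 + \<sigma>)"
      using j by (simp flip: powr_add add: powr_numeral power2_eq_square)
    have "?p j = (T ^ j * D) * \<sigma> * Gamma (1 - b) / (fact j * (- b) * Gamma (1 - \<sigma>))"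
      unfolding m c_def by (simp add: field_simps)
    also have "\<dots> = C * Gamma (1 - b) / (fact j * (- b)) * (1 - x ^ j * x powr (- \<sigma>))"
      unfolding TD C_def by (simp add: field_simps)
    finally have p_eq: "?p j = C * Gamma (1 - b) / (fact j * (- b)) * (1 - x ^ j * x powr (- \<sigma>))" .
    have "?p j / (C * real j powr - (1 + \<sigma>)) =
        Gamma (1 - b) * real j powr (1 + \<sigma>) / (fact j * (- b)) * (1 - x ^ j * x powr (- \<sigma>))"
      unfolding p_eq powr_minus_divide[of "real j"] using C by simp
    also have "Gamma (1 - b) * real j powr (1 + \<sigma>) / (fact j * (- b)) = ?R j * (real j / (real j - \<sigma>))"
    proof -
      have 1: "1 - b = real j + (1 - \<sigma>)" "- b = real j - \<sigma>" by (simp_all add: b_def)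
      have js: "real j - \<sigma> \<noteq> 0" "real j \<noteq> 0" "real j powr (1 - \<sigma>) \<noteq> 0" using b j by (auto simp: b_def)
      have "Gamma (1 - b) * real j powr (1 + \<sigma>) / (fact j * (- b)) =
        Gamma (real j + (1 - \<sigma>)) * (real j powr (1 - \<sigma>) * real j powr (1 + \<sigma>)) / (real j * fact (j - 1) * (real j - \<sigma>) * real j powr (1 - \<sigma>))"
        unfolding 1 fj using js by simp
      also have "\<dots> = ?R j * (real j / (real j - \<sigma>))"
        unfolding jp[symmetric] using js by simp
      finally show ?thesis .
    qed
    finally show ?thesis .
  qed
  have "(\<lambda>j. ?R j * (real j / (real j - \<sigma>)) * (1 - x ^ j * x powr (- \<sigma>))) \<longlonglongrightarrow> 1 * 1 * (1 - 0 * x powr (- \<sigma>))"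
  proof (intro tendsto_mult tendsto_diff tendsto_const)
    show "?R \<longlonglongrightarrow> 1" using \<sigma> by (intro Gamma_shift_asymp) auto
    show "(\<lambda>j. real j / (real j - \<sigma>)) \<longlonglongrightarrow> 1" by real_asymp
    show "(\<lambda>j. x ^ j) \<longlonglongrightarrow> 0" using x by (intro LIMSEQ_realpow_zero) auto
  qed
  then have "(\<lambda>j. ?R j * (real j / (real j - \<sigma>)) * (1 - x ^ j * x powr (- \<sigma>))) \<longlonglongrightarrow> 1" by simp
  then have "(\<lambda>j. ?p j / (C * real j powr - (1 + \<sigma>))) \<longlonglongrightarrow> 1"
    by (rule Lim_transform_eventually) (use eventually_ge_at_top[of 1] in \<open>eventually_elim, simp only: p\<close>)
  then have "?p \<sim>[at_top] (\<lambda>j. C * real j powr - (1 + \<sigma>))"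
    by (rule asymp_equivI')
  then show ?thesis
    unfolding exhibits_power_law_def using C \<sigma> by (intro exI[of _ C] exI[of _ "1 + \<sigma>"] conjI) auto
qed

end

context BFRY_urn_params
begin

lemma emeasure_num_features:
  assumes n: "1 \<le> n"
  shows "emeasure M {\<omega>\<in>space M. num_features (Z \<omega>) n = j} = ennreal (T n ^ j / fact j) * BFRY_moment \<sigma> j (T n)"
proof -
  have "emeasure M {\<omega>\<in>space M. num_features (Z \<omega>) n = j} =
      (\<integral>\<^sup>+\<omega>. indicator {\<omega>\<in>space M. num_features (Z \<omega>) n = j} \<omega> \<partial>M)"
    by (rule nn_integral_indicator[symmetric]) measurable
  also have "\<dots> = (\<integral>\<^sup>+\<omega>. initial_weight n (\<lambda>_. 1) j (Z \<omega>) \<partial>M)"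
    using AE_ex_initial_support[OF n] AE_space
  proof (intro nn_integral_cong_AE, eventually_elim)
    fix \<omega> assume \<omega>: "\<omega> \<in> space M" and "\<exists>i. initial_support n i (Z \<omega>)"
    then obtain i where "initial_support n i (Z \<omega>)" by blast
    then have "num_features (Z \<omega>) n = j \<longleftrightarrow> initial_support n j (Z \<omega>)"
      using initial_support_num_features by blast
    then show "indicator {\<omega>\<in>space M. num_features (Z \<omega>) n = j} \<omega> = initial_weight n (\<lambda>_. 1) j (Z \<omega>)"
      using \<omega> by (simp add: initial_weight_def)
  qed
  also have "\<dots> = ennreal (T n ^ j / fact j) * BFRY_moment \<sigma> j (T n)"
    by (subst nn_integral_initial_weight[OF n]) (simp_all only: total_weight_1 zero_le_one)
  finally show ?thesis .
qed

theorem num_features_law: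
  assumes n: "1 \<le> n"
  shows "distr M (count_space UNIV) (\<lambda>\<omega>. num_features (Z \<omega>) n) = Poisson_BFRY \<sigma> (T n)"
proof (rule measure_eqI_countable[of _ UNIV])
  fix j :: nat
  have T: "0 < T n" using n by (rule sum_phi_pos)
  have "emeasure (distr M (count_space UNIV) (\<lambda>\<omega>. num_features (Z \<omega>) n)) {j} =
     emeasure M {\<omega>\<in>space M. num_features (Z \<omega>) n = j}"
    by (subst emeasure_distr) (auto intro!: arg_cong[where f="emeasure M"])
  also have "\<dots> = ennreal (T n ^ j / fact j) * BFRY_moment \<sigma> j (T n)"
    by (rule emeasure_num_features[OF n])
  also have "\<dots> = (\<integral>\<^sup>+z. ennreal (T n ^ j / fact j) * ennreal (z ^ j * exp (- T n * z)) \<partial>BFRY \<sigma>)"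
    unfolding BFRY_moment_def by (rule nn_integral_cmult[symmetric]) measurable
  also have "\<dots> = (\<integral>\<^sup>+z. ennreal (pmf (poisson_pmf (T n * z)) j) \<partial>BFRY \<sigma>)"
    using AE_BFRY_pos
  proof (intro nn_integral_cong_AE, eventually_elim)
    fix z :: real assume z: "0 < z"
    have "0 < T n * z" using T z by simp
    then have "pmf (poisson_pmf (T n * z)) j = T n ^ j / fact j * (z ^ j * exp (- T n * z))"
      by (simp add: power_mult_distrib)
    then show "ennreal (T n ^ j / fact j) * ennreal (z ^ j * exp (- T n * z)) = ennreal (pmf (poisson_pmf (T n * z)) j)"
      using T z by (simp only:) (intro ennreal_mult[symmetric], auto)
  qed
  also have "\<dots> = emeasure (Poisson_BFRY \<sigma> (T n)) {j}"
    unfolding Poisson_BFRY_def by (subst emeasure_density) (auto simp: nn_integral_count_space_indicator[symmetric])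
  finally show "emeasure (distr M (count_space UNIV) (\<lambda>\<omega>. num_features (Z \<omega>) n)) {j} = emeasure (Poisson_BFRY \<sigma> (T n)) {j}" .
qed (auto simp: Poisson_BFRY_def)

theorem num_features_power_law:
  assumes n: "1 \<le> n"
  shows "exhibits_power_law (\<lambda>j. \<P>(\<omega> in M. num_features (Z \<omega>) n = j))"
proof -
  have T: "0 < T n" using n by (rule sum_phi_pos)
  have "\<P>(\<omega> in M. num_features (Z \<omega>) n = j) = T n ^ j / fact j * enn2real (BFRY_moment \<sigma> j (T n))" for j
    unfolding measure_def emeasure_num_features[OF n] using T by (simp add: enn2real_mult)
  then show ?thesis using power_law_BFRY_moment[OF T] by simp
qed

end

subsection \<open>Infinite products of weights\<close>

text \<open>An infinite product of factors in \<open>[0,1]\<close> is represented as the infimum of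
  its partial products, which exists no matter how many factors differ from 1.\<close>

lemma decseq_prod_weights:
  fixes a :: "nat \<Rightarrow> real"
  assumes "\<And>k. 0 \<le> a k" "\<And>k. a k \<le> 1"
  shows "decseq (\<lambda>m. ennreal (\<Prod>k<m. a k))"
  using assms
  by (intro decseq_SucI ennreal_leI) (auto intro!: mult_left_le prod_nonneg)

lemma INF_prod_finite:
  fixes a :: "nat \<Rightarrow> real"
  assumes a: "\<And>k. 0 \<le> a k" "\<And>k. a k \<le> 1" and fin: "finite S" "\<And>k. k \<notin> S \<Longrightarrow> a k = 1"
  shows "(INF m. ennreal (\<Prod>k<m. a k)) = ennreal (\<Prod>k\<in>S. a k)"
proof (rule LIMSEQ_unique)
  show "(\<lambda>m. ennreal (\<Prod>k<m. a k)) \<longlonglongrightarrow> (INF m. ennreal (\<Prod>k<m. a k))"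
    by (rule LIMSEQ_INF[OF decseq_prod_weights[OF a]])
  have "\<forall>\<^sub>F m in sequentially. ennreal (\<Prod>k\<in>S. a k) = ennreal (\<Prod>k<m. a k)"
    using eventually_gt_at_top[of "Max (insert 0 S)"]
  proof eventually_elim
    case (elim m)
    then have "S \<subseteq> {..<m}" using fin(1) by auto
    then show ?case using fin(2) by (intro arg_cong[where f=ennreal] prod.mono_neutral_left) auto
  qed
  then show "(\<lambda>m. ennreal (\<Prod>k<m. a k)) \<longlonglongrightarrow> ennreal (\<Prod>k\<in>S. a k)"
    by (rule Lim_transform_eventually[OF tendsto_const])
qed

text \<open>Any \<open>d\<close> of the small factors already force a partial product below
  \<open>\<rho> ^ d\<close>. This is the case of infinitely many selected columns.\<close>

lemma INF_prod_zero:
  fixes a :: "nat \<Rightarrow> real"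
  assumes a: "\<And>k. 0 \<le> a k" "\<And>k. a k \<le> 1" and inf: "infinite {k. a k \<le> \<rho>}" and \<rho>: "\<rho> < 1"
  shows "(INF m. ennreal (\<Prod>k<m. a k)) = 0"
proof -
  obtain k0 where "a k0 \<le> \<rho>" using infinite_imp_nonempty[OF inf] by auto
  then have \<rho>0: "0 \<le> \<rho>" using a(1)[of k0] by linarith
  have le: "(INF m. ennreal (\<Prod>k<m. a k)) \<le> ennreal (\<rho> ^ d)" for d
  proof -
    obtain S where S: "finite S" "card S = d" "S \<subseteq> {k. a k \<le> \<rho>}"
      using infinite_arbitrarily_large[OF inf] by blast
    define m where "m = Suc (Max (insert 0 S))"
    have Sm: "S \<subseteq> {..<m}" using S(1) by (auto simp: m_def less_Suc_eq_le)
    have "(\<Prod>k<m. a k) = (\<Prod>k\<in>S. a k) * (\<Prod>k\<in>{..<m} - S. a k)"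
      using prod.subset_diff[OF Sm] by (simp add: mult.commute)
    also have "\<dots> \<le> (\<Prod>k\<in>S. \<rho>) * 1"
      using S a \<rho>0 by (intro mult_mono prod_mono prod_le_1 prod_nonneg) auto
    finally have "(\<Prod>k<m. a k) \<le> \<rho> ^ d" using S by simp
    then show ?thesis by (intro INF_lower2[of m] ennreal_leI) auto
  qed
  have "(\<lambda>d. ennreal (\<rho> ^ d)) \<longlonglongrightarrow> ennreal 0"
    using \<rho> \<rho>0 by (intro tendsto_ennrealI LIMSEQ_realpow_zero)
  from LIMSEQ_le_const[OF this] le have "(INF m. ennreal (\<Prod>k<m. a k)) \<le> ennreal 0" by blast
  then show ?thesis by simp
qed

subsection \<open>Mixed Bernoulli columns\<close>

text \<open>The expected weight of a column with \<open>n\<close> independent entries of success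
  probability \<open>s\<close>; the recursion averages out the last entry.\<close>

primrec bernoulli_weight :: "nat \<Rightarrow> (nat \<Rightarrow> real) \<Rightarrow> real \<Rightarrow> real" where
  "bernoulli_weight 0 u s = u 0"
| "bernoulli_weight (Suc n) u s = bernoulli_weight n (\<lambda>v. s * u (Suc (2 * v)) + (1 - s) * u (2 * v)) s"

lemma sum_lessThan_even_odd:
  fixes f :: "nat \<Rightarrow> 'a::comm_monoid_add"
  shows "(\<Sum>v<2 * m. f v) = (\<Sum>v<m. f (2 * v) + f (Suc (2 * v)))"
  by (induction m) (simp_all add: ac_simps)

lemma bernoulli_weight_eq:
  "bernoulli_weight n u s = (\<Sum>v<2 ^ n. u v * (s ^ popcount v * (1 - s) ^ (n - popcount v)))"
proof (induction n arbitrary: u)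
  case (Suc n)
  have "(\<Sum>v<2 ^ Suc n. u v * (s ^ popcount v * (1 - s) ^ (Suc n - popcount v))) =
    (\<Sum>v<2 ^ n. u (2 * v) * (s ^ popcount v * (1 - s) ^ (Suc n - popcount v)) +
      u (Suc (2 * v)) * (s ^ Suc (popcount v) * (1 - s) ^ (n - popcount v)))"
    unfolding power_Suc[of "2::nat"] sum_lessThan_even_odd by simp
  also have "\<dots> = (\<Sum>v<2 ^ n. (s * u (Suc (2 * v)) + (1 - s) * u (2 * v)) * (s ^ popcount v * (1 - s) ^ (n - popcount v)))"
  proof (intro sum.cong refl)
    fix v :: nat assume "v \<in> {..<2 ^ n}"
    then have "Suc n - popcount v = Suc (n - popcount v)" using popcount_le[of v n] by auto
    then show "u (2 * v) * (s ^ popcount v * (1 - s) ^ (Suc n - popcount v)) +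
      u (Suc (2 * v)) * (s ^ Suc (popcount v) * (1 - s) ^ (n - popcount v)) =
      (s * u (Suc (2 * v)) + (1 - s) * u (2 * v)) * (s ^ popcount v * (1 - s) ^ (n - popcount v))"
      by (simp add: algebra_simps)
  qed
  finally show ?case using Suc.IH[of "\<lambda>v. s * u (Suc (2 * v)) + (1 - s) * u (2 * v)"] by simp
qed simp

lemma bernoulli_weight_1: "bernoulli_weight n (\<lambda>_. 1) s = 1"
  by (induction n) simp_all

lemma bernoulli_weight_bounds:
  assumes "0 \<le> s" "s \<le> 1"
  shows "(\<And>v. 0 \<le> u v) \<Longrightarrow> 0 \<le> bernoulli_weight n u s"
    and "(\<And>v. u v \<le> 1) \<Longrightarrow> bernoulli_weight n u s \<le> 1"
proof -
  show "(\<And>v. 0 \<le> u v) \<Longrightarrow> 0 \<le> bernoulli_weight n u s"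
    unfolding bernoulli_weight_eq using assms by (intro sum_nonneg mult_nonneg_nonneg) auto
  assume "\<And>v. u v \<le> 1"
  then have "bernoulli_weight n u s \<le> bernoulli_weight n (\<lambda>_. 1) s"
    unfolding bernoulli_weight_eq using assms by (intro sum_mono mult_right_mono) auto
  then show "bernoulli_weight n u s \<le> 1" by (simp add: bernoulli_weight_1)
qed

text \<open>Because \<open>u 0 = 1\<close> the zero pattern drops out, and with it the one term that
  is not integrable against the Levy density.\<close>

lemma bernoulli_weight_compl:
  assumes "u 0 = 1"
  shows "1 - bernoulli_weight n u s = (\<Sum>v\<in>{1..<2 ^ n}. (1 - u v) * (s ^ popcount v * (1 - s) ^ (n - popcount v)))"
proof -
  have "1 - bernoulli_weight n u s = bernoulli_weight n (\<lambda>_. 1) s - bernoulli_weight n u s"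
    by (simp add: bernoulli_weight_1)
  also have "\<dots> = (\<Sum>v<2 ^ n. (1 - u v) * (s ^ popcount v * (1 - s) ^ (n - popcount v)))"
    unfolding bernoulli_weight_eq by (simp add: sum_subtractf[symmetric] algebra_simps)
  also have "\<dots> = (\<Sum>v\<in>{1..<2 ^ n}. (1 - u v) * (s ^ popcount v * (1 - s) ^ (n - popcount v)))"
    using assms by (intro sum.mono_neutral_right) (auto simp: not_le)
  finally show ?thesis .
qed

text \<open>Lets the column formula hold at every sample point: a jump outside \<open>[0,1]\<close>,
  possible on a null set, acts like its clamped value.\<close>

lemma bernoulli_pmf_clamp: "bernoulli_pmf p = bernoulli_pmf (min 1 (max 0 p))"
  by (rule pmf_eqI) (simp add: bernoulli_pmf.rep_eq)

lemma pattern_measurable_rows: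
  assumes "l \<le> n"
  shows "(\<lambda>x. pattern l (\<lambda>i. x i k)) \<in>
    measurable (PiM {..<n} (\<lambda>_. PiM UNIV (\<lambda>k. measure_pmf (f k)))) (count_space UNIV)"
  using assms
proof (induction l)
  case (Suc l)
  let ?R = "PiM UNIV (\<lambda>k. measure_pmf (f k))"
  have "(\<lambda>x. x l) \<in> measurable (PiM {..<n} (\<lambda>_. ?R)) ?R"
    using Suc.prems by (intro measurable_component_singleton) auto
  moreover have "(\<lambda>y. y k) \<in> measurable ?R (count_space UNIV)"
    by (rule measurable_compose[OF measurable_component_singleton, of k]) auto
  ultimately have [measurable]: "(\<lambda>x. x l k) \<in> measurable (PiM {..<n} (\<lambda>_. ?R)) (count_space UNIV)"
    by (rule measurable_compose)
  note [measurable] = Suc.IH[OF Suc_leD[OF Suc.prems]]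
  show ?case by simp
qed simp

text \<open>The weights are allowed to depend on the column because removing the last row mixes them
  with the column's own success probability \<open>p k\<close>.\<close>

lemma nn_integral_bernoulli_rows:
  fixes p :: "nat \<Rightarrow> real"
  assumes p: "\<And>k. 0 \<le> p k" "\<And>k. p k \<le> 1" and u: "\<And>k v. 0 \<le> u k v"
  shows "(\<integral>\<^sup>+x. ennreal (\<Prod>k<m. u k (pattern n (\<lambda>i. x i k)))
      \<partial>PiM {..<n} (\<lambda>_. PiM UNIV (\<lambda>k. measure_pmf (bernoulli_pmf (p k))))) =
    ennreal (\<Prod>k<m. bernoulli_weight n (u k) (p k))"
  using u
proof (induction n arbitrary: u)
  case 0
  show ?case by (simp add: space_PiM PiM_empty)
next
  case (Suc n)
  let ?R = "PiM UNIV (\<lambda>k. measure_pmf (bernoulli_pmf (p k)))"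
  have R: "prob_space ?R" by (intro prob_space_PiM measure_pmf.prob_space_axioms)
  interpret product_prob_space "\<lambda>_::nat. ?R" UNIV
    using R by (simp add: product_prob_space_def product_prob_space_axioms_def product_sigma_finite_def prob_space_imp_sigma_finite)
  have [measurable]: "(\<lambda>x. u k (pattern (Suc n) (\<lambda>i. x i k))) \<in> borel_measurable (PiM {..<Suc n} (\<lambda>_. ?R))" for k
    by (rule measurable_compose[OF pattern_measurable_rows]) simp_all
  have meas: "(\<lambda>x. ennreal (\<Prod>k<m. u k (pattern (Suc n) (\<lambda>i. x i k)))) \<in> borel_measurable (PiM (insert n {..<n}) (\<lambda>_. ?R))"
    unfolding lessThan_Suc[symmetric] by measurable
  define u' where "u' k v = p k * u k (Suc (2 * v)) + (1 - p k) * u k (2 * v)" for k v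
  have u': "0 \<le> u' k v" for k v using p Suc.prems by (simp add: u'_def)
  have "(\<integral>\<^sup>+x. ennreal (\<Prod>k<m. u k (pattern (Suc n) (\<lambda>i. x i k))) \<partial>PiM {..<Suc n} (\<lambda>_. ?R)) =
    (\<integral>\<^sup>+x. (\<integral>\<^sup>+y. ennreal (\<Prod>k<m. u k (pattern (Suc n) (\<lambda>i. (x(n := y)) i k))) \<partial>?R) \<partial>PiM {..<n} (\<lambda>_. ?R))"
    unfolding lessThan_Suc by (rule product_nn_integral_insert[OF _ _ meas]) auto
  also have "\<dots> = (\<integral>\<^sup>+x. ennreal (\<Prod>k<m. u' k (pattern n (\<lambda>i. x i k))) \<partial>PiM {..<n} (\<lambda>_. ?R))"
  proof (intro nn_integral_cong)
    fix x :: "nat \<Rightarrow> nat \<Rightarrow> bool"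
    let ?a = "\<lambda>k. pattern n (\<lambda>i. x i k)"
    have pc: "pattern n (\<lambda>i. (x(n := y)) i k) = ?a k" for y :: "nat \<Rightarrow> bool" and k by (intro pattern_cong) auto
    have "(\<integral>\<^sup>+y. ennreal (\<Prod>k<m. u k (pattern (Suc n) (\<lambda>i. (x(n := y)) i k))) \<partial>?R) =
      (\<integral>\<^sup>+y. (\<Prod>k<m. ennreal (u k (2 * ?a k + of_bool (y k)))) \<partial>?R)"
      using Suc.prems by (simp add: pc prod_ennreal del: fun_upd_apply) (simp add: prod_ennreal)
    also have "\<dots> = (\<Prod>k<m. \<integral>\<^sup>+b. ennreal (u k (2 * ?a k + of_bool b)) \<partial>measure_pmf (bernoulli_pmf (p k)))"
      by (rule nn_integral_PiM_prod) (auto simp: measure_pmf.prob_space_axioms)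
    also have "\<dots> = (\<Prod>k<m. ennreal (u' k (?a k)))"
      using p Suc.prems by (intro prod.cong refl) (auto simp: u'_def mult.commute simp flip: ennreal_mult ennreal_plus)
    also have "\<dots> = ennreal (\<Prod>k<m. u' k (?a k))" using u' by (intro prod_ennreal) auto
    finally show "(\<integral>\<^sup>+y. ennreal (\<Prod>k<m. u k (pattern (Suc n) (\<lambda>i. (x(n := y)) i k))) \<partial>?R) = ennreal (\<Prod>k<m. u' k (?a k))" .
  qed
  also have "\<dots> = ennreal (\<Prod>k<m. bernoulli_weight n (u' k) (p k))"
    by (rule Suc.IH[OF u'])
  finally show ?case by (simp add: u'_def[abs_def])
qed

lemma nn_integral_bernoulli_matrix:
  fixes p :: "nat \<Rightarrow> real"
  assumes u: "\<And>v. 0 \<le> u v"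
  shows "(\<integral>\<^sup>+X. ennreal (\<Prod>k<m. u (pattern n (column X k)))
      \<partial>PiM UNIV (\<lambda>i. PiM UNIV (\<lambda>k. measure_pmf (bernoulli_pmf (p k))))) =
    ennreal (\<Prod>k<m. bernoulli_weight n u (min 1 (max 0 (p k))))"
proof -
  define q where "q k = min 1 (max 0 (p k))" for k
  have q: "0 \<le> q k" "q k \<le> 1" for k by (auto simp: q_def)
  let ?R = "PiM UNIV (\<lambda>k. measure_pmf (bernoulli_pmf (q k)))"
  have pq: "bernoulli_pmf (p k) = bernoulli_pmf (q k)" for k
    unfolding q_def by (rule bernoulli_pmf_clamp)
  have R: "prob_space ?R" by (intro prob_space_PiM measure_pmf.prob_space_axioms)
  interpret product_prob_space "\<lambda>_::nat. ?R" UNIV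
    using R by (simp add: product_prob_space_def product_prob_space_axioms_def product_sigma_finite_def prob_space_imp_sigma_finite)
  have [measurable]: "(\<lambda>x. u (pattern n (\<lambda>i. x i k))) \<in> borel_measurable (PiM {..<n} (\<lambda>_. ?R))" for k
    by (rule measurable_compose[OF pattern_measurable_rows]) simp_all
  have "(\<integral>\<^sup>+X. ennreal (\<Prod>k<m. u (pattern n (column X k))) \<partial>PiM UNIV (\<lambda>_. ?R)) =
    (\<integral>\<^sup>+X. ennreal (\<Prod>k<m. u (pattern n (\<lambda>i. restrict X {..<n} i k))) \<partial>PiM UNIV (\<lambda>_. ?R))"
    by (intro nn_integral_cong arg_cong[where f=ennreal] prod.cong refl arg_cong[where f=u] pattern_cong) auto
  also have "\<dots> = (\<integral>\<^sup>+x. ennreal (\<Prod>k<m. u (pattern n (\<lambda>i. x i k)))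
     \<partial>distr (PiM UNIV (\<lambda>_. ?R)) (PiM {..<n} (\<lambda>_. ?R)) (\<lambda>X. restrict X {..<n}))"
  proof (rule nn_integral_distr[symmetric])
    show "(\<lambda>X. restrict X {..<n}) \<in> measurable (PiM UNIV (\<lambda>_. ?R)) (PiM {..<n} (\<lambda>_. ?R))"
      by (rule measurable_restrict_subset) simp
  qed measurable
  also have "\<dots> = (\<integral>\<^sup>+x. ennreal (\<Prod>k<m. u (pattern n (\<lambda>i. x i k))) \<partial>PiM {..<n} (\<lambda>_. ?R))"
    by (subst distr_PiM_restrict_finite) auto
  also have "\<dots> = ennreal (\<Prod>k<m. bernoulli_weight n u (q k))"
    by (rule nn_integral_bernoulli_rows[OF q u])
  finally show ?thesis unfolding pq by (simp only: q_def)
qed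

subsection \<open>The Laplace functional of the jumps\<close>

text \<open>The power of \<rho> with exponent \<open>x\<close>, with value 0 at infinity. For
  \<open>\<rho> = 0\<close> the convention \<open>0 ^ 0 = 1\<close> gives the right value for a set
  without points.\<close>

definition point_weight :: "real \<Rightarrow> enat \<Rightarrow> real" where
  "point_weight \<rho> x = (case x of enat n \<Rightarrow> \<rho> ^ n | \<infinity> \<Rightarrow> 0)"

lemma point_weight_simps[simp]: "point_weight \<rho> (enat n) = \<rho> ^ n" "point_weight \<rho> \<infinity> = 0"
  by (simp_all add: point_weight_def)

lemma point_weight_nonneg: "0 \<le> \<rho> \<Longrightarrow> 0 \<le> point_weight \<rho> x"
  by (cases x) simp_all

lemma nn_integral_point_weight:
  assumes \<rho>: "0 \<le> \<rho>" and r: "0 \<le> r"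
  shows "(\<integral>\<^sup>+x. ennreal (point_weight \<rho> x) \<partial>measure_pmf (extended_poisson_pmf (ennreal r))) = ennreal (exp (- r * (1 - \<rho>)))"
proof (cases "r = 0")
  case True
  have "point_weight \<rho> 0 = 1" using point_weight_simps(1)[of \<rho> 0] by (simp add: zero_enat_def)
  then show ?thesis using True by (simp add: extended_poisson_pmf_def)
next
  case False
  then have r0: "0 < r" using r by simp
  have "(\<integral>\<^sup>+x. ennreal (point_weight \<rho> x) \<partial>measure_pmf (extended_poisson_pmf (ennreal r))) =
    (\<integral>\<^sup>+n. ennreal (\<rho> ^ n) \<partial>measure_pmf (poisson_pmf r))"
    using r0 by (simp add: extended_poisson_pmf_def)
  also have "\<dots> = (\<Sum>n. ennreal (r ^ n / fact n * exp (- r)) * ennreal (\<rho> ^ n))"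
    using r0 by (simp add: nn_integral_measure_pmf nn_integral_count_space_nat)
  also have "\<dots> = (\<Sum>n. ennreal ((r * \<rho>) ^ n / fact n * exp (- r)))"
    using r0 \<rho> by (intro suminf_cong) (simp add: power_mult_distrib mult_ac flip: ennreal_mult)
  also have "\<dots> = ennreal (exp (r * \<rho>) * exp (- r))"
  proof (rule suminf_ennreal_eq)
    have "(\<lambda>n. (r * \<rho>) ^ n /\<^sub>R fact n * exp (- r)) sums (exp (r * \<rho>) * exp (- r))"
      by (intro sums_mult2 exp_converges)
    then show "(\<lambda>n. (r * \<rho>) ^ n / fact n * exp (- r)) sums (exp (r * \<rho>) * exp (- r))"
      by (simp add: divide_inverse mult.commute)
  qed (use r0 \<rho> in auto)
  finally show ?thesis by (simp add: algebra_simps flip: exp_add)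
qed

text \<open>Grouping the points by the level of \<open>c\<close> turns a product over an arbitrary
  enumeration into a function of counts, which is all that the Poisson hypothesis describes. Points
  of level 0 contribute the factor 1; an infinite positive level makes both sides 0.\<close>

lemma INF_prod_level_sets:
  fixes c :: "real \<Rightarrow> nat" and x :: "nat \<Rightarrow> real"
  assumes q: "0 < q" and c: "\<And>s. c s \<le> q"
  shows "(INF m. ennreal (\<Prod>k<m. 1 - real (c (x k)) / real q)) =
    (\<Prod>i<q. ennreal (point_weight (1 - real (Suc i) / real q) (num_points x {s. c s = Suc i})))"
proof -
  let ?a = "\<lambda>k. 1 - real (c (x k)) / real q"
  let ?A = "\<lambda>i. {k. c (x k) = Suc i}"
  have a: "0 \<le> ?a k" "?a k \<le> 1" for k using c[of "x k"] q by auto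
  show ?thesis
  proof (cases "\<forall>i<q. finite (?A i)")
    case True
    have "(INF m. ennreal (\<Prod>k<m. ?a k)) = ennreal (\<Prod>k\<in>(\<Union>i<q. ?A i). ?a k)"
    proof (rule INF_prod_finite[OF a])
      show "finite (\<Union>i<q. ?A i)" using True by auto
      fix k assume k: "k \<notin> (\<Union>i<q. ?A i)"
      have "c (x k) = 0"
      proof (rule ccontr)
        assume "c (x k) \<noteq> 0"
        then obtain i where i: "c (x k) = Suc i" by (cases "c (x k)") auto
        then have "i < q" using c[of "x k"] by auto
        then show False using k i by blast
      qed
      then show "?a k = 1" by simp
    qed
    also have "(\<Prod>k\<in>(\<Union>i<q. ?A i). ?a k) = (\<Prod>i<q. \<Prod>k\<in>?A i. ?a k)"
      using True by (intro prod.UNION_disjoint) auto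
    also have "\<dots> = (\<Prod>i<q. point_weight (1 - real (Suc i) / real q) (num_points x {s. c s = Suc i}))"
    proof (intro prod.cong refl)
      fix i assume "i \<in> {..<q}"
      then have "finite (?A i)" using True by simp
      then show "(\<Prod>k\<in>?A i. ?a k) = point_weight (1 - real (Suc i) / real q) (num_points x {s. c s = Suc i})"
        by (simp add: num_points_def)
    qed
    also have "ennreal \<dots> = (\<Prod>i<q. ennreal (point_weight (1 - real (Suc i) / real q) (num_points x {s. c s = Suc i})))"
    proof (rule prod_ennreal[symmetric])
      fix i assume "i \<in> {..<q}"
      then show "0 \<le> point_weight (1 - real (Suc i) / real q) (num_points x {s. c s = Suc i})"
        using q by (intro point_weight_nonneg) (simp add: divide_simps)
    qed
    finally show ?thesis .
  next
    case False
    then obtain i where i: "i < q" "infinite (?A i)" by auto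
    have "(INF m. ennreal (\<Prod>k<m. ?a k)) = 0"
    proof (rule INF_prod_zero[OF a])
      show "infinite {k. ?a k \<le> 1 - real (Suc i) / real q}"
        by (rule infinite_super[OF _ i(2)]) auto
      show "1 - real (Suc i) / real q < 1" using q by simp
    qed
    moreover have "point_weight (1 - real (Suc i) / real q) (num_points x {s. c s = Suc i}) = 0"
      using i by (simp add: num_points_def)
    then have "(\<Prod>i<q. ennreal (point_weight (1 - real (Suc i) / real q) (num_points x {s. c s = Suc i}))) = 0"
      using i(1) by (intro prod_zero) (auto intro!: bexI[of _ i])
    ultimately show ?thesis by simp
  qed
qed

locale BFRY_feature_model_params = BFRY_feature_model + urn_params
begin

lemma zeta_meas[measurable]: "\<zeta> \<in> borel_measurable M"
  using distributed_measurable[OF zeta_law] by simp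

lemma J_meas[measurable]: "J k \<in> borel_measurable M"
  using jumps by (simp add: cond_poisson_process_def)

lemma Z_meas[measurable]: "Z \<in> measurable M matrix_space"
  using entries by (simp add: cond_distributed_def)

text \<open>For a function with values in the multiples of \<open>1 / q\<close>, the counts of the
  positive levels are independent Poisson variables given \<open>\<zeta>\<close>, so the functional
  is a product of Poisson generating functions.\<close>

lemma nn_integral_simple_jumps:
  fixes c :: "real \<Rightarrow> nat"
  assumes q: "0 < q" and c: "\<And>s. c s \<le> q" and c_meas: "c \<in> measurable borel (count_space UNIV)"
    and fin: "(\<integral>\<^sup>+s. ennreal (real (c s) / real q * levy_density \<alpha> \<theta> s) \<partial>lborel) < \<infinity>"
  shows "(\<integral>\<^sup>+\<omega>. (INF m. ennreal (\<Prod>k<m. 1 - real (c (J k \<omega>)) / real q)) \<partial>M) =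
    (\<integral>\<^sup>+\<omega>. ennreal (exp (- \<zeta> \<omega> * enn2real (\<integral>\<^sup>+s. ennreal (real (c s) / real q * levy_density \<alpha> \<theta> s) \<partial>lborel))) \<partial>M)"
proof -
  note [measurable] = c_meas
  let ?lev = "levy_density \<alpha> \<theta>"
  define A where "A i = {s. c s = Suc i}" for i
  have A[measurable]: "A i \<in> sets borel" for i
  proof -
    have "A i = c -` {Suc i} \<inter> space borel" by (auto simp: A_def)
    also have "\<dots> \<in> sets borel" by (rule measurable_sets[OF c_meas]) simp
    finally show ?thesis .
  qed
  define L where "L i = (\<integral>\<^sup>+s. ennreal (?lev s) * indicator (A i) s \<partial>lborel)" for i
  define I where "I = (\<integral>\<^sup>+s. ennreal (real (c s) / real q * ?lev s) \<partial>lborel)"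
  have lev: "0 \<le> ?lev s" for s using \<alpha> by (intro levy_density_nonneg) auto
  have I_eq: "I = (\<Sum>i<q. ennreal (real (Suc i) / real q) * L i)"
  proof -
    have "I = (\<integral>\<^sup>+s. (\<Sum>i<q. ennreal (real (Suc i) / real q) * (ennreal (?lev s) * indicator (A i) s)) \<partial>lborel)"
      unfolding I_def
    proof (intro nn_integral_cong)
      fix s
      show "ennreal (real (c s) / real q * ?lev s) = (\<Sum>i<q. ennreal (real (Suc i) / real q) * (ennreal (?lev s) * indicator (A i) s))"
      proof (cases "c s")
        case 0
        then show ?thesis by (simp add: A_def)
      next
        case (Suc i)
        then have "i < q" using c[of s] by simp
        have "(\<Sum>j<q. ennreal (real (Suc j) / real q) * (ennreal (?lev s) * indicator (A j) s)) =
          (\<Sum>j<q. if j = i then ennreal (real (Suc i) / real q) * ennreal (?lev s) else 0)"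
          by (intro sum.cong refl) (auto simp: A_def Suc)
        also have "\<dots> = ennreal (real (Suc i) / real q) * ennreal (?lev s)" using \<open>i < q\<close> by simp
        also have "\<dots> = ennreal (real (Suc i) / real q * ?lev s)"
          using lev[of s] by (intro ennreal_mult[symmetric]) auto
        finally show ?thesis unfolding Suc by (rule sym)
      qed
    qed
    also have "\<dots> = (\<Sum>i<q. ennreal (real (Suc i) / real q) * L i)"
      unfolding L_def by (subst nn_integral_sum) (auto simp: nn_integral_cmult)
    finally show ?thesis .
  qed
  \<comment> \<open>Each positive level carries a coefficient bounded away from 0 in a finite
    integral. The level 0, where infinitely many small jumps may accumulate, is not among the sets
    \<open>A i\<close>.\<close>
  have Lfin: "L i < \<top>" if "i < q" for i
  proof -
    have "ennreal (real (Suc i) / real q) * L i \<le> I"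
      unfolding I_eq using that by (intro member_le_sum) auto
    then have "ennreal (real (Suc i) / real q) * L i < \<top>"
      using fin unfolding I_def[symmetric] by (simp add: le_less_trans)
    then show ?thesis using q by (auto simp: ennreal_mult_less_top)
  qed
  let ?Y = "\<lambda>\<omega>. \<lambda>i\<in>{..<q}. num_points (\<lambda>k. J k \<omega>) (A i)"
  let ?LM = "\<lambda>\<omega>. density lborel (\<lambda>s. ennreal (\<zeta> \<omega> * ?lev s))"
  let ?K = "\<lambda>\<omega>. PiM {..<q} (\<lambda>i. measure_pmf (extended_poisson_pmf (emeasure (?LM \<omega>) (A i))))"
  let ?PL = "PiM {..<q} (\<lambda>_. count_space UNIV) :: (nat \<Rightarrow> enat) measure"
  let ?w = "\<lambda>i x. ennreal (point_weight (1 - real (Suc i) / real q) x)"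
  have cd: "cond_distributed M (generated_by M borel \<zeta>) ?PL ?Y ?K"
  proof -
    have "disjoint_family_on A {..<q}" by (auto simp: disjoint_family_on_def A_def)
    then show ?thesis using jumps A unfolding cond_poisson_process_def by blast
  qed
  have w[measurable]: "(\<lambda>y. ?w i (y i)) \<in> borel_measurable ?PL" if "i \<in> {..<q}" for i
    by (rule measurable_compose[OF measurable_component_singleton[OF that]]) simp
  define f where "f y = (\<Prod>i<q. ?w i (y i))" for y
  have f: "f \<in> borel_measurable ?PL"
    unfolding f_def by (intro borel_measurable_prod_ennreal) (rule w)
  have prK: "prob_space (?K \<omega>)" for \<omega> by (intro prob_space_PiM measure_pmf.prob_space_axioms)
  have setsK: "sets (?K \<omega>) = sets ?PL" for \<omega> by (intro sets_PiM_cong) auto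
  have "(\<integral>\<^sup>+\<omega>. (INF m. ennreal (\<Prod>k<m. 1 - real (c (J k \<omega>)) / real q)) \<partial>M) =
    (\<integral>\<^sup>+\<omega>. f (?Y \<omega>) \<partial>M)"
  proof (intro nn_integral_cong)
    fix \<omega>
    have "f (?Y \<omega>) = (\<Prod>i<q. ?w i (num_points (\<lambda>k. J k \<omega>) (A i)))"
      unfolding f_def by (intro prod.cong) auto
    then show "(INF m. ennreal (\<Prod>k<m. 1 - real (c (J k \<omega>)) / real q)) = f (?Y \<omega>)"
      using INF_prod_level_sets[OF q c, where x="\<lambda>k. J k \<omega>"] by (simp only: A_def)
  qed
  also have "\<dots> = (\<integral>\<^sup>+\<omega>. (\<integral>\<^sup>+y. f y \<partial>?K \<omega>) \<partial>M)"
    by (rule cond_distributed_nn_integral_marginal[OF prob_space_axioms cd prK setsK f])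
  also have "\<dots> = (\<integral>\<^sup>+\<omega>. ennreal (exp (- \<zeta> \<omega> * enn2real I)) \<partial>M)"
    using AE_BFRY_distributed_pos[OF zeta_law]
  proof (intro nn_integral_cong_AE, eventually_elim)
    fix \<omega> assume z: "0 < \<zeta> \<omega>"
    have em: "emeasure (?LM \<omega>) (A i) = ennreal (\<zeta> \<omega> * enn2real (L i))" if "i < q" for i
    proof -
      have "emeasure (?LM \<omega>) (A i) = (\<integral>\<^sup>+s. ennreal (\<zeta> \<omega> * ?lev s) * indicator (A i) s \<partial>lborel)"
        by (rule emeasure_density) auto
      also have "\<dots> = (\<integral>\<^sup>+s. ennreal (\<zeta> \<omega>) * (ennreal (?lev s) * indicator (A i) s) \<partial>lborel)"
        using z lev by (intro nn_integral_cong) (simp add: ennreal_mult mult.assoc)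
      also have "\<dots> = ennreal (\<zeta> \<omega>) * L i" unfolding L_def by (rule nn_integral_cmult) measurable
      also have "\<dots> = ennreal (\<zeta> \<omega> * enn2real (L i))"
        using z Lfin[OF that] by (simp add: ennreal_mult)
      finally show ?thesis .
    qed
    have "(\<integral>\<^sup>+y. f y \<partial>?K \<omega>) = (\<integral>\<^sup>+y. (\<Prod>i<q. ?w i (y i)) \<partial>?K \<omega>)"
      by (simp add: f_def)
    also have "\<dots> = (\<Prod>i<q. \<integral>\<^sup>+x. ?w i x \<partial>measure_pmf (extended_poisson_pmf (emeasure (?LM \<omega>) (A i))))"
      by (rule nn_integral_PiM_prod) (auto simp: measure_pmf.prob_space_axioms)
    also have "\<dots> = (\<Prod>i<q. ennreal (exp (- \<zeta> \<omega> * (real (Suc i) / real q * enn2real (L i)))))"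
    proof (intro prod.cong refl)
      fix i assume "i \<in> {..<q}"
      then have i: "i < q" by simp
      have "(\<integral>\<^sup>+x. ?w i x \<partial>measure_pmf (extended_poisson_pmf (ennreal (\<zeta> \<omega> * enn2real (L i))))) =
        ennreal (exp (- (\<zeta> \<omega> * enn2real (L i)) * (1 - (1 - real (Suc i) / real q))))"
        using i z by (intro nn_integral_point_weight) (auto simp: divide_simps)
      then show "(\<integral>\<^sup>+x. ?w i x \<partial>measure_pmf (extended_poisson_pmf (emeasure (?LM \<omega>) (A i)))) =
        ennreal (exp (- \<zeta> \<omega> * (real (Suc i) / real q * enn2real (L i))))"
        unfolding em[OF i] by (simp add: mult_ac)
    qed
    also have "\<dots> = ennreal (exp (\<Sum>i<q. - \<zeta> \<omega> * (real (Suc i) / real q * enn2real (L i))))"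
      by (simp add: prod_ennreal exp_sum)
    also have "(\<Sum>i<q. - \<zeta> \<omega> * (real (Suc i) / real q * enn2real (L i))) = - \<zeta> \<omega> * enn2real I"
    proof -
      have "enn2real I = (\<Sum>i<q. real (Suc i) / real q * enn2real (L i))"
      proof -
        have "I = (\<Sum>i<q. ennreal (real (Suc i) / real q * enn2real (L i)))"
          unfolding I_eq
        proof (intro sum.cong refl)
          fix i assume "i \<in> {..<q}"
          then have "L i = ennreal (enn2real (L i))" using Lfin[of i] by simp
          then have "ennreal (real (Suc i) / real q) * L i = ennreal (real (Suc i) / real q) * ennreal (enn2real (L i))"
            by (rule arg_cong)
          also have "\<dots> = ennreal (real (Suc i) / real q * enn2real (L i))"
            by (intro ennreal_mult[symmetric]) auto
          finally show "ennreal (real (Suc i) / real q) * L i = ennreal (real (Suc i) / real q * enn2real (L i))" .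
        qed
        also have "\<dots> = ennreal (\<Sum>i<q. real (Suc i) / real q * enn2real (L i))"
          by (rule sum_ennreal) auto
        finally show ?thesis by (simp add: sum_nonneg)
      qed
      then show ?thesis by (simp only: sum_distrib_left)
    qed
    finally show "(\<integral>\<^sup>+y. f y \<partial>?K \<omega>) = ennreal (exp (- \<zeta> \<omega> * enn2real I))" .
  qed
  finally show ?thesis unfolding I_def .
qed

text \<open>Rounding \<open>g\<close> down to multiples of \<open>2 ^ - l\<close> gives functions
  increasing to \<open>g\<close>. The products then decrease in \<open>l\<close> as well as in
  \<open>m\<close>, while the Levy integrals increase to a finite limit, so both sides pass to the
  limit.\<close>

lemma nn_integral_jumps:
  fixes g :: "real \<Rightarrow> real"
  assumes g[measurable]: "g \<in> borel_measurable borel" and g01: "\<And>s. 0 \<le> g s" "\<And>s. g s \<le> 1"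
    and fin: "(\<integral>\<^sup>+s. ennreal (g s * levy_density \<alpha> \<theta> s) \<partial>lborel) < \<infinity>"
  shows "(\<integral>\<^sup>+\<omega>. (INF m. ennreal (\<Prod>k<m. 1 - g (J k \<omega>))) \<partial>M) =
    (\<integral>\<^sup>+\<omega>. ennreal (exp (- \<zeta> \<omega> * enn2real (\<integral>\<^sup>+s. ennreal (g s * levy_density \<alpha> \<theta> s) \<partial>lborel))) \<partial>M)"
proof -
  let ?lev = "levy_density \<alpha> \<theta>"
  have lev: "0 \<le> ?lev s" for s using \<alpha> by (intro levy_density_nonneg) auto
  define c where "c l s = nat \<lfloor>2 ^ l * g s\<rfloor>" for l :: nat and s
  define h where "h l s = real (c l s) / real (2 ^ l)" for l s
  have c_meas[measurable]: "c l \<in> measurable borel (count_space UNIV)" for l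
    unfolding c_def by measurable
  have c_le: "c l s \<le> 2 ^ l" for l s
  proof -
    have "2 ^ l * g s \<le> 2 ^ l" using g01(2)[of s] by (simp add: mult_left_le)
    then have "\<lfloor>2 ^ l * g s\<rfloor> \<le> \<lfloor>2 ^ l :: real\<rfloor>" by (rule floor_mono)
    also have "\<lfloor>2 ^ l :: real\<rfloor> = 2 ^ l" by (metis floor_of_int of_int_numeral of_int_power)
    finally show ?thesis by (simp add: c_def nat_le_iff)
  qed
  have rc: "real (c l s) = of_int \<lfloor>2 ^ l * g s\<rfloor>" for l s
    using g01(1)[of s] by (simp add: c_def)
  have h_le: "h l s \<le> g s" for l s
    using of_int_floor_le[of "2 ^ l * g s"] by (simp add: h_def rc field_simps)
  have h_ge: "g s - (1 / 2) ^ l \<le> h l s" for l s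
  proof -
    have "2 ^ l * g s - 1 \<le> real (c l s)" unfolding rc using floor_correct[of "2 ^ l * g s"] by linarith
    then have "(2 ^ l * g s - 1) / 2 ^ l \<le> real (c l s) / 2 ^ l" by (intro divide_right_mono) auto
    then show ?thesis by (simp add: h_def diff_divide_distrib power_divide)
  qed
  have h1: "h l s \<le> 1" for l s using h_le[of l s] g01(2)[of s] by linarith
  have h_Suc: "h l s \<le> h (Suc l) s" for l s
  proof -
    have "2 * \<lfloor>2 ^ l * g s\<rfloor> \<le> \<lfloor>2 ^ Suc l * g s\<rfloor>"
      unfolding le_floor_iff using of_int_floor_le[of "2 ^ l * g s"] by simp
    then have "2 * real (c l s) \<le> real (c (Suc l) s)" unfolding rc by linarith
    then show ?thesis by (simp add: h_def field_simps)
  qed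
  have h_lim: "(\<lambda>l. h l s) \<longlonglongrightarrow> g s" for s
  proof (rule tendsto_sandwich)
    show "(\<lambda>l. g s - (1 / 2) ^ l) \<longlonglongrightarrow> g s"
      using tendsto_diff[OF tendsto_const LIMSEQ_realpow_zero[of "1 / 2"], of "g s"] by simp
  qed (use h_le h_ge in auto)
  have [measurable]: "h l \<in> borel_measurable borel" for l
    unfolding h_def by measurable
  have sup: "(SUP l. \<integral>\<^sup>+s. ennreal (h l s * ?lev s) \<partial>lborel) = (\<integral>\<^sup>+s. ennreal (g s * ?lev s) \<partial>lborel)" (is "(SUP l. ?I l) = ?E")
  proof -
    have inc: "incseq (\<lambda>l s. ennreal (h l s * ?lev s))"
      using h_Suc lev by (intro incseq_SucI le_funI ennreal_leI mult_right_mono) auto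
    have "(SUP l. ennreal (h l s * ?lev s)) = ennreal (g s * ?lev s)" for s
    proof (rule LIMSEQ_unique)
      show "(\<lambda>l. ennreal (h l s * ?lev s)) \<longlonglongrightarrow> (SUP l. ennreal (h l s * ?lev s))"
        using inc by (intro LIMSEQ_SUP) (auto simp: incseq_def le_fun_def)
      show "(\<lambda>l. ennreal (h l s * ?lev s)) \<longlonglongrightarrow> ennreal (g s * ?lev s)"
        by (intro tendsto_ennrealI tendsto_mult_right h_lim)
    qed
    then show ?thesis using nn_integral_monotone_convergence_SUP[OF inc, of lborel] by simp
  qed
  have I_le: "?I l \<le> ?E" for l unfolding sup[symmetric] by (rule SUP_upper) simp
  have I_mono: "incseq ?I"
    using h_Suc lev by (intro incseq_SucI nn_integral_mono ennreal_leI mult_right_mono) auto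
  have I_lim: "(\<lambda>l. enn2real (?I l)) \<longlonglongrightarrow> enn2real ?E"
    using LIMSEQ_SUP[OF I_mono] fin unfolding sup
    by (intro tendsto_enn2real) auto
  have simple: "(\<integral>\<^sup>+\<omega>. (INF m. ennreal (\<Prod>k<m. 1 - h l (J k \<omega>))) \<partial>M) = (\<integral>\<^sup>+\<omega>. ennreal (exp (- \<zeta> \<omega> * enn2real (?I l))) \<partial>M)" for l
    unfolding h_def
  proof (rule nn_integral_simple_jumps[OF _ c_le c_meas])
    show "(\<integral>\<^sup>+s. ennreal (real (c l s) / real (2 ^ l) * ?lev s) \<partial>lborel) < \<infinity>"
      using le_less_trans[OF I_le fin] by (simp add: h_def)
  qed simp
  have dec: "decseq (\<lambda>l. ennreal (\<Prod>k<m. 1 - h l (J k \<omega>)))" for m \<omega>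
    using h_Suc h1 by (intro decseq_SucI ennreal_leI prod_mono) auto
  have inf: "(INF l. ennreal (\<Prod>k<m. 1 - h l (J k \<omega>))) = ennreal (\<Prod>k<m. 1 - g (J k \<omega>))" for m \<omega>
  proof (rule LIMSEQ_unique)
    show "(\<lambda>l. ennreal (\<Prod>k<m. 1 - h l (J k \<omega>))) \<longlonglongrightarrow> (INF l. ennreal (\<Prod>k<m. 1 - h l (J k \<omega>)))"
      by (rule LIMSEQ_INF[OF dec])
    show "(\<lambda>l. ennreal (\<Prod>k<m. 1 - h l (J k \<omega>))) \<longlonglongrightarrow> ennreal (\<Prod>k<m. 1 - g (J k \<omega>))"
      by (intro tendsto_ennrealI tendsto_prod tendsto_diff tendsto_const h_lim)
  qed
  \<comment> \<open>For fixed \<open>m\<close> the product is continuous in its finitely many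
    factors. Both limits being infima, they may be interchanged without any uniformity.\<close>
  have "(\<integral>\<^sup>+\<omega>. (INF m. ennreal (\<Prod>k<m. 1 - g (J k \<omega>))) \<partial>M) =
    (\<integral>\<^sup>+\<omega>. (INF l. INF m. ennreal (\<Prod>k<m. 1 - h l (J k \<omega>))) \<partial>M)"
    unfolding inf[symmetric] by (subst INF_commute) simp
  also have "\<dots> = (INF l. \<integral>\<^sup>+\<omega>. (INF m. ennreal (\<Prod>k<m. 1 - h l (J k \<omega>))) \<partial>M)"
  proof (rule nn_integral_monotone_convergence_INF_decseq)
    show "decseq (\<lambda>l \<omega>. INF m. ennreal (\<Prod>k<m. 1 - h l (J k \<omega>)))"
      using dec by (intro decseq_SucI le_funI INF_mono') (auto simp: decseq_Suc_iff)
    show "(\<lambda>\<omega>. INF m. ennreal (\<Prod>k<m. 1 - h l (J k \<omega>))) \<in> borel_measurable M" for l by measurable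
    have "(\<integral>\<^sup>+\<omega>. (INF m. ennreal (\<Prod>k<m. 1 - h 0 (J k \<omega>))) \<partial>M) \<le> (\<integral>\<^sup>+\<omega>. 1 \<partial>M)"
      by (intro nn_integral_mono INF_lower2[of 0]) auto
    then show "(\<integral>\<^sup>+\<omega>. (INF m. ennreal (\<Prod>k<m. 1 - h 0 (J k \<omega>))) \<partial>M) < \<infinity>"
      by (simp add: emeasure_space_1 le_less_trans)
  qed
  also have "\<dots> = (INF l. \<integral>\<^sup>+\<omega>. ennreal (exp (- \<zeta> \<omega> * enn2real (?I l))) \<partial>M)"
    by (simp only: simple)
  also have "\<dots> = (\<integral>\<^sup>+\<omega>. ennreal (exp (- \<zeta> \<omega> * enn2real ?E)) \<partial>M)"
  proof (rule LIMSEQ_unique)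
    have "decseq (\<lambda>l. \<integral>\<^sup>+\<omega>. ennreal (exp (- \<zeta> \<omega> * enn2real (?I l))) \<partial>M)"
    proof (intro decseq_SucI nn_integral_mono_AE)
      fix l
      have le: "enn2real (?I l) \<le> enn2real (?I (Suc l))"
        using incseq_SucD[OF I_mono, of l] le_less_trans[OF I_le fin, of "Suc l"] by (intro enn2real_mono) auto
      show "AE \<omega> in M. ennreal (exp (- \<zeta> \<omega> * enn2real (?I (Suc l)))) \<le> ennreal (exp (- \<zeta> \<omega> * enn2real (?I l)))"
        using AE_BFRY_distributed_pos[OF zeta_law]
      proof eventually_elim
        fix \<omega> assume "0 < \<zeta> \<omega>"
        then show "ennreal (exp (- \<zeta> \<omega> * enn2real (?I (Suc l)))) \<le> ennreal (exp (- \<zeta> \<omega> * enn2real (?I l)))"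
          using mult_left_mono[OF le, of "\<zeta> \<omega>"] by (intro ennreal_leI) simp
      qed
    qed
    then show "(\<lambda>l. \<integral>\<^sup>+\<omega>. ennreal (exp (- \<zeta> \<omega> * enn2real (?I l))) \<partial>M) \<longlonglongrightarrow> (INF l. \<integral>\<^sup>+\<omega>. ennreal (exp (- \<zeta> \<omega> * enn2real (?I l))) \<partial>M)"
      by (rule LIMSEQ_INF)
    show "(\<lambda>l. \<integral>\<^sup>+\<omega>. ennreal (exp (- \<zeta> \<omega> * enn2real (?I l))) \<partial>M) \<longlonglongrightarrow> (\<integral>\<^sup>+\<omega>. ennreal (exp (- \<zeta> \<omega> * enn2real ?E)) \<partial>M)"
    proof (rule nn_integral_dominated_convergence[where w="\<lambda>_. 1"])
      show "AE \<omega> in M. ennreal (exp (- \<zeta> \<omega> * enn2real (?I l))) \<le> 1" for l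
        using AE_BFRY_distributed_pos[OF zeta_law] by eventually_elim auto
      show "AE \<omega> in M. (\<lambda>l. ennreal (exp (- \<zeta> \<omega> * enn2real (?I l)))) \<longlonglongrightarrow> ennreal (exp (- \<zeta> \<omega> * enn2real ?E))"
        by (intro always_eventually allI tendsto_ennrealI tendsto_exp tendsto_mult_left I_lim)
    qed (auto simp: emeasure_space_1)
  qed
  finally show ?thesis .
qed

text \<open>Given the jumps, a column contributes its expected weight \<open>1 - g (J k)\<close>,
  and the Laplace functional takes over. The integral of \<open>g\<close> against the Levy density
  is \<open>T - S(u)\<close> because the expansion of \<open>g\<close> runs over the non-zero
  patterns only.\<close>

theorem nn_integral_pattern_weights:
  assumes u: "\<And>v. 0 \<le> u v" "\<And>v. u v \<le> 1" "u 0 = 1"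
  shows "(\<integral>\<^sup>+\<omega>. (INF m. ennreal (\<Prod>k<m. u (pattern n (column (Z \<omega>) k)))) \<partial>M) =
    (\<integral>\<^sup>+z. ennreal (exp (- (total_weight \<alpha> \<theta> n (\<lambda>_. 1) - total_weight \<alpha> \<theta> n u) * z)) \<partial>BFRY \<sigma>)"
proof -
  let ?cl = "\<lambda>s :: real. min 1 (max 0 s)" and ?lev = "levy_density \<alpha> \<theta>"
  define g where "g s = 1 - bernoulli_weight n u (?cl s)" for s
  have bw_meas[measurable]: "(\<lambda>s. bernoulli_weight n u (?cl s)) \<in> borel_measurable borel"
    unfolding bernoulli_weight_eq by measurable
  have g_meas[measurable]: "g \<in> borel_measurable borel" unfolding g_def by measurable
  have g01: "0 \<le> g s" "g s \<le> 1" for s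
    using bernoulli_weight_bounds[of "?cl s" u n] u by (auto simp: g_def)
  have lev: "0 \<le> ?lev s" for s using \<alpha> by (intro levy_density_nonneg) auto
  have int: "(\<integral>\<^sup>+s. ennreal (g s * ?lev s) \<partial>lborel) = ennreal (total_weight \<alpha> \<theta> n (\<lambda>_. 1) - total_weight \<alpha> \<theta> n u)"
  proof -
    have "(\<integral>\<^sup>+s. ennreal (g s * ?lev s) \<partial>lborel) =
      (\<integral>\<^sup>+s. (\<Sum>v\<in>{1..<2 ^ n}. ennreal (1 - u v) * ennreal (s ^ popcount v * (1 - s) ^ (n - popcount v) * ?lev s)) \<partial>lborel)"
    proof (intro nn_integral_cong)
      fix s :: real
      show "ennreal (g s * ?lev s) = (\<Sum>v\<in>{1..<2 ^ n}. ennreal (1 - u v) * ennreal (s ^ popcount v * (1 - s) ^ (n - popcount v) * ?lev s))"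
      proof (cases "0 < s \<and> s < 1")
        case True
        have "(\<Sum>v\<in>{1..<2 ^ n}. ennreal (1 - u v) * ennreal (s ^ popcount v * (1 - s) ^ (n - popcount v) * ?lev s)) =
          (\<Sum>v\<in>{1..<2 ^ n}. ennreal ((1 - u v) * (s ^ popcount v * (1 - s) ^ (n - popcount v) * ?lev s)))"
          using True u lev by (intro sum.cong refl ennreal_mult[symmetric] mult_nonneg_nonneg) auto
        also have "\<dots> = ennreal (\<Sum>v\<in>{1..<2 ^ n}. (1 - u v) * (s ^ popcount v * (1 - s) ^ (n - popcount v) * ?lev s))"
          using True u lev by (intro sum_ennreal mult_nonneg_nonneg) auto
        also have "(\<Sum>v\<in>{1..<2 ^ n}. (1 - u v) * (s ^ popcount v * (1 - s) ^ (n - popcount v) * ?lev s)) = g s * ?lev s"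
          using True by (simp add: g_def bernoulli_weight_compl[of u, OF u(3)] sum_distrib_right mult.assoc)
        finally show ?thesis ..
      qed (auto simp: levy_density_def)
    qed
    also have "\<dots> = (\<Sum>v\<in>{1..<2 ^ n}. ennreal (1 - u v) * (\<integral>\<^sup>+s. ennreal (s ^ popcount v * (1 - s) ^ (n - popcount v) * ?lev s) \<partial>lborel))"
      by (subst nn_integral_sum) (auto simp: nn_integral_cmult)
    also have "\<dots> = (\<Sum>v\<in>{1..<2 ^ n}. ennreal ((1 - u v) * pattern_mass \<alpha> \<theta> n v))"
    proof (intro sum.cong refl)
      fix v :: nat assume v: "v \<in> {1..<2 ^ n}"
      then have "1 \<le> popcount v" "popcount v \<le> n" using popcount_pos[of v] popcount_le[of v n] by auto
      then have "(\<integral>\<^sup>+s. ennreal (s ^ popcount v * (1 - s) ^ (n - popcount v) * ?lev s) \<partial>lborel) = ennreal (pattern_mass \<alpha> \<theta> n v)"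
        unfolding pattern_mass_def by (rule nn_integral_levy_beta[OF \<alpha> \<theta>])
      then show "ennreal (1 - u v) * (\<integral>\<^sup>+s. ennreal (s ^ popcount v * (1 - s) ^ (n - popcount v) * ?lev s) \<partial>lborel) =
        ennreal ((1 - u v) * pattern_mass \<alpha> \<theta> n v)"
        using u(2)[of v] pattern_mass_nonneg[OF v] by (simp add: ennreal_mult)
    qed
    also have "\<dots> = ennreal (\<Sum>v\<in>{1..<2 ^ n}. (1 - u v) * pattern_mass \<alpha> \<theta> n v)"
      using u pattern_mass_nonneg by (intro sum_ennreal mult_nonneg_nonneg) auto
    also have "(\<Sum>v\<in>{1..<2 ^ n}. (1 - u v) * pattern_mass \<alpha> \<theta> n v) = total_weight \<alpha> \<theta> n (\<lambda>_. 1) - total_weight \<alpha> \<theta> n u"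
      unfolding total_weight_def by (simp add: sum_subtractf[symmetric] left_diff_distrib)
    finally show ?thesis .
  qed
  have diff: "0 \<le> total_weight \<alpha> \<theta> n (\<lambda>_. 1) - total_weight \<alpha> \<theta> n u"
  proof -
    have "total_weight \<alpha> \<theta> n u \<le> total_weight \<alpha> \<theta> n (\<lambda>_. 1)"
      unfolding total_weight_def by (intro sum_mono mult_right_mono pattern_mass_nonneg u(2))
    then show ?thesis by simp
  qed
  have step: "(\<integral>\<^sup>+\<omega>. ennreal (\<Prod>k<m. u (pattern n (column (Z \<omega>) k))) \<partial>M) = (\<integral>\<^sup>+\<omega>. ennreal (\<Prod>k<m. 1 - g (J k \<omega>)) \<partial>M)" for m
  proof -
    let ?K = "\<lambda>\<omega>. PiM UNIV (\<lambda>i::nat. PiM UNIV (\<lambda>k. measure_pmf (bernoulli_pmf (J k \<omega>))))"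
    define f where "f X = ennreal (\<Prod>k<m. u (pattern n (column X k)))" for X
    have f: "f \<in> borel_measurable matrix_space" unfolding f_def by measurable
    have prK: "prob_space (?K \<omega>)" for \<omega> by (intro prob_space_PiM measure_pmf.prob_space_axioms)
    have setsK: "sets (?K \<omega>) = sets matrix_space" for \<omega>
      unfolding matrix_space_def by (intro sets_PiM_cong refl) auto
    have "(\<integral>\<^sup>+\<omega>. f (Z \<omega>) \<partial>M) = (\<integral>\<^sup>+\<omega>. (\<integral>\<^sup>+X. f X \<partial>?K \<omega>) \<partial>M)"
      by (rule cond_distributed_nn_integral_marginal[OF prob_space_axioms entries prK setsK f])
    also have "\<dots> = (\<integral>\<^sup>+\<omega>. ennreal (\<Prod>k<m. 1 - g (J k \<omega>)) \<partial>M)"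
    proof (rule nn_integral_cong)
      fix \<omega>
      show "(\<integral>\<^sup>+X. f X \<partial>?K \<omega>) = ennreal (\<Prod>k<m. 1 - g (J k \<omega>))"
        unfolding f_def g_def diff_diff_eq2 add_diff_cancel_left' by (rule nn_integral_bernoulli_matrix[OF u(1)])
    qed
    finally show ?thesis by (simp only: f_def)
  qed
  \<comment> \<open>The Bernoulli formula covers finitely many columns, so the infinite product is
    taken out of the integral on both sides and the partial products are compared.\<close>
  have INF1: "(\<integral>\<^sup>+\<omega>. (INF m. ennreal (\<Prod>k<m. a k \<omega>)) \<partial>M) = (INF m. \<integral>\<^sup>+\<omega>. ennreal (\<Prod>k<m. a k \<omega>) \<partial>M)"
    if a: "\<And>k \<omega>. 0 \<le> a k \<omega>" "\<And>k \<omega>. a k \<omega> \<le> 1" "\<And>k. a k \<in> borel_measurable M" for a :: "nat \<Rightarrow> 'a \<Rightarrow> real"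
  proof (rule nn_integral_monotone_convergence_INF_decseq)
    show "decseq (\<lambda>m \<omega>. ennreal (\<Prod>k<m. a k \<omega>))"
    proof (intro decseq_SucI le_funI)
      fix m \<omega>
      show "ennreal (\<Prod>k<Suc m. a k \<omega>) \<le> ennreal (\<Prod>k<m. a k \<omega>)"
        using decseq_SucD[OF decseq_prod_weights[of "\<lambda>k. a k \<omega>", OF a(1,2)]] .
    qed
    show "(\<lambda>\<omega>. ennreal (\<Prod>k<m. a k \<omega>)) \<in> borel_measurable M" for m using a(3) by measurable
    show "(\<integral>\<^sup>+\<omega>. ennreal (\<Prod>k<0. a k \<omega>) \<partial>M) < \<infinity>" by (simp add: emeasure_space_1)
  qed
  have "(\<integral>\<^sup>+\<omega>. (INF m. ennreal (\<Prod>k<m. u (pattern n (column (Z \<omega>) k)))) \<partial>M) =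
    (\<integral>\<^sup>+\<omega>. (INF m. ennreal (\<Prod>k<m. 1 - g (J k \<omega>))) \<partial>M)"
    by (subst (1 2) INF1) (use u g01 in \<open>auto simp: step intro: measurable_compose[OF Z_meas weight_measurable]\<close>)
  also have "\<dots> = (\<integral>\<^sup>+\<omega>. ennreal (exp (- \<zeta> \<omega> * enn2real (\<integral>\<^sup>+s. ennreal (g s * ?lev s) \<partial>lborel))) \<partial>M)"
    by (rule nn_integral_jumps[OF g_meas g01]) (simp add: int)
  also have "\<dots> = (\<integral>\<^sup>+\<omega>. ennreal (exp (- (total_weight \<alpha> \<theta> n (\<lambda>_. 1) - total_weight \<alpha> \<theta> n u) * \<zeta> \<omega>)) \<partial>M)"
    unfolding int enn2real_ennreal[OF diff] by (simp add: algebra_simps)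
  also have "\<dots> = (\<integral>\<^sup>+z. ennreal (exp (- (total_weight \<alpha> \<theta> n (\<lambda>_. 1) - total_weight \<alpha> \<theta> n u) * z)) \<partial>BFRY \<sigma>)"
    by (rule nn_integral_BFRY_distributed[OF zeta_law]) measurable
  finally show ?thesis .
qed

end

subsection \<open>Encoding the pattern counts by prime factorizations\<close>

abbreviation support :: "nat \<Rightarrow> binary_matrix \<Rightarrow> nat set" where
  "support n Z \<equiv> {k. 0 < pattern n (column Z k)}"

definition pattern_count :: "nat \<Rightarrow> binary_matrix \<Rightarrow> nat \<Rightarrow> nat" where
  "pattern_count n Z v = card {k. pattern n (column Z k) = v}"

definition prime_code :: "nat \<Rightarrow> nat" where
  "prime_code = enumerate {p. prime p}"

text \<open>The value 0 is free to mark infinite support, as a product of prime powers is never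
  0.\<close>

definition code :: "nat \<Rightarrow> binary_matrix \<Rightarrow> nat" where
  "code n Z = (if finite (support n Z) then \<Prod>v\<in>{1..<2 ^ n}. prime_code v ^ pattern_count n Z v else 0)"

lemma prime_prime_code: "prime (prime_code v)"
  using enumerate_in_set[OF primes_infinite, of v] by (simp add: prime_code_def)

lemma inj_prime_code: "inj prime_code"
  unfolding prime_code_def using strict_mono_enumerate[OF primes_infinite] strict_mono_imp_inj_on by blast

lemma code_eq_0_iff: "code n Z = 0 \<longleftrightarrow> infinite (support n Z)"
  using prime_gt_0_nat[OF prime_prime_code] by (simp add: code_def)

lemma multiplicity_prime_code:
  fixes c :: "nat \<Rightarrow> nat"
  assumes "finite A" "v \<in> A"
  shows "multiplicity (prime_code v) (\<Prod>w\<in>A. prime_code w ^ c w) = c v"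
proof -
  have "(\<Prod>w\<in>A. prime_code w ^ c w) = (\<Prod>p\<in>prime_code ` A. p ^ c (inv prime_code p))"
    using inj_prime_code by (subst prod.reindex) (auto intro: inj_on_subset)
  also have "multiplicity (prime_code v) \<dots> = c (inv prime_code (prime_code v))"
    using assms by (subst multiplicity_prod_prime_powers) (auto simp: prime_prime_code)
  finally show ?thesis using inj_prime_code by simp
qed

lemma multiplicity_code:
  assumes "finite (support n Z)" "v \<in> {1..<2 ^ n}"
  shows "multiplicity (prime_code v) (code n Z) = pattern_count n Z v"
  using assms multiplicity_prime_code[of "{1..<2 ^ n}" v "pattern_count n Z"] by (simp add: code_def)

lemma prod_support:
  fixes w :: "nat \<Rightarrow> 'a::comm_monoid_mult"
  assumes fin: "finite (support n Z)"
  shows "(\<Prod>k\<in>support n Z. w (pattern n (column Z k))) = (\<Prod>v\<in>{1..<2 ^ n}. w v ^ pattern_count n Z v)"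
proof -
  have "(\<Prod>k\<in>support n Z. w (pattern n (column Z k))) =
    (\<Prod>v\<in>{1..<2 ^ n}. \<Prod>k\<in>{k \<in> support n Z. pattern n (column Z k) = v}. w (pattern n (column Z k)))"
    using fin pattern_less by (intro prod.group[symmetric]) (auto simp: Suc_le_eq)
  also have "\<dots> = (\<Prod>v\<in>{1..<2 ^ n}. w v ^ pattern_count n Z v)"
  proof (intro prod.cong refl)
    fix v :: nat assume "v \<in> {1..<2 ^ n}"
    then have "{k \<in> support n Z. pattern n (column Z k) = v} = {k. pattern n (column Z k) = v}" by auto
    then show "(\<Prod>k\<in>{k \<in> support n Z. pattern n (column Z k) = v}. w (pattern n (column Z k))) = w v ^ pattern_count n Z v"
      by (simp add: pattern_count_def)
  qed
  finally show ?thesis .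
qed

definition code_weight :: "nat \<Rightarrow> nat \<Rightarrow> real" where
  "code_weight s v = (if v = 0 then 1 else (1 / real (prime_code v)) ^ s)"

lemma code_weight_bounds: "0 \<le> code_weight s v" "code_weight s v \<le> 1" "code_weight s 0 = 1"
  using prime_gt_1_nat[OF prime_prime_code, of v] by (auto simp: code_weight_def intro!: power_le_one)

text \<open>Holds without a finiteness assumption: for infinite support infinitely many factors are
  at most \<open>1 / 2\<close>, and the right side is a positive power of
  \<open>1 / 0 = 0\<close>.\<close>

lemma INF_code_weight:
  assumes s: "1 \<le> s"
  shows "(INF m. ennreal (\<Prod>k<m. code_weight s (pattern n (column Z k)))) = ennreal ((1 / real (code n Z)) ^ s)"
proof (cases "finite (support n Z)")
  case True
  have "(INF m. ennreal (\<Prod>k<m. code_weight s (pattern n (column Z k)))) =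
    ennreal (\<Prod>k\<in>support n Z. code_weight s (pattern n (column Z k)))"
    by (rule INF_prod_finite) (use True in \<open>auto simp: code_weight_bounds\<close>)
  also have "(\<Prod>k\<in>support n Z. code_weight s (pattern n (column Z k))) = (\<Prod>v\<in>{1..<2 ^ n}. code_weight s v ^ pattern_count n Z v)"
    by (rule prod_support[OF True])
  also have "\<dots> = (\<Prod>v\<in>{1..<2 ^ n}. ((1 / real (prime_code v)) ^ pattern_count n Z v) ^ s)"
    by (intro prod.cong refl) (auto simp: code_weight_def mult.commute simp flip: power_mult)
  also have "\<dots> = (1 / real (code n Z)) ^ s"
    using True by (simp add: code_def prod_power_distrib[symmetric] power_one_over prod_dividef)
  finally show ?thesis .
next
  case False
  have "(INF m. ennreal (\<Prod>k<m. code_weight s (pattern n (column Z k)))) = 0"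
  proof (rule INF_prod_zero[where \<rho>="1 / 2"])
    have "code_weight s v \<le> 1 / 2" if "0 < v" for v
    proof -
      have p: "2 \<le> real (prime_code v)" using prime_ge_2_nat[OF prime_prime_code, of v] by simp
      have "(1 / real (prime_code v)) ^ s \<le> (1 / real (prime_code v)) ^ 1"
        using p s by (intro power_decreasing) auto
      also have "\<dots> \<le> 1 / 2" using p by (simp add: divide_simps)
      finally show ?thesis using that by (simp add: code_weight_def)
    qed
    then have "support n Z \<subseteq> {k. code_weight s (pattern n (column Z k)) \<le> 1 / 2}" by auto
    then show "infinite {k. code_weight s (pattern n (column Z k)) \<le> 1 / 2}"
      using False infinite_super by blast
  qed (auto simp: code_weight_bounds)
  then show ?thesis using False s by (simp add: code_def)
qed

lemma finite_support_measurable[measurable]: "Measurable.pred matrix_space (\<lambda>Z. finite (support n Z))"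
  unfolding finite_nat_set_iff_bounded mem_Collect_eq Ball_def by measurable

lemma code_measurable[measurable]: "code n \<in> measurable matrix_space (count_space UNIV)"
proof -
  have [measurable]: "(\<lambda>Z. pattern_count n Z v) \<in> measurable matrix_space (count_space UNIV)" for v
    unfolding pattern_count_def by measurable
  have [measurable]: "(\<lambda>Z. \<Prod>v\<in>A. prime_code v ^ pattern_count n Z v) \<in> measurable matrix_space (count_space UNIV)" if "finite A" for A
    using that by induction simp_all
  show ?thesis unfolding code_def by measurable
qed

text \<open>A law on the positive integers is determined by the negative moments: the smallest integer with different
  probabilities dominates as \<open>s\<close> grows.  The value \<open>0\<close> contributes nothing since \<open>1 / 0 = 0\<close>.\<close>

lemma inverse_moments_unique:
  fixes P Q :: "nat measure"
  assumes P: "prob_space P" "sets P = UNIV" and Q: "prob_space Q" "sets Q = UNIV"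
    and eq: "\<And>s. 1 \<le> s \<Longrightarrow> (\<integral>\<^sup>+x. ennreal ((1 / real x) ^ s) \<partial>P) = (\<integral>\<^sup>+x. ennreal ((1 / real x) ^ s) \<partial>Q)"
  shows "P = Q"
proof -
  \<comment> \<open>The contribution of values above \<open>m\<close> after scaling the moment by
    \<open>m ^ s\<close>. It tends to 0 with growing \<open>s\<close>, while the value
    \<open>m\<close> itself keeps the coefficient 1.\<close>
  let ?r = "\<lambda>P m s. (\<integral>x. indicator {m<..} x * (real m / real x) ^ s \<partial>P)"
  have meas: "f \<in> borel_measurable R" if "sets R = UNIV" for f :: "nat \<Rightarrow> real" and R :: "nat measure"
    by (rule measurableI) (auto simp: that)
  have decomp: "real m ^ s * enn2real (\<integral>\<^sup>+x. ennreal ((1 / real x) ^ s) \<partial>R) =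
      (\<Sum>y\<in>{1..m}. (real m / real y) ^ s * measure R {y}) + ?r R m s"
    and lim: "(\<lambda>s. ?r R m s) \<longlonglongrightarrow> 0"
    if R: "prob_space R" "sets R = UNIV" and s: "1 \<le> s" and m: "1 \<le> m" for R m s
  proof -
    interpret R: prob_space R by fact
    note [measurable] = meas[OF R(2)]
    have bound: "\<bar>indicator {m<..} x * (real m / real x) ^ s\<bar> \<le> 1" for x s
      using power_le_one[of "real m / real x" s] by (auto simp: indicator_def)
    have int: "integrable R (\<lambda>x. indicator {m<..} x * (real m / real x) ^ s)" for s
      using bound by (intro R.integrable_const_bound[where B=1]) auto
    have int': "integrable R (\<lambda>x. (real m / real y) ^ s * indicator {y} x)" for y
      using R(2) by (intro integrable_mult_right integrable_real_indicator) (auto simp: R.emeasure_eq_measure)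
    have pw: "real m ^ s * (1 / real x) ^ s =
      (\<Sum>y\<in>{1..m}. (real m / real y) ^ s * indicator {y} x) + indicator {m<..} x * (real m / real x) ^ s" for x
    proof (cases "x = 0")
      case True
      then have "(\<Sum>y\<in>{1..m}. (real m / real y) ^ s * indicator {y} x) = 0" by (intro sum.neutral) auto
      then show ?thesis using True s by simp
    next
      case x: False
      show ?thesis
      proof (cases "x \<le> m")
        case True
        have "(\<Sum>y\<in>{1..m}. (real m / real y) ^ s * indicator {y} x) = (\<Sum>y\<in>{1..m}. if y = x then (real m / real x) ^ s else 0)"
          by (intro sum.cong) auto
        also have "\<dots> = (real m / real x) ^ s" using True x by simp
        finally show ?thesis using True by (simp add: power_divide)
      next
        case False
        then have "(\<Sum>y\<in>{1..m}. (real m / real y) ^ s * indicator {y} x) = 0" by (intro sum.neutral) auto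
        then show ?thesis using False by (simp add: power_divide)
      qed
    qed
    have "enn2real (\<integral>\<^sup>+x. ennreal ((1 / real x) ^ s) \<partial>R) = (\<integral>x. (1 / real x) ^ s \<partial>R)"
      by (rule integral_eq_nn_integral[symmetric]) auto
    then have "real m ^ s * enn2real (\<integral>\<^sup>+x. ennreal ((1 / real x) ^ s) \<partial>R) = (\<integral>x. real m ^ s * (1 / real x) ^ s \<partial>R)"
      by simp
    also have "\<dots> = (\<Sum>y\<in>{1..m}. \<integral>x. (real m / real y) ^ s * indicator {y} x \<partial>R) + ?r R m s"
      unfolding pw
      by (subst Bochner_Integration.integral_add[OF Bochner_Integration.integrable_sum[OF int'] int],
          subst Bochner_Integration.integral_sum[OF int']) (rule refl)
    also have "(\<Sum>y\<in>{1..m}. \<integral>x. (real m / real y) ^ s * indicator {y} x \<partial>R) = (\<Sum>y\<in>{1..m}. (real m / real y) ^ s * measure R {y})"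
      using R(2) by (intro sum.cong refl) simp
    finally show "real m ^ s * enn2real (\<integral>\<^sup>+x. ennreal ((1 / real x) ^ s) \<partial>R) =
      (\<Sum>y\<in>{1..m}. (real m / real y) ^ s * measure R {y}) + ?r R m s" .
    have "(\<lambda>s. ?r R m s) \<longlonglongrightarrow> (\<integral>x. 0 \<partial>R)"
    proof (rule integral_dominated_convergence[where w="\<lambda>_. 1"])
      show "AE x in R. (\<lambda>s. indicator {m<..} x * (real m / real x) ^ s) \<longlonglongrightarrow> 0"
      proof (intro always_eventually allI)
        fix x
        show "(\<lambda>s. indicator {m<..} x * (real m / real x) ^ s) \<longlonglongrightarrow> 0"
          using tendsto_mult_right[OF LIMSEQ_realpow_zero[of "real m / real x"], of "indicator {m<..} x"]
          by (cases "m < x") auto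
      qed
      show "AE x in R. norm (indicator {m<..} x * (real m / real x) ^ s) \<le> 1" for s
        using bound by auto
    qed auto
    then show "(\<lambda>s. ?r R m s) \<longlonglongrightarrow> 0" by simp
  qed
  have pos: "measure P {m} = measure Q {m}" if "1 \<le> m" for m
    using that
  proof (induction m rule: less_induct)
    case (less m)
    \<comment> \<open>The values below \<open>m\<close> cancel by induction, so the difference of
      the two remainders does not depend on \<open>s\<close>; its limit 0 is therefore its
      value.\<close>
    have diff: "measure P {m} - measure Q {m} = ?r Q m s - ?r P m s" if s: "1 \<le> s" for s
    proof -
      have split: "(\<Sum>y\<in>{1..m}. f y) = (\<Sum>y\<in>{1..<m}. f y) + f m" for f :: "nat \<Rightarrow> real"
        using less.prems by (metis One_nat_def Suc_pred atLeastLessThanSuc_atLeastAtMost less_le_trans sum.atLeastLessThan_Suc zero_less_one)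
      have "(\<Sum>y\<in>{1..<m}. (real m / real y) ^ s * measure P {y}) = (\<Sum>y\<in>{1..<m}. (real m / real y) ^ s * measure Q {y})"
        using less.IH by (intro sum.cong) auto
      then show ?thesis
        using decomp[OF P s less.prems] decomp[OF Q s less.prems] less.prems unfolding split eq[OF s] by simp
    qed
    have "\<forall>\<^sub>F s in sequentially. ?r Q m s - ?r P m s = measure P {m} - measure Q {m}"
      by (rule eventually_mono[OF eventually_ge_at_top[of 1]]) (simp only: diff)
    moreover have "(\<lambda>s. ?r Q m s - ?r P m s) \<longlonglongrightarrow> 0 - 0"
      using lim[OF Q order_refl less.prems] lim[OF P order_refl less.prems] by (rule tendsto_diff)
    ultimately have "(\<lambda>s. measure P {m} - measure Q {m}) \<longlonglongrightarrow> 0 - 0"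
      by (rule Lim_transform_eventually[rotated])
    then show ?case by (simp add: LIMSEQ_const_iff)
  qed
  \<comment> \<open>The moments are blind to the value 0, whose mass is recovered as the complement
    of all others.\<close>
  have zero: "measure R {0} = 1 - (\<Sum>i. measure R {Suc i})" if R: "prob_space R" "sets R = UNIV" for R :: "nat measure"
  proof -
    interpret R: prob_space R by fact
    have "(\<lambda>i. measure R {Suc i}) sums measure R (\<Union>i. {Suc i})"
      using R(2) by (intro R.finite_measure_UNION) (auto simp: disjoint_family_on_def)
    moreover have "(\<Union>i. {Suc i}) = space R - {0}"
    proof -
      have "(\<Union>i. {Suc i}) = - {0}" using not0_implies_Suc by auto
      then show ?thesis using sets_eq_imp_space_eq[of R "count_space UNIV"] R(2) by auto
    qed
    moreover have "measure R (space R - {0}) = 1 - measure R {0}"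
      using R(2) by (intro R.prob_compl) simp
    ultimately show ?thesis using sums_unique by fastforce
  qed
  interpret P: prob_space P by fact
  interpret Q: prob_space Q by fact
  show ?thesis
  proof (rule measure_eqI_countable[of _ UNIV])
    fix m :: nat
    have "measure P {m} = measure Q {m}"
      using pos[of m] zero[OF P] zero[OF Q] pos by (cases m) simp_all
    then show "emeasure P {m} = emeasure Q {m}" by (simp add: P.emeasure_eq_measure Q.emeasure_eq_measure)
  qed (use P Q in auto)
qed

subsection \<open>The left-ordered form\<close>

definition tail_count :: "nat \<Rightarrow> (nat \<Rightarrow> nat) \<Rightarrow> nat \<Rightarrow> nat" where
  "tail_count n c v = (\<Sum>w\<in>{v..<2 ^ n}. c w)"

text \<open>If \<open>c v\<close> columns have pattern \<open>v\<close>, then \<open>sorted_pattern n c k\<close> is entry \<open>k\<close> of the decreasing list of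
  these patterns, padded with zeros.\<close>

definition sorted_pattern :: "nat \<Rightarrow> (nat \<Rightarrow> nat) \<Rightarrow> nat \<Rightarrow> nat" where
  "sorted_pattern n c k = card {v \<in> {1..<2 ^ n}. k < tail_count n c v}"

text \<open>Row \<open>i\<close> consists of the last bits of the sorted patterns of
  \<open>Suc i\<close> rows. Each entry thus depends on a single code, which makes the map
  measurable; that successive rows fit together is a separate fact about codes of one
  matrix.\<close>

definition matrix_of_codes :: "(nat \<Rightarrow> nat) \<Rightarrow> binary_matrix" where
  "matrix_of_codes N = (\<lambda>i k. odd (sorted_pattern (Suc i) (\<lambda>v. multiplicity (prime_code v) (N (Suc i))) k))"

abbreviation left_ordered :: "binary_matrix \<Rightarrow> binary_matrix" where
  "left_ordered Z \<equiv> matrix_of_codes (\<lambda>n. code n Z)"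

definition locally_finite :: "binary_matrix \<Rightarrow> bool" where
  "locally_finite Z \<longleftrightarrow> (\<forall>n. finite (support n Z))"

abbreviation upper_columns :: "nat \<Rightarrow> binary_matrix \<Rightarrow> nat \<Rightarrow> nat set" where
  "upper_columns n Z v \<equiv> {k. v \<le> pattern n (column Z k)}"

text \<open>A downward closed subset of \<open>{1..<m}\<close> is an initial segment, so its
  cardinality decides membership.\<close>

lemma le_card_down_closed:
  fixes P :: "nat \<Rightarrow> bool"
  assumes anti: "\<And>v w. v \<le> w \<Longrightarrow> P w \<Longrightarrow> 1 \<le> v \<Longrightarrow> P v" and v: "v \<in> {1..<m}"
  shows "v \<le> card {w \<in> {1..<m}. P w} \<longleftrightarrow> P v"
proof
  assume "P v"
  then have "{1..v} \<subseteq> {w \<in> {1..<m}. P w}" using v anti by auto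
  from card_mono[OF _ this] show "v \<le> card {w \<in> {1..<m}. P w}" by simp
next
  assume le: "v \<le> card {w \<in> {1..<m}. P w}"
  show "P v"
  proof (rule ccontr)
    assume "\<not> P v"
    then have "{w \<in> {1..<m}. P w} \<subseteq> {1..<v}" using v anti[of v] by (auto simp: not_le[symmetric])
    from card_mono[OF _ this] have "card {w \<in> {1..<m}. P w} \<le> v - 1" by simp
    then show False using le v unfolding atLeastLessThan_iff by linarith
  qed
qed

lemma tail_count_eq_card:
  assumes fin: "finite (support n Z)" and v: "1 \<le> v"
    and c: "\<And>w. w \<in> {1..<2 ^ n} \<Longrightarrow> c w = pattern_count n Z w"
  shows "tail_count n c v = card (upper_columns n Z v)"
proof -
  have "upper_columns n Z v = (\<Union>w\<in>{v..<2 ^ n}. {k. pattern n (column Z k) = w})"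
    using pattern_less by auto
  also have "card \<dots> = (\<Sum>w\<in>{v..<2 ^ n}. card {k. pattern n (column Z k) = w})"
  proof (rule card_UN_disjoint)
    show "\<forall>w\<in>{v..<2 ^ n}. finite {k. pattern n (column Z k) = w}"
      using v by (auto intro!: finite_subset[OF _ fin])
  qed auto
  also have "\<dots> = tail_count n c v"
    unfolding tail_count_def using v by (intro sum.cong refl) (simp add: c pattern_count_def)
  finally show ?thesis ..
qed

text \<open>The usual duality between a decreasing rearrangement and its conjugate partition.
  Everything about the sorted list is proved by comparing lower bounds through it.\<close>

lemma le_sorted_pattern_iff:
  assumes fin: "finite (support n Z)" and v: "1 \<le> v"
    and c: "\<And>w. w \<in> {1..<2 ^ n} \<Longrightarrow> c w = pattern_count n Z w"
  shows "v \<le> sorted_pattern n c k \<longleftrightarrow> k < card (upper_columns n Z v)"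
proof (cases "v < 2 ^ n")
  case True
  have "sorted_pattern n c k = card {w \<in> {1..<2 ^ n}. k < card (upper_columns n Z w)}"
    unfolding sorted_pattern_def using tail_count_eq_card[OF fin _ c] by (intro arg_cong[where f=card]) auto
  moreover have "v \<le> card {w \<in> {1..<2 ^ n}. k < card (upper_columns n Z w)} \<longleftrightarrow> k < card (upper_columns n Z v)"
  proof (rule le_card_down_closed)
    fix a b assume ab: "a \<le> b" "k < card (upper_columns n Z b)" "1 \<le> a"
    have "card (upper_columns n Z b) \<le> card (upper_columns n Z a)"
      using ab by (intro card_mono finite_subset[OF _ fin]) auto
    then show "k < card (upper_columns n Z a)" using ab by simp
  qed (use True v in auto)
  ultimately show ?thesis by simp
next
  case False
  then have "pattern n (column Z k) < v" for k using pattern_less[of n "column Z k"] by linarith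
  then have "upper_columns n Z v = {}" by (auto simp: not_le)
  moreover have "sorted_pattern n c k \<le> card {1..<2 ^ n :: nat}"
    unfolding sorted_pattern_def by (intro card_mono) auto
  then have "sorted_pattern n c k \<le> 2 ^ n - 1" by simp
  then have "sorted_pattern n c k < 2 ^ n" by (metis One_nat_def Suc_pred less_Suc_eq_le zero_less_numeral zero_less_power)
  ultimately show ?thesis using False by auto
qed

lemma eq_if_same_lower_bounds:
  fixes a b :: nat
  assumes "\<And>v. 1 \<le> v \<Longrightarrow> v \<le> a \<longleftrightarrow> v \<le> b"
  shows "a = b"
  using assms[of a] assms[of b] by (cases "a = 0"; cases "b = 0") auto

text \<open>Forgetting the last row halves every pattern. Halving is monotone, so it commutes with
  sorting, and the sorted lists for successive \<open>n\<close> extend one another row by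
  row.\<close>

lemma pattern_left_ordered:
  assumes fin: "locally_finite Z"
  shows "pattern n (column (left_ordered Z) k) = sorted_pattern n (pattern_count n Z) k"
proof (induction n)
  case 0
  show ?case by (simp add: sorted_pattern_def)
next
  case (Suc n)
  have f: "finite (support m Z)" for m using fin by (simp add: locally_finite_def)
  let ?L = "\<lambda>n. sorted_pattern n (pattern_count n Z) k"
  have half: "?L (Suc n) div 2 = ?L n"
  proof (rule eq_if_same_lower_bounds)
    fix v :: nat assume v: "1 \<le> v"
    have "v \<le> ?L (Suc n) div 2 \<longleftrightarrow> 2 * v \<le> ?L (Suc n)" by (simp add: less_eq_div_iff_mult_less_eq mult.commute)
    also have "\<dots> \<longleftrightarrow> k < card (upper_columns (Suc n) Z (2 * v))"
      using v by (intro le_sorted_pattern_iff[OF f]) auto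
    also have "upper_columns (Suc n) Z (2 * v) = upper_columns n Z v"
      by (auto simp: of_bool_def)
    also have "k < card (upper_columns n Z v) \<longleftrightarrow> v \<le> ?L n"
      by (rule le_sorted_pattern_iff[OF f v refl, symmetric])
    finally show "v \<le> ?L (Suc n) div 2 \<longleftrightarrow> v \<le> ?L n" .
  qed
  have "sorted_pattern (Suc n) (\<lambda>v. multiplicity (prime_code v) (code (Suc n) Z)) k = ?L (Suc n)"
  proof (rule eq_if_same_lower_bounds)
    fix v :: nat assume v: "1 \<le> v"
    show "v \<le> sorted_pattern (Suc n) (\<lambda>v. multiplicity (prime_code v) (code (Suc n) Z)) k \<longleftrightarrow> v \<le> ?L (Suc n)"
      by (rule trans[OF le_sorted_pattern_iff[OF f v multiplicity_code[OF f]] le_sorted_pattern_iff[OF f v refl, symmetric]])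
  qed
  then have "left_ordered Z n k \<longleftrightarrow> odd (?L (Suc n))" by (simp add: matrix_of_codes_def)
  then have "pattern (Suc n) (column (left_ordered Z) k) = 2 * (?L (Suc n) div 2) + of_bool (odd (?L (Suc n)))"
    using Suc half by simp
  also have "\<dots> = ?L (Suc n)" by simp
  finally show ?case .
qed

lemma finite_pattern_fibre:
  assumes "locally_finite Z" "0 < v"
  shows "finite {k. pattern n (column Z k) = v}"
proof (rule finite_subset)
  show "{k. pattern n (column Z k) = v} \<subseteq> support n Z" using assms(2) by (intro Collect_mono impI) simp
  show "finite (support n Z)" using assms(1) by (simp add: locally_finite_def)
qed

text \<open>In the sorted matrix the columns with pattern at least \<open>v\<close> form an initial
  segment of the same size as in the given matrix; a fibre is the difference of two such
  sets.\<close>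

lemma left_ordered_fibres:
  assumes fin: "locally_finite Z" and v: "0 < v"
  shows "finite {k. pattern n (column (left_ordered Z) k) = v}"
    and "card {k. pattern n (column (left_ordered Z) k) = v} = card {k. pattern n (column Z k) = v}"
proof -
  let ?X = "left_ordered Z"
  have f: "finite (support m Z)" for m using fin by (simp add: locally_finite_def)
  have up: "upper_columns n ?X w = {..<card (upper_columns n Z w)}" if "1 \<le> w" for w
    using le_sorted_pattern_iff[OF f that refl] by (auto simp: pattern_left_ordered[OF fin])
  have fin_up: "finite (upper_columns n Z w)" if "1 \<le> w" for w
    using that by (intro finite_subset[OF _ f[of n]]) auto
  have diff: "{k. pattern n (column Y k) = v} = upper_columns n Y v - upper_columns n Y (Suc v)" for Y by auto
  have card: "card {k. pattern n (column Y k) = v} = card (upper_columns n Y v) - card (upper_columns n Y (Suc v))"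
    if "finite (upper_columns n Y v)" for Y
    unfolding diff using that by (intro card_Diff_subset finite_subset[OF _ that]) auto
  show "finite {k. pattern n (column ?X k) = v}" unfolding diff using v up[of v] by simp
  show "card {k. pattern n (column ?X k) = v} = card {k. pattern n (column Z k) = v}"
    using v by (subst (1 2) card) (simp_all add: up fin_up)
qed

text \<open>The columns that agree with \<open>x\<close> on the first \<open>n\<close> rows decrease
  to the columns equal to \<open>x\<close>. Once a row with \<open>x i\<close> is included these
  sets are finite, so they become constant.\<close>

lemma ex_column_fibre:
  assumes fin: "\<And>n v. 0 < v \<Longrightarrow> finite {k. pattern n (column Z k) = v}" and x: "x i"
  shows "\<exists>n0. \<forall>n\<ge>n0. i < n \<and> {k. pattern n (column Z k) = pattern n x} = {k. column Z k = x}"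
proof -
  let ?S = "\<lambda>n. {k. pattern n (column Z k) = pattern n x}"
  have S: "?S n = {k. \<forall>i<n. Z i k = x i}" for n by (simp add: pattern_eq_iff)
  have "0 < pattern (Suc i) x" unfolding pattern_pos_iff using x by blast
  then have finS: "finite (?S (Suc i))" by (rule fin)
  have "\<exists>n. k \<notin> ?S n" if "column Z k \<noteq> x" for k
  proof -
    obtain l where "Z l k \<noteq> x l" using \<open>column Z k \<noteq> x\<close> by blast
    then have "k \<notin> ?S (Suc l)" unfolding S by blast
    then show ?thesis by blast
  qed
  moreover define m where "m k = (SOME n. k \<notin> ?S n)" for k
  ultimately have m: "k \<notin> ?S (m k)" if "column Z k \<noteq> x" for k
    unfolding m_def using that by (intro someI_ex[of "\<lambda>n. k \<notin> ?S n"])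
  \<comment> \<open>Large enough for each of the finitely many candidates left after row
    \<open>i\<close> that differs from \<open>x\<close> to have been separated from it.\<close>
  define n0 where "n0 = Max (insert (Suc i) (m ` ?S (Suc i)))"
  have n0: "Suc i \<le> n0" "\<And>k. k \<in> ?S (Suc i) \<Longrightarrow> m k \<le> n0"
    unfolding n0_def using finS by (auto intro!: Max_ge)
  have "i < n \<and> ?S n = {k. column Z k = x}" if n: "n0 \<le> n" for n
  proof
    show "i < n" using n n0 by simp
    show "?S n = {k. column Z k = x}"
    proof (intro set_eqI iffI)
      fix k assume k: "k \<in> ?S n"
      then have "k \<in> ?S (Suc i)" unfolding S using n n0(1) by auto
      then have "m k \<le> n" using n0(2) n le_trans by blast
      then have "k \<in> ?S (m k)" using k unfolding S by auto
      then show "k \<in> {k. column Z k = x}" using m[of k] by (intro CollectI) (rule ccontr, simp only: simp_thms)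
    qed simp
  qed
  then show ?thesis by (intro exI[of _ n0] allI impI)
qed

lemma bij_betw_fibres:
  assumes "\<And>x. finite {a \<in> A. f a = x}" "\<And>x. finite {b \<in> B. g b = x}"
    and "\<And>x. card {a \<in> A. f a = x} = card {b \<in> B. g b = x}"
  shows "\<exists>\<pi>. bij_betw \<pi> A B \<and> (\<forall>a\<in>A. g (\<pi> a) = f a)"
proof -
  have ex: "\<exists>h. bij_betw h {a \<in> A. f a = x} {b \<in> B. g b = x}" for x
    using assms by (intro finite_same_card_bij)
  define h where "h x = (SOME h. bij_betw h {a \<in> A. f a = x} {b \<in> B. g b = x})" for x
  have h: "bij_betw (h x) {a \<in> A. f a = x} {b \<in> B. g b = x}" for x
    unfolding h_def by (rule someI_ex[OF ex])
  have img: "h (f a) a \<in> B" "g (h (f a) a) = f a" if "a \<in> A" for a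
    using bij_betwE[OF h[of "f a"]] that by auto
  have "bij_betw (\<lambda>a. h (f a) a) A B"
  proof (rule bij_betwI')
    fix a b assume ab: "a \<in> A" "b \<in> A"
    show "h (f a) a = h (f b) b \<longleftrightarrow> a = b"
    proof
      assume eq: "h (f a) a = h (f b) b"
      then have "f a = f b" using img(2)[OF ab(1)] img(2)[OF ab(2)] by simp
      then show "a = b" using eq ab bij_betw_imp_inj_on[OF h[of "f b"]] by (auto dest: inj_onD)
    qed simp
  next
    fix b assume "b \<in> B"
    then have "b \<in> h (g b) ` {a \<in> A. f a = g b}" using bij_betw_imp_surj_on[OF h[of "g b"]] by auto
    then obtain a where a: "a \<in> A" "f a = g b" "b = h (g b) a" by auto
    then have "b = h (f a) a" by simp
    then show "\<exists>a\<in>A. b = h (f a) a" using a(1) by (rule bexI)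
  qed (use img in auto)
  then show ?thesis using img by blast
qed

lemma matrix_equivI:
  assumes "bij_betw \<pi> (nonzero_columns Z) (nonzero_columns W)"
    and "\<And>k i. k \<in> nonzero_columns Z \<Longrightarrow> W i (\<pi> k) = Z i k"
  shows "(Z, W) \<in> matrix_equiv"
  unfolding matrix_equiv_def mem_Collect_eq case_prod_conv
  by (rule exI[of _ \<pi>], rule conjI[OF assms(1)], rule ballI, rule allI, rule assms(2))

lemma matrix_equivE:
  assumes "(Z, W) \<in> matrix_equiv"
  obtains \<pi> where "bij_betw \<pi> (nonzero_columns Z) (nonzero_columns W)"
    "\<forall>k\<in>nonzero_columns Z. \<forall>i. W i (\<pi> k) = Z i k"
  using assms unfolding matrix_equiv_def mem_Collect_eq case_prod_conv by (elim exE conjE)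

text \<open>A full column has infinitely many entries, so its multiplicity is not directly visible
  in any code. It equals the multiplicity of a sufficiently long initial pattern, for which both
  matrices agree; bijections between the finite fibres are then glued.\<close>

theorem left_ordered_equiv:
  assumes fin: "locally_finite Z"
  shows "(Z, left_ordered Z) \<in> matrix_equiv"
proof -
  let ?X = "left_ordered Z"
  have fibres: "finite {k. column Z k = x}" "finite {k. column ?X k = x}"
    "card {k. column Z k = x} = card {k. column ?X k = x}" if x: "x i" for x i
  proof -
    obtain n1 where n1: "\<forall>n\<ge>n1. i < n \<and> {k. pattern n (column Z k) = pattern n x} = {k. column Z k = x}"
      using ex_column_fibre[of Z x i, OF finite_pattern_fibre[OF fin] x] by (rule exE)
    obtain n2 where n2: "\<forall>n\<ge>n2. i < n \<and> {k. pattern n (column ?X k) = pattern n x} = {k. column ?X k = x}"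
      using ex_column_fibre[of ?X x i, OF left_ordered_fibres(1)[OF fin] x] by (rule exE)
    \<comment> \<open>Beyond both thresholds the fibres of the two matrices have stabilised, so one
      common \<open>n\<close> can be used for the comparison.\<close>
    define n where "n = max n1 n2"
    have eq: "{k. column Z k = x} = {k. pattern n (column Z k) = pattern n x}"
        "{k. column ?X k = x} = {k. pattern n (column ?X k) = pattern n x}" and "i < n"
      using n1[rule_format, of n] n2[rule_format, of n] by (simp_all only: n_def max.cobounded1 max.cobounded2 simp_thms)
    then have pos: "0 < pattern n x" unfolding pattern_pos_iff using x by blast
    show "finite {k. column Z k = x}" unfolding eq by (rule finite_pattern_fibre[OF fin pos])
    show "finite {k. column ?X k = x}" unfolding eq by (rule left_ordered_fibres(1)[OF fin pos])
    show "card {k. column Z k = x} = card {k. column ?X k = x}"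
      unfolding eq by (rule left_ordered_fibres(2)[OF fin pos, symmetric])
  qed
  have nonzero_iff: "k \<in> nonzero_columns Y \<longleftrightarrow> (\<exists>i. x i)" if "column Y k = x" for Y k x
    unfolding nonzero_columns_def mem_Collect_eq that[symmetric] ..
  have fibre: "{k \<in> nonzero_columns Y. column Y k = x} = {k. column Y k = x}" if "\<exists>i. x i" for Y x
  proof (rule Collect_cong)
    fix k
    show "(k \<in> nonzero_columns Y \<and> column Y k = x) = (column Y k = x)"
    proof (cases "column Y k = x")
      case True
      then show ?thesis using nonzero_iff[of Y k x, OF True] that by (simp only: simp_thms)
    next
      case False
      then show ?thesis by (simp only: simp_thms)
    qed
  qed
  have fibre': "{k \<in> nonzero_columns Y. column Y k = x} = {}" if "\<not> (\<exists>i. x i)" for Y x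
    unfolding Collect_empty_eq
  proof (rule allI)
    fix k
    show "\<not> (k \<in> nonzero_columns Y \<and> column Y k = x)"
    proof
      assume k: "k \<in> nonzero_columns Y \<and> column Y k = x"
      then show False using nonzero_iff[of Y k x, OF conjunct2[OF k]] that by (simp only: simp_thms)
    qed
  qed
  have "\<exists>\<pi>. bij_betw \<pi> (nonzero_columns Z) (nonzero_columns ?X) \<and> (\<forall>k\<in>nonzero_columns Z. column ?X (\<pi> k) = column Z k)"
  proof (rule bij_betw_fibres)
    fix x
    show "finite {k \<in> nonzero_columns Z. column Z k = x}"
    proof (cases "\<exists>i. x i")
      case True
      then obtain i where "x i" ..
      then show ?thesis unfolding fibre[OF True] by (rule fibres(1))
    next
      case False
      show ?thesis unfolding fibre'[OF False] by (rule finite.emptyI)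
    qed
    show "finite {k \<in> nonzero_columns ?X. column ?X k = x}"
    proof (cases "\<exists>i. x i")
      case True
      then obtain i where "x i" ..
      then show ?thesis unfolding fibre[OF True] by (rule fibres(2))
    next
      case False
      show ?thesis unfolding fibre'[OF False] by (rule finite.emptyI)
    qed
    show "card {k \<in> nonzero_columns Z. column Z k = x} = card {k \<in> nonzero_columns ?X. column ?X k = x}"
    proof (cases "\<exists>i. x i")
      case True
      then obtain i where "x i" ..
      then show ?thesis unfolding fibre[OF True] by (rule fibres(3))
    next
      case False
      show ?thesis unfolding fibre'[OF False] ..
    qed
  qed
  then obtain \<pi> where \<pi>: "bij_betw \<pi> (nonzero_columns Z) (nonzero_columns ?X)"
    "\<forall>k\<in>nonzero_columns Z. column ?X (\<pi> k) = column Z k" by (elim exE conjE)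
  have "?X i (\<pi> k) = Z i k" if "k \<in> nonzero_columns Z" for i k
    using fun_cong[OF bspec[OF \<pi>(2) that], of i] .
  then show ?thesis by (rule matrix_equivI[OF \<pi>(1)])
qed

section \<open>The equivalence relation, and measurability of classes and representatives\<close>

lemma equiv_matrix_equiv: "equiv UNIV matrix_equiv"
proof (rule equivI)
  show "matrix_equiv \<subseteq> UNIV \<times> UNIV" by simp
  show "refl matrix_equiv"
  proof (rule refl_onI)
    show "(Z, Z) \<in> matrix_equiv" for Z
      by (rule matrix_equivI[of id]) (simp_all add: bij_betw_id)
  qed
  show "sym matrix_equiv"
  proof (rule symI)
    fix Z W assume "(Z, W) \<in> matrix_equiv"
    then obtain \<pi> where \<pi>: "bij_betw \<pi> (nonzero_columns Z) (nonzero_columns W)"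
      "\<forall>k\<in>nonzero_columns Z. \<forall>i. W i (\<pi> k) = Z i k" by (rule matrix_equivE)
    let ?\<rho> = "inv_into (nonzero_columns Z) \<pi>"
    have bij: "bij_betw ?\<rho> (nonzero_columns W) (nonzero_columns Z)" by (rule bij_betw_inv_into[OF \<pi>(1)])
    show "(W, Z) \<in> matrix_equiv"
    proof (rule matrix_equivI[OF bij])
      fix k i assume k: "k \<in> nonzero_columns W"
      show "Z i (?\<rho> k) = W i k"
        using \<pi>(2)[rule_format, OF bij_betw_apply[OF bij k], of i] unfolding bij_betw_inv_into_right[OF \<pi>(1) k] by (rule sym)
    qed
  qed
  show "trans matrix_equiv"
  proof (rule transI)
    fix X Y Z assume XY: "(X, Y) \<in> matrix_equiv" and YZ: "(Y, Z) \<in> matrix_equiv"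
    obtain \<pi> where \<pi>: "bij_betw \<pi> (nonzero_columns X) (nonzero_columns Y)"
      "\<forall>k\<in>nonzero_columns X. \<forall>i. Y i (\<pi> k) = X i k" using XY by (rule matrix_equivE)
    obtain \<rho> where \<rho>: "bij_betw \<rho> (nonzero_columns Y) (nonzero_columns Z)"
      "\<forall>k\<in>nonzero_columns Y. \<forall>i. Z i (\<rho> k) = Y i k" using YZ by (rule matrix_equivE)
    show "(X, Z) \<in> matrix_equiv"
    proof (rule matrix_equivI[OF bij_betw_trans[OF \<pi>(1) \<rho>(1)]])
      fix k i assume k: "k \<in> nonzero_columns X"
      show "Z i ((\<rho> \<circ> \<pi>) k) = X i k"
        unfolding o_apply \<rho>(2)[rule_format, OF bij_betw_apply[OF \<pi>(1) k]] by (rule \<pi>(2)[rule_format, OF k])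
    qed
  qed
qed

lemma matrix_class_left_ordered: "locally_finite Z \<Longrightarrow> matrix_class (left_ordered Z) = matrix_class Z"
  unfolding matrix_class_def
  by (rule equiv_class_eq[OF equiv_matrix_equiv left_ordered_equiv, symmetric])

lemma matrix_class_measurable[measurable]: "matrix_class \<in> measurable matrix_space class_space"
  unfolding class_space_def
proof (rule measurable_measure_of)
  show "matrix_class \<in> space matrix_space \<rightarrow> UNIV // matrix_equiv"
    unfolding matrix_class_def by (intro Pi_I quotientI UNIV_I)
next
  fix A assume "A \<in> {A. A \<subseteq> UNIV // matrix_equiv \<and> matrix_class -` A \<in> sets matrix_space}"
  then show "matrix_class -` A \<inter> space matrix_space \<in> sets matrix_space" by simp
next
  show "{A. A \<subseteq> UNIV // matrix_equiv \<and> matrix_class -` A \<in> sets matrix_space} \<subseteq> Pow (UNIV // matrix_equiv)"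
    by (simp only: Collect_mono_iff Pow_def) simp
qed

lemma matrix_of_codes_measurable[measurable]:
  "matrix_of_codes \<in> measurable (PiM UNIV (\<lambda>_. count_space UNIV)) matrix_space"
  unfolding matrix_space_def
proof (rule measurable_PiM_single', goal_cases)
  case (1 i)
  show ?case
  proof (rule measurable_PiM_single', goal_cases)
    case (1 k)
    have "(\<lambda>N. matrix_of_codes N i k) = (\<lambda>c. odd (sorted_pattern (Suc i) (\<lambda>v. multiplicity (prime_code v) c) k)) \<circ> (\<lambda>N. N (Suc i))"
      by (simp add: matrix_of_codes_def fun_eq_iff)
    also have "\<dots> \<in> measurable (PiM UNIV (\<lambda>_. count_space UNIV)) (count_space UNIV)"
      by (rule measurable_comp[OF measurable_component_singleton]) auto
    finally show ?case .
  qed (auto simp: space_PiM)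
qed (auto simp: space_PiM)

subsection \<open>Equality in law of the equivalence classes\<close>

text \<open>Merges the patterns of \<open>n\<close> rows that share their first \<open>m\<close>
  rows, by dividing off the last \<open>n - m\<close> bits; patterns whose first \<open>m\<close>
  rows vanish are dropped.\<close>

definition reduce_code :: "nat \<Rightarrow> nat \<Rightarrow> nat \<Rightarrow> nat" where
  "reduce_code m n N = (\<Prod>v\<in>{1..<2 ^ m}. prime_code v ^
     (\<Sum>w\<in>{w \<in> {1..<2 ^ n}. w div 2 ^ (n - m) = v}. multiplicity (prime_code w) N))"

lemma pattern_div: "m \<le> n \<Longrightarrow> pattern n x div 2 ^ (n - m) = pattern m x"
proof (induction n rule: dec_induct)
  case (step n)
  have "pattern (Suc n) x div 2 ^ (Suc n - m) = pattern (Suc n) x div 2 div 2 ^ (n - m)"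
    using step(1) by (simp only: Suc_diff_le power_Suc div_mult2_eq)
  also have "pattern (Suc n) x div 2 = pattern n x" by simp
  finally show ?case using step by simp
qed simp

lemma support_mono: "m \<le> n \<Longrightarrow> support m Z \<subseteq> support n Z"
  unfolding pattern_pos_iff using less_le_trans by (intro Collect_mono impI) blast

lemma code_eq_reduce_code:
  assumes mn: "m \<le> n" and fin: "finite (support n Z)"
  shows "code m Z = reduce_code m n (code n Z)"
proof -
  have fin': "finite (support m Z)" using support_mono[OF mn] fin by (rule finite_subset)
  have "pattern_count m Z v = (\<Sum>w\<in>{w \<in> {1..<2 ^ n}. w div 2 ^ (n - m) = v}. multiplicity (prime_code w) (code n Z))"
    if v: "v \<in> {1..<2 ^ m}" for v
  proof -
    let ?A = "{w \<in> {1..<2 ^ n}. w div 2 ^ (n - m) = v}"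
    have "{k. pattern m (column Z k) = v} = (\<Union>w\<in>?A. {k. pattern n (column Z k) = w})"
    proof (intro set_eqI iffI)
      fix k assume "k \<in> {k. pattern m (column Z k) = v}"
      then have "pattern n (column Z k) div 2 ^ (n - m) = v" using pattern_div[OF mn, of "column Z k"] by simp
      moreover have "pattern n (column Z k) \<noteq> 0"
      proof
        assume "pattern n (column Z k) = 0"
        then have "v = 0" using calculation by simp
        then show False using v by simp
      qed
      ultimately show "k \<in> (\<Union>w\<in>?A. {k. pattern n (column Z k) = w})"
        using pattern_less[of n "column Z k"] by (simp add: Suc_le_eq)
    next
      fix k assume "k \<in> (\<Union>w\<in>?A. {k. pattern n (column Z k) = w})"
      then have "pattern n (column Z k) div 2 ^ (n - m) = v" by simp
      then show "k \<in> {k. pattern m (column Z k) = v}" using pattern_div[OF mn, of "column Z k"] by simp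
    qed
    then have "pattern_count m Z v = card (\<Union>w\<in>?A. {k. pattern n (column Z k) = w})"
      by (simp only: pattern_count_def)
    also have "\<dots> = (\<Sum>w\<in>?A. card {k. pattern n (column Z k) = w})"
    proof (rule card_UN_disjoint)
      show "\<forall>w\<in>?A. finite {k. pattern n (column Z k) = w}"
      proof
        fix w assume "w \<in> ?A"
        then have "{k. pattern n (column Z k) = w} \<subseteq> support n Z" by (intro Collect_mono impI) simp
        then show "finite {k. pattern n (column Z k) = w}" using fin by (rule finite_subset)
      qed
    qed auto
    also have "\<dots> = (\<Sum>w\<in>?A. multiplicity (prime_code w) (code n Z))"
      by (intro sum.cong refl) (simp add: multiplicity_code[OF fin] pattern_count_def)
    finally show ?thesis .
  qed
  then show ?thesis using fin' by (simp add: code_def reduce_code_def)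
qed

definition codes :: "binary_matrix \<Rightarrow> nat \<Rightarrow> nat" where
  "codes Z = (\<lambda>n. code n Z)"

lemma codes_measurable[measurable]: "codes \<in> measurable matrix_space (PiM UNIV (\<lambda>_. count_space UNIV))"
  unfolding codes_def by (rule measurable_PiM_single') (auto simp: space_PiM)

text \<open>For locally finite matrices the earlier codes are functions of the last one, so a
  cylinder event over several codes becomes an event about a single code. This is what makes
  one-dimensional laws sufficient.\<close>

lemma emeasure_codes_cylinder:
  fixes A :: "nat \<Rightarrow> nat set"
  assumes [measurable]: "X \<in> measurable R matrix_space" and fin: "AE \<omega> in R. locally_finite (X \<omega>)"
    and J: "finite J" "\<And>i. i \<in> J \<Longrightarrow> i \<le> n"
  shows "emeasure (distr R (PiM UNIV (\<lambda>_. count_space UNIV)) (\<lambda>\<omega>. codes (X \<omega>))) (prod_emb UNIV (\<lambda>_. count_space UNIV) J (Pi\<^sub>E J A)) =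
    emeasure (distr R (count_space UNIV) (\<lambda>\<omega>. code n (X \<omega>))) {c. \<forall>i\<in>J. reduce_code i n c \<in> A i}"
    (is "emeasure (distr R ?P _) ?E = emeasure _ ?C")
proof -
  have E: "?E \<in> sets ?P" using J by (intro sets_PiM_I) auto
  have memE: "x \<in> ?E \<longleftrightarrow> (\<forall>i\<in>J. x i \<in> A i)" for x :: "nat \<Rightarrow> nat"
    by (auto simp: prod_emb_def)
  have "emeasure (distr R ?P (\<lambda>\<omega>. codes (X \<omega>))) ?E = emeasure R ((\<lambda>\<omega>. codes (X \<omega>)) -` ?E \<inter> space R)"
    using E by (intro emeasure_distr) auto
  also have "\<dots> = emeasure R ((\<lambda>\<omega>. code n (X \<omega>)) -` ?C \<inter> space R)"
  proof (rule emeasure_eq_AE)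
    show "AE \<omega> in R. \<omega> \<in> (\<lambda>\<omega>. codes (X \<omega>)) -` ?E \<inter> space R \<longleftrightarrow> \<omega> \<in> (\<lambda>\<omega>. code n (X \<omega>)) -` ?C \<inter> space R"
      using fin
    proof eventually_elim
      fix \<omega> assume "locally_finite (X \<omega>)"
      then have "finite (support n (X \<omega>))" by (simp add: locally_finite_def)
      then have "code i (X \<omega>) = reduce_code i n (code n (X \<omega>))" if "i \<in> J" for i
        using J(2)[OF that] by (intro code_eq_reduce_code)
      then show "\<omega> \<in> (\<lambda>\<omega>. codes (X \<omega>)) -` ?E \<inter> space R \<longleftrightarrow> \<omega> \<in> (\<lambda>\<omega>. code n (X \<omega>)) -` ?C \<inter> space R"
        by (simp add: memE codes_def)
    qed
    show "(\<lambda>\<omega>. codes (X \<omega>)) -` ?E \<inter> space R \<in> sets R"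
      using E by (intro measurable_sets[of _ R ?P]) auto
    show "(\<lambda>\<omega>. code n (X \<omega>)) -` ?C \<inter> space R \<in> sets R"
      by (rule measurable_sets[of _ R "count_space UNIV"]) auto
  qed
  also have "\<dots> = emeasure (distr R (count_space UNIV) (\<lambda>\<omega>. code n (X \<omega>))) ?C"
    by (rule emeasure_distr[symmetric]) auto
  finally show ?thesis .
qed

lemma codes_law_eqI:
  assumes M: "prob_space M"
    and Z[measurable]: "Z \<in> measurable M matrix_space" and W: "W \<in> measurable N matrix_space"
    and fin: "AE \<omega> in M. locally_finite (Z \<omega>)" "AE \<omega> in N. locally_finite (W \<omega>)"
    and law: "\<And>n. 1 \<le> n \<Longrightarrow> distr M (count_space UNIV) (\<lambda>\<omega>. code n (Z \<omega>)) = distr N (count_space UNIV) (\<lambda>\<omega>. code n (W \<omega>))"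
  shows "distr M (PiM UNIV (\<lambda>_. count_space UNIV)) (\<lambda>\<omega>. codes (Z \<omega>)) =
    distr N (PiM UNIV (\<lambda>_. count_space UNIV)) (\<lambda>\<omega>. codes (W \<omega>))"
proof (rule measure_eqI_PiM_infinite)
  fix A :: "nat \<Rightarrow> nat set" and J :: "nat set" assume J: "finite J"
  \<comment> \<open>The element 1 is inserted because the laws of the codes are compared for at
    least one row, and it covers an empty \<open>J\<close>.\<close>
  define n where "n = Max (insert 1 J)"
  have n: "1 \<le> n" "\<And>i. i \<in> J \<Longrightarrow> i \<le> n" using J by (auto simp: n_def)
  show "emeasure (distr M (PiM UNIV (\<lambda>_. count_space UNIV)) (\<lambda>\<omega>. codes (Z \<omega>))) (prod_emb UNIV (\<lambda>_. count_space UNIV) J (Pi\<^sub>E J A)) =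
    emeasure (distr N (PiM UNIV (\<lambda>_. count_space UNIV)) (\<lambda>\<omega>. codes (W \<omega>))) (prod_emb UNIV (\<lambda>_. count_space UNIV) J (Pi\<^sub>E J A))"
    by (simp only: emeasure_codes_cylinder[OF Z fin(1) J n(2)] emeasure_codes_cylinder[OF W fin(2) J n(2)] law[OF n(1)])
next
  interpret M: prob_space M by (rule M)
  show "finite_measure (distr M (PiM UNIV (\<lambda>_. count_space UNIV)) (\<lambda>\<omega>. codes (Z \<omega>)))"
    by (rule M.finite_measure_distr) measurable
qed simp_all

text \<open>Almost surely the class is a measurable function of the codes, so its law is an image of
  theirs and the quotient sigma-algebra never has to be described by generators.\<close>

lemma distr_matrix_class:
  assumes [measurable]: "Z \<in> measurable M matrix_space" and fin: "AE \<omega> in M. locally_finite (Z \<omega>)"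
  shows "distr M class_space (\<lambda>\<omega>. matrix_class (Z \<omega>)) =
    distr (distr M (PiM UNIV (\<lambda>_. count_space UNIV)) (\<lambda>\<omega>. codes (Z \<omega>))) class_space (\<lambda>N. matrix_class (matrix_of_codes N))"
proof -
  have "distr M class_space (\<lambda>\<omega>. matrix_class (Z \<omega>)) = distr M class_space (\<lambda>\<omega>. matrix_class (matrix_of_codes (codes (Z \<omega>))))"
  proof (rule distr_cong_AE)
    show "AE \<omega> in M. matrix_class (Z \<omega>) = matrix_class (matrix_of_codes (codes (Z \<omega>)))"
      using fin by eventually_elim (simp add: codes_def matrix_class_left_ordered)
  qed simp_all
  also have "\<dots> = distr (distr M (PiM UNIV (\<lambda>_. count_space UNIV)) (\<lambda>\<omega>. codes (Z \<omega>))) class_space (\<lambda>N. matrix_class (matrix_of_codes N))"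
    by (subst distr_distr) (simp_all add: o_def)
  finally show ?thesis .
qed

section \<open>Comparison of the urn scheme with the feature model\<close>

context BFRY_urn_params
begin

text \<open>Almost surely exactly one \<open>j\<close> contributes to the sum of the restricted
  weights, and there the infinite product reduces to its first \<open>j\<close> factors because
  \<open>u 0 = 1\<close>.\<close>

lemma nn_integral_pattern_weights:
  assumes n: "1 \<le> n" and u: "\<And>v. 0 \<le> u v" "\<And>v. u v \<le> 1" "u 0 = 1"
  shows "(\<integral>\<^sup>+\<omega>. (INF m. ennreal (\<Prod>k<m. u (pattern n (column (Z \<omega>) k)))) \<partial>M) =
    (\<integral>\<^sup>+z. ennreal (exp (- (total_weight \<alpha> \<theta> n (\<lambda>_. 1) - total_weight \<alpha> \<theta> n u) * z)) \<partial>BFRY \<sigma>)"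
proof -
  have "(\<integral>\<^sup>+\<omega>. (INF m. ennreal (\<Prod>k<m. u (pattern n (column (Z \<omega>) k)))) \<partial>M) =
    (\<integral>\<^sup>+\<omega>. (\<Sum>j. initial_weight n u j (Z \<omega>)) \<partial>M)"
    using AE_ex_initial_support[OF n]
  proof (intro nn_integral_cong_AE, eventually_elim)
    fix \<omega> assume "\<exists>j. initial_support n j (Z \<omega>)"
    then obtain i where i: "initial_support n i (Z \<omega>)" ..
    then have iff: "initial_support n j (Z \<omega>) \<longleftrightarrow> j = i" for j using initial_support_unique by blast
    have "(\<Sum>j. initial_weight n u j (Z \<omega>)) = (\<Sum>j\<in>{i}. initial_weight n u j (Z \<omega>))"
      by (rule suminf_finite) (simp_all add: initial_weight_def iff)
    also have "\<dots> = ennreal (\<Prod>k<i. u (pattern n (column (Z \<omega>) k)))"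
      using i by (simp add: initial_weight_def)
    also have "\<dots> = (INF m. ennreal (\<Prod>k<m. u (pattern n (column (Z \<omega>) k))))"
    proof (rule INF_prod_finite[symmetric])
      fix k assume "k \<notin> {..<i}"
      then have "pattern n (column (Z \<omega>) k) = 0"
        using i[unfolded initial_support_def, rule_format, of k] by simp
      then show "u (pattern n (column (Z \<omega>) k)) = 1" by (simp only: u(3))
    qed (simp_all add: u)
    finally show "(INF m. ennreal (\<Prod>k<m. u (pattern n (column (Z \<omega>) k)))) = (\<Sum>j. initial_weight n u j (Z \<omega>))" by (rule sym)
  qed
  also have "\<dots> = (\<Sum>j. \<integral>\<^sup>+\<omega>. initial_weight n u j (Z \<omega>) \<partial>M)"
    by (rule nn_integral_suminf) measurable
  also have "\<dots> = (\<Sum>j. ennreal (W n u ^ j / fact j) * BFRY_moment \<sigma> j (T n))"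
    by (simp only: nn_integral_initial_weight[OF n u(1)])
  also have "\<dots> = (\<integral>\<^sup>+z. ennreal (exp (- (T n - W n u) * z)) \<partial>BFRY \<sigma>)"
    by (rule suminf_BFRY_moment) (rule total_weight_nonneg[OF u(1)])
  finally show ?thesis by (simp only: total_weight_1)
qed

lemma AE_locally_finite: "AE \<omega> in M. locally_finite (Z \<omega>)"
proof -
  have "AE \<omega> in M. finite (support n (Z \<omega>))" for n
  proof (cases "1 \<le> n")
    case True
    show ?thesis
      using AE_ex_initial_support[OF True]
    proof eventually_elim
      fix \<omega> assume "\<exists>j. initial_support n j (Z \<omega>)"
      then obtain j where "initial_support n j (Z \<omega>)" ..
      then show "finite (support n (Z \<omega>))" by (simp add: initial_support_def)
    qed
  qed (simp add: not_le)
  then show ?thesis by (simp add: locally_finite_def AE_all_countable)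
qed

lemma feature_model_code_law:
  assumes "BFRY_feature_model_params N \<sigma> \<alpha> \<theta> \<xi> J Y" and n: "1 \<le> n"
  shows "distr M (count_space UNIV) (\<lambda>\<omega>. code n (Z \<omega>)) = distr N (count_space UNIV) (\<lambda>\<omega>. code n (Y \<omega>))"
proof -
  interpret F: BFRY_feature_model_params N \<sigma> \<alpha> \<theta> \<xi> J Y by fact
  show ?thesis
  proof (rule inverse_moments_unique)
    show "prob_space (distr M (count_space UNIV) (\<lambda>\<omega>. code n (Z \<omega>)))" by (rule prob_space_distr) simp
    show "prob_space (distr N (count_space UNIV) (\<lambda>\<omega>. code n (Y \<omega>)))" by (rule F.prob_space_distr) simp
    fix s :: nat assume s: "1 \<le> s"
    have "(\<integral>\<^sup>+\<omega>. ennreal ((1 / real (code n (Z \<omega>))) ^ s) \<partial>M) = (\<integral>\<^sup>+\<omega>. ennreal ((1 / real (code n (Y \<omega>))) ^ s) \<partial>N)"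
      unfolding INF_code_weight[OF s, symmetric]
      by (simp only: nn_integral_pattern_weights[of n "code_weight s", OF n code_weight_bounds]
        F.nn_integral_pattern_weights[of "code_weight s" n, OF code_weight_bounds])
    then show "(\<integral>\<^sup>+x. ennreal ((1 / real x) ^ s) \<partial>distr M (count_space UNIV) (\<lambda>\<omega>. code n (Z \<omega>))) =
      (\<integral>\<^sup>+x. ennreal ((1 / real x) ^ s) \<partial>distr N (count_space UNIV) (\<lambda>\<omega>. code n (Y \<omega>)))"
      by (subst (1 2) nn_integral_distr) simp_all
  qed simp_all
qed

theorem feature_model_equivalently_distributed:
  assumes F: "BFRY_feature_model_params N \<sigma> \<alpha> \<theta> \<xi> J Y"
  shows "equivalently_distributed M Z N Y"
proof -
  interpret F: BFRY_feature_model_params N \<sigma> \<alpha> \<theta> \<xi> J Y by fact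
  note law = feature_model_code_law[OF F]
  \<comment> \<open>Local finiteness of the feature model is read off from the equality of code
    laws: the urn's code is almost surely not 0, hence neither is this one.\<close>
  have "AE \<omega> in N. finite (support n (Y \<omega>))" for n
  proof (cases "1 \<le> n")
    case True
    have "AE \<omega> in M. code n (Z \<omega>) \<noteq> 0"
      using AE_locally_finite by eventually_elim (simp add: code_eq_0_iff locally_finite_def)
    then have "AE c in distr M (count_space UNIV) (\<lambda>\<omega>. code n (Z \<omega>)). c \<noteq> 0"
      by (subst AE_distr_iff) simp_all
    then have "AE c in distr N (count_space UNIV) (\<lambda>\<omega>. code n (Y \<omega>)). c \<noteq> 0"
      unfolding law[OF True] .
    then have "AE \<omega> in N. code n (Y \<omega>) \<noteq> 0"
      by (subst (asm) AE_distr_iff) simp_all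
    then show ?thesis by (simp add: code_eq_0_iff)
  qed (simp add: not_le)
  then have fin: "AE \<omega> in N. locally_finite (Y \<omega>)"
    by (simp add: locally_finite_def AE_all_countable)
  have "distr M (PiM UNIV (\<lambda>_. count_space UNIV)) (\<lambda>\<omega>. codes (Z \<omega>)) =
      distr N (PiM UNIV (\<lambda>_. count_space UNIV)) (\<lambda>\<omega>. codes (Y \<omega>))"
    by (rule codes_law_eqI[OF prob_space_axioms Z_meas F.Z_meas AE_locally_finite fin law])
  then show ?thesis
    unfolding equivalently_distributed_def
      distr_matrix_class[OF Z_meas AE_locally_finite] distr_matrix_class[OF F.Z_meas fin] by simp
qed

end

theorem proposition5p1:
  fixes \<sigma> \<alpha> \<theta> :: real
    and M :: "'a measure" and \<zeta> :: "'a \<Rightarrow> real"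
    and G V :: "nat \<Rightarrow> 'a \<Rightarrow> real" and H :: "nat \<Rightarrow> 'a \<Rightarrow> nat"
    and Z :: "'a \<Rightarrow> binary_matrix"
  assumes "0 < \<sigma>" "\<sigma> < 1" "0 < \<alpha>" "\<alpha> < 1" "0 < \<theta>"
    and "BFRY_urn M \<sigma> \<alpha> \<theta> \<zeta> G V H Z"
  shows "(\<forall>(N :: 'b measure) \<xi> J W. BFRY_feature_model N \<sigma> \<alpha> \<theta> \<xi> J W \<longrightarrow>
            equivalently_distributed M Z N W) \<and>
         (\<forall>n\<ge>1. distr M (count_space UNIV) (\<lambda>\<omega>. num_features (Z \<omega>) n) =
              Poisson_BFRY \<sigma> (\<Sum>j=1..n. phi \<alpha> \<theta> j) \<and>
            exhibits_power_law (\<lambda>j. \<P>(\<omega> in M. num_features (Z \<omega>) n = j)))"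
proof -
  have params: "urn_params \<sigma> \<alpha> \<theta>" using assms by unfold_locales
  then have urn: "BFRY_urn_params M \<sigma> \<alpha> \<theta> \<zeta> G V H Z"
    using assms by (intro BFRY_urn_params.intro)
  show ?thesis
  proof (intro conjI allI impI)
    fix N :: "'b measure" and \<xi> J W assume "BFRY_feature_model N \<sigma> \<alpha> \<theta> \<xi> J W"
    then have "BFRY_feature_model_params N \<sigma> \<alpha> \<theta> \<xi> J W"
      using params by (intro BFRY_feature_model_params.intro)
    then show "equivalently_distributed M Z N W"
      by (rule BFRY_urn_params.feature_model_equivalently_distributed[OF urn])
  qed (rule BFRY_urn_params.num_features_law[OF urn], assumption,
    rule BFRY_urn_params.num_features_power_law[OF urn], assumption)
qed

end
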